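(* For any quantum programs $P,Q$ (without recursive calls), and with $M=\{M_0,M_1\}$ a binary measurement, $$\mu X.\big(Q\vartriangleleft M\vartriangleright(P;X)\big)\;\equiv\;(M\ast P);Q .$$
   Context: A set $QV$ of quantum variables is given; each quantum variable $q$ has a Hilbert space $\mathcal H_q$; a register $\bar q$ is a sequence $q_1,\dots,q_n$ of distinct variables with space $\mathcal H_{\bar q}=\bigotimes_i\mathcal H_{q_i}$. $\mathcal H_{QV}$ is the state space of the composite system of all variables in $QV$; operators on $\mathcal H_{\bar q}$ are identified with their extensions by the identity. $\mathcal D(\mathcal H_{QV})$ is the set of partial density operators (positive operators of trace $\le1$) on $\mathcal H_{QV}$. Circuits: $C::=\mathbf{skip}\mid U[\bar q]\mid C_1;C_2\mid \mathbf{qif}\,[\bar q](\square_{i=1}^d|\psi_i\rangle\to C_i)\,\mathbf{fiq}$ ($U$ a unitary constant from a given set, $\{|\psi_i\rangle\}$ an orthonormal basis of $\mathcal H_{\bar q}$, $\bar q$ disjoint from the variables of all $C_i$), with unitary semantics $I$, $U_{\bar q}$, $[\![C_2]\!][\![C_1]\!]$, $\sum_i|\psi_i\rangle_{\bar q}\langle\psi_i|\otimes[\![C_i]\!]$ respectively. A measurement on $\bar q$ is a family $M=\{M_m\}$ of linear operators on $\mathcal H_{\bar q}$ with $\sum_mM_m^\dagger M_m=I$; it is binary if the outcomes are $0,1$. Programs: $P::=\mathbf{skip}\mid\mathbf{abort}\mid\bar q:=|\psi\rangle\mid C\mid P_1;P_2\mid\mathbf{if}\,M[\bar q](\square m\to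 P_m)\,\mathbf{fi}\mid\mathbf{while}\,M[\bar q]=1\,\mathbf{do}\,P\,\mathbf{od}$ (with $M$ binary in the loop). Semantics on $\mathcal D(\mathcal H_{QV})$: $[\![\mathbf{skip}]\!](\rho)=\rho$; $[\![\mathbf{abort}]\!](\rho)=0$; $[\![\bar q:=|\psi\rangle]\!](\rho)=\sum_n|\psi\rangle_{\bar q}\langle n|\rho|n\rangle_{\bar q}\langle\psi|$ ($\{|n\rangle\}$ an orthonormal basis of $\mathcal H_{\bar q}$); $[\![C]\!](\rho)=[\![C]\!]\rho[\![C]\!]^\dagger$; $[\![P_1;P_2]\!]=[\![P_2]\!]\circ[\![P_1]\!]$; $[\![\mathbf{if}\,M[\bar q](\square m\to P_m)\,\mathbf{fi}]\!](\rho)=\sum_m[\![P_m]\!](M_m\rho M_m^\dagger)$; $[\![\mathbf{while}\,M[\bar q]=1\,\mathbf{do}\,P\,\mathbf{od}]\!]=\sum_{n=0}^\infty\mathcal E_0\circ([\![P]\!]\circ\mathcal E_1)^n$ with $\mathcal E_i(\rho)=M_i\rho M_i^\dagger$. $P\equiv Q$ iff $[\![P]\!]=[\![Q]\!]$. Notation: $P_0\vartriangleleft M\vartriangleright P_1$ is the if-statement executing $P_0$ on outcome $0$ and $P_1$ on outcome $1$; $M\ast P$ is the loop $\mathbf{while}\,M[\bar q]=1\,\mathbf{do}\,P\,\mathbf{od}$ (the measured register is omitted from the notation). Recursion: for a program scheme $F(X)$ built from the program syntax with an additional program identifier $X$, $F(P)$ is $F(X)$ with $X$ replaced by $P$; $F^{(0)}=\mathbf{abort}$,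 $F^{(n+1)}=F(F^{(n)})$; and $[\![\mu X.F(X)]\!]=\bigsqcup_{n\ge0}[\![F^{(n)}]\!]$, the least upper bound in the CPO of quantum operations (trace-nonincreasing super-operators) on $\mathcal H_{QV}$ under the order $\mathcal E\sqsubseteq\mathcal F$ iff $\mathcal F(\rho)-\mathcal E(\rho)$ is positive semidefinite for all $\rho$. *)

theory Defs
  imports "HOL-Analysis.Analysis" "HOL-Algebra.Lattice"
begin

section \<open>Operators on \<open>\<ell>\<^sup>2(I)\<close>\<close>

text \<open>
  Every complex Hilbert space is, up to the choice of an orthonormal basis, \<open>\<ell>\<^sup>2(I)\<close> for a set \<open>I\<close>
  (of arbitrary cardinality) that indexes the basis. Vectors are functions supported in \<open>I\<close>, and a
  bounded operator \<open>A\<close> is given by its matrix \<open>A x y = \<langle>x|A|y\<rangle>\<close>, supported in \<open>I \<times> I\<close>. For bounded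
  operators the sums in \<open>app\<close>, \<open>cinner\<close> and \<open>mult\<close> below converge absolutely. Nothing is assumed
  about dimensions: for finite \<open>I\<close> these are ordinary matrices.
\<close>

type_synonym 'i vec = "'i \<Rightarrow> complex"
type_synonym 'i oper = "'i \<Rightarrow> 'i \<Rightarrow> complex"

definition ell2 :: "'i set \<Rightarrow> 'i vec set" where
  "ell2 I = {\<psi>. (\<forall>x. x \<notin> I \<longrightarrow> \<psi> x = 0) \<and> (\<lambda>x. (cmod (\<psi> x))\<^sup>2) summable_on I}"

definition cinner :: "'i set \<Rightarrow> 'i vec \<Rightarrow> 'i vec \<Rightarrow> complex" where
  "cinner I \<phi> \<psi> = (\<Sum>\<^sub>\<infinity>x\<in>I. cnj (\<phi> x) * \<psi> x)"

definition norm2 :: "'i set \<Rightarrow> 'i vec \<Rightarrow> real" where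
  "norm2 I \<psi> = sqrt (\<Sum>\<^sub>\<infinity>x\<in>I. (cmod (\<psi> x))\<^sup>2)"

definition app :: "'i set \<Rightarrow> 'i oper \<Rightarrow> 'i vec \<Rightarrow> 'i vec" where
  "app I A \<psi> = (\<lambda>x. \<Sum>\<^sub>\<infinity>y\<in>I. A x y * \<psi> y)"

definition bounded_op :: "'i set \<Rightarrow> 'i oper \<Rightarrow> bool" where
  "bounded_op I A \<longleftrightarrow>
     (\<forall>x y. x \<notin> I \<or> y \<notin> I \<longrightarrow> A x y = 0) \<and>
     (\<exists>K. \<forall>\<psi>\<in>ell2 I. (\<forall>x\<in>I. (\<lambda>y. A x y * \<psi> y) summable_on I) \<and>
                     app I A \<psi> \<in> ell2 I \<and> norm2 I (app I A \<psi>) \<le> K * norm2 I \<psi>)"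

definition id_op :: "'i set \<Rightarrow> 'i oper" where
  "id_op I = (\<lambda>x y. if x \<in> I \<and> x = y then 1 else 0)"

definition zero_op :: "'i oper" where
  "zero_op = (\<lambda>_ _. 0)"

definition adj :: "'i oper \<Rightarrow> 'i oper" where
  "adj A = (\<lambda>x y. cnj (A y x))"

definition mult :: "'i set \<Rightarrow> 'i oper \<Rightarrow> 'i oper \<Rightarrow> 'i oper" where
  "mult I A B = (\<lambda>x y. \<Sum>\<^sub>\<infinity>z\<in>I. A x z * B z y)"

text \<open>\<open>conjug I A \<rho>\<close> is \<open>A \<rho> A\<^sup>\<dagger>\<close>.\<close>

definition conjug :: "'i set \<Rightarrow> 'i oper \<Rightarrow> 'i oper \<Rightarrow> 'i oper" where
  "conjug I A \<rho> = mult I (mult I A \<rho>) (adj A)"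

definition ket :: "'i \<Rightarrow> 'i vec" where
  "ket n = (\<lambda>x. if x = n then 1 else 0)"

text \<open>\<open>ketbra \<psi> \<phi>\<close> is \<open>|\<psi>\<rangle>\<langle>\<phi>|\<close>.\<close>

definition ketbra :: "'i vec \<Rightarrow> 'i vec \<Rightarrow> 'i oper" where
  "ketbra \<psi> \<phi> = (\<lambda>x y. \<psi> x * cnj (\<phi> y))"

definition unitary :: "'i set \<Rightarrow> 'i oper \<Rightarrow> bool" where
  "unitary I U \<longleftrightarrow> bounded_op I U \<and> mult I (adj U) U = id_op I \<and> mult I U (adj U) = id_op I"

definition positive_op :: "'i set \<Rightarrow> 'i oper \<Rightarrow> bool" where
  "positive_op I A \<longleftrightarrow> bounded_op I A \<and> (\<forall>\<psi>\<in>ell2 I. cinner I \<psi> (app I A \<psi>) \<in> \<real>\<^sub>\<ge>\<^sub>0)"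

definition trace :: "'i set \<Rightarrow> 'i oper \<Rightarrow> complex" where
  "trace I A = (\<Sum>\<^sub>\<infinity>x\<in>I. A x x)"

definition partial_density :: "'i set \<Rightarrow> 'i oper set" where
  "partial_density I =
     {\<rho>. positive_op I \<rho> \<and> (\<lambda>x. \<rho> x x) summable_on I \<and> Re (trace I \<rho>) \<le> 1}"

definition orthonormal_basis :: "'i set \<Rightarrow> 'k set \<Rightarrow> ('k \<Rightarrow> 'i vec) \<Rightarrow> bool" where
  "orthonormal_basis I K \<psi> \<longleftrightarrow>
     (\<forall>k\<in>K. \<psi> k \<in> ell2 I) \<and>
     (\<forall>k\<in>K. \<forall>l\<in>K. cinner I (\<psi> k) (\<psi> l) = (if k = l then 1 else 0)) \<and>
     (\<forall>\<phi>\<in>ell2 I. (\<forall>k\<in>K. cinner I (\<psi> k) \<phi> = 0) \<longrightarrow> \<phi> = (\<lambda>_. 0))"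


section \<open>The CPO of quantum operations\<close>

text \<open>
  The trace class operators, as the complex linear span of the partial density operators (every
  trace class operator is a combination of four positive ones).
\<close>

definition trace_class :: "'i set \<Rightarrow> 'i oper set" where
  "trace_class I =
     {A. \<exists>(n::nat) (c :: nat \<Rightarrow> complex) \<rho>.
           (\<forall>k<n. \<rho> k \<in> partial_density I) \<and> A = (\<lambda>x y. \<Sum>k<n. c k * \<rho> k x y)}"

text \<open>
  Positivity of the operator on \<open>\<complex>\<^sup>n \<otimes> \<ell>\<^sup>2(I)\<close> with blocks \<open>R a b\<close>. The map \<open>id \<otimes> \<E>\<close> acts blockwise.
\<close>

definition block_positive :: "'i set \<Rightarrow> nat \<Rightarrow> (nat \<Rightarrow> nat \<Rightarrow> 'i oper) \<Rightarrow> bool" where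
  "block_positive I n R \<longleftrightarrow>
     (\<forall>\<psi> :: nat \<Rightarrow> 'i vec. (\<forall>a<n. \<psi> a \<in> ell2 I) \<longrightarrow>
        (\<Sum>a<n. \<Sum>b<n. cinner I (\<psi> a) (app I (R a b) (\<psi> b))) \<in> \<real>\<^sub>\<ge>\<^sub>0)"

definition completely_positive :: "'i set \<Rightarrow> ('i oper \<Rightarrow> 'i oper) \<Rightarrow> bool" where
  "completely_positive I \<E> \<longleftrightarrow>
     (\<forall>n R. (\<forall>a<n. \<forall>b<n. R a b \<in> trace_class I) \<and> block_positive I n R \<longrightarrow>
            block_positive I n (\<lambda>a b. \<E> (R a b)))"

text \<open>Outside the trace class a quantum operation has a fixed dummy value.\<close>

definition quantum_operation :: "'i set \<Rightarrow> ('i oper \<Rightarrow> 'i oper) \<Rightarrow> bool" where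
  "quantum_operation I \<E> \<longleftrightarrow>
     (\<forall>A\<in>trace_class I. \<E> A \<in> trace_class I) \<and>
     (\<forall>A\<in>trace_class I. \<forall>B\<in>trace_class I. \<E> (\<lambda>x y. A x y + B x y) = (\<lambda>x y. \<E> A x y + \<E> B x y)) \<and>
     (\<forall>c. \<forall>A\<in>trace_class I. \<E> (\<lambda>x y. c * A x y) = (\<lambda>x y. c * \<E> A x y)) \<and>
     completely_positive I \<E> \<and>
     (\<forall>\<rho>\<in>partial_density I. Re (trace I (\<E> \<rho>)) \<le> Re (trace I \<rho>)) \<and>
     (\<forall>A. A \<notin> trace_class I \<longrightarrow> \<E> A = zero_op)"

definition restrict_tc :: "'i set \<Rightarrow> ('i oper \<Rightarrow> 'i oper) \<Rightarrow> 'i oper \<Rightarrow> 'i oper" where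
  "restrict_tc I \<E> = (\<lambda>A. if A \<in> trace_class I then \<E> A else zero_op)"

definition qop_le :: "'i set \<Rightarrow> ('i oper \<Rightarrow> 'i oper) \<Rightarrow> ('i oper \<Rightarrow> 'i oper) \<Rightarrow> bool" where
  "qop_le I \<E> \<F> \<longleftrightarrow> (\<forall>\<rho>\<in>partial_density I. positive_op I (\<lambda>x y. \<F> \<rho> x y - \<E> \<rho> x y))"

definition qop_order :: "'i set \<Rightarrow> ('i oper \<Rightarrow> 'i oper) gorder" where
  "qop_order I = \<lparr> carrier = {\<E>. quantum_operation I \<E>}, eq = (=), le = qop_le I \<rparr>"


section \<open>Quantum variables and registers\<close>

text \<open>
  The space of a variable \<open>v \<in> vars S\<close> is \<open>\<ell>\<^sup>2(basis S v)\<close>. A finite tensor product of spaces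
  \<open>\<ell>\<^sup>2(B\<^sub>i)\<close> is \<open>\<ell>\<^sup>2\<close> of the Cartesian product of the \<open>B\<^sub>i\<close>. The component \<open>ref\<close> only matters when
  \<open>vars S\<close> is infinite: then the composite system is the incomplete (von Neumann) tensor product
  with reference unit vectors \<open>|ref S v\<rangle>\<close>, whose basis consists of the configurations that differ
  from \<open>ref S\<close> at finitely many variables (see the lemma \<open>configs_finite\<close>). The set \<open>gates S\<close>
  is the given set of unitary constants.
\<close>

record ('v, 'b) qsystem =
  vars :: "'v set"
  basis :: "'v \<Rightarrow> 'b set"
  ref :: "'v \<Rightarrow> 'b"
  gates :: "'b list oper set"

definition qsystem :: "('v, 'b) qsystem \<Rightarrow> bool" where
  "qsystem S \<longleftrightarrow> (\<forall>v\<in>vars S. ref S v \<in> basis S v)"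

definition configs :: "('v, 'b) qsystem \<Rightarrow> ('v \<Rightarrow> 'b) set" where
  "configs S = {x \<in> PiE (vars S) (basis S). finite {v \<in> vars S. x v \<noteq> ref S v}}"

lemma configs_finite: "finite (vars S) \<Longrightarrow> configs S = PiE (vars S) (basis S)"
  by (auto simp: configs_def)

definition register :: "('v, 'b) qsystem \<Rightarrow> 'v list \<Rightarrow> bool" where
  "register S qs \<longleftrightarrow> distinct qs \<and> set qs \<subseteq> vars S"

definition reg_basis :: "('v, 'b) qsystem \<Rightarrow> 'v list \<Rightarrow> 'b list set" where
  "reg_basis S qs = listset (map (basis S) qs)"

text \<open>The extension of an operator on the register \<open>qs\<close> by the identity on all other variables.\<close>

definition extend :: "('v, 'b) qsystem \<Rightarrow> 'v list \<Rightarrow> 'b list oper \<Rightarrow> ('v \<Rightarrow> 'b) oper" where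
  "extend S qs A = (\<lambda>x y.
     if x \<in> configs S \<and> y \<in> configs S \<and> (\<forall>v. v \<notin> set qs \<longrightarrow> x v = y v)
     then A (map x qs) (map y qs) else 0)"

text \<open>
  Completeness \<open>\<Sum>\<^sub>m M\<^sub>m\<^sup>\<dagger> M\<^sub>m = I\<close> is read entrywise, which for infinitely many outcomes is the usual
  weak (equivalently, strong) convergence since the partial sums are increasing and bounded.
\<close>

definition measurement ::
    "('v, 'b) qsystem \<Rightarrow> 'v list \<Rightarrow> nat set \<Rightarrow> (nat \<Rightarrow> 'b list oper) \<Rightarrow> bool" where
  "measurement S qs outs M \<longleftrightarrow>
     (\<forall>m\<in>outs. bounded_op (reg_basis S qs) (M m)) \<and>
     (\<forall>x\<in>reg_basis S qs. \<forall>y\<in>reg_basis S qs.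
        ((\<lambda>m. mult (reg_basis S qs) (adj (M m)) (M m) x y) has_sum id_op (reg_basis S qs) x y) outs)"


section \<open>Circuits\<close>

text \<open>In \<open>QIf qs d \<psi> C\<close> only the branches \<open>\<psi> i\<close>, \<open>C i\<close> with \<open>i \<in> {1..d}\<close> are meaningful.\<close>

datatype ('v, 'b) circuit =
    CSkip
  | CGate "'b list oper" "'v list"
  | CSeq "('v, 'b) circuit" "('v, 'b) circuit"
  | QIf "'v list" nat "nat \<Rightarrow> 'b list vec" "nat \<Rightarrow> ('v, 'b) circuit"

primrec cvars :: "('v, 'b) circuit \<Rightarrow> 'v set" where
  "cvars CSkip = {}"
| "cvars (CGate U qs) = set qs"
| "cvars (CSeq C1 C2) = cvars C1 \<union> cvars C2"
| "cvars (QIf qs d \<psi> C) = set qs \<union> (\<Union>i\<in>{1..d}. cvars (C i))"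

primrec wf_circuit :: "('v, 'b) qsystem \<Rightarrow> ('v, 'b) circuit \<Rightarrow> bool" where
  "wf_circuit S CSkip \<longleftrightarrow> True"
| "wf_circuit S (CGate U qs) \<longleftrightarrow> register S qs \<and> U \<in> gates S \<and> unitary (reg_basis S qs) U"
| "wf_circuit S (CSeq C1 C2) \<longleftrightarrow> wf_circuit S C1 \<and> wf_circuit S C2"
| "wf_circuit S (QIf qs d \<psi> C) \<longleftrightarrow>
     register S qs \<and> orthonormal_basis (reg_basis S qs) {1..d} \<psi> \<and>
     (\<forall>i\<in>{1..d}. wf_circuit S (C i) \<and> set qs \<inter> cvars (C i) = {})"

text \<open>
  In the last clause \<open>|\<psi>\<^sub>i\<rangle>\<langle>\<psi>\<^sub>i| \<otimes> [[C\<^sub>i]]\<close> is the product of the extensions of both factors to the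
  whole system.
\<close>

primrec csem :: "('v, 'b) qsystem \<Rightarrow> ('v, 'b) circuit \<Rightarrow> ('v \<Rightarrow> 'b) oper" where
  "csem S CSkip = id_op (configs S)"
| "csem S (CGate U qs) = extend S qs U"
| "csem S (CSeq C1 C2) = mult (configs S) (csem S C2) (csem S C1)"
| "csem S (QIf qs d \<psi> C) = (\<lambda>x y. \<Sum>i\<in>{1..d}.
     mult (configs S) (extend S qs (ketbra (\<psi> i) (\<psi> i))) (csem S (C i)) x y)"


section \<open>Programs and program schemes\<close>

text \<open>
  Program schemes \<open>F(X)\<close> are built with the identifier \<open>X\<close> (constructor \<open>Ident\<close>); programs proper
  are the well-formed schemes without it. In \<open>Meas qs outs M P\<close> only outcomes \<open>m \<in> outs\<close> matter.
\<close>

datatype ('v, 'b) prog =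
    Skip
  | Abort
  | Init "'v list" "'b list vec"
  | Circ "('v, 'b) circuit"
  | Seq "('v, 'b) prog" "('v, 'b) prog"
  | Meas "'v list" "nat set" "nat \<Rightarrow> 'b list oper" "nat \<Rightarrow> ('v, 'b) prog"
  | While "'v list" "nat \<Rightarrow> 'b list oper" "('v, 'b) prog"
  | Ident

primrec wf_prog :: "('v, 'b) qsystem \<Rightarrow> ('v, 'b) prog \<Rightarrow> bool" where
  "wf_prog S Skip \<longleftrightarrow> True"
| "wf_prog S Abort \<longleftrightarrow> True"
| "wf_prog S (Init qs \<psi>) \<longleftrightarrow>
     register S qs \<and> \<psi> \<in> ell2 (reg_basis S qs) \<and> norm2 (reg_basis S qs) \<psi> = 1"
| "wf_prog S (Circ C) \<longleftrightarrow> wf_circuit S C"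
| "wf_prog S (Seq P1 P2) \<longleftrightarrow> wf_prog S P1 \<and> wf_prog S P2"
| "wf_prog S (Meas qs outs M P) \<longleftrightarrow>
     register S qs \<and> measurement S qs outs M \<and> (\<forall>m\<in>outs. wf_prog S (P m))"
| "wf_prog S (While qs M P) \<longleftrightarrow> register S qs \<and> measurement S qs {0, 1} M \<and> wf_prog S P"
| "wf_prog S Ident \<longleftrightarrow> True"

primrec calls :: "('v, 'b) prog \<Rightarrow> bool" where
  "calls Skip \<longleftrightarrow> False"
| "calls Abort \<longleftrightarrow> False"
| "calls (Init qs \<psi>) \<longleftrightarrow> False"
| "calls (Circ C) \<longleftrightarrow> False"
| "calls (Seq P1 P2) \<longleftrightarrow> calls P1 \<or> calls P2"
| "calls (Meas qs outs M P) \<longleftrightarrow> (\<exists>m\<in>outs. calls (P m))"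
| "calls (While qs M P) \<longleftrightarrow> calls P"
| "calls Ident \<longleftrightarrow> True"

definition program :: "('v, 'b) qsystem \<Rightarrow> ('v, 'b) prog \<Rightarrow> bool" where
  "program S P \<longleftrightarrow> wf_prog S P \<and> \<not> calls P"

definition meas_op ::
    "('v, 'b) qsystem \<Rightarrow> 'v list \<Rightarrow> 'b list oper \<Rightarrow> ('v \<Rightarrow> 'b) oper \<Rightarrow> ('v \<Rightarrow> 'b) oper" where
  "meas_op S qs A \<rho> = conjug (configs S) (extend S qs A) \<rho>"

text \<open>
  The infinite sums are taken entrywise. On partial density operators their terms are positive and
  the traces of the partial sums are bounded, so that entrywise, weak and trace norm convergence
  coincide. For \<open>Init\<close> the basis \<open>{|n\<rangle>}\<close> is the standard one. The value at \<open>Ident\<close> is irrelevant,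
  as only programs without identifier are interpreted.
\<close>

primrec psem :: "('v, 'b) qsystem \<Rightarrow> ('v, 'b) prog \<Rightarrow> ('v \<Rightarrow> 'b) oper \<Rightarrow> ('v \<Rightarrow> 'b) oper" where
  "psem S Skip = (\<lambda>\<rho>. \<rho>)"
| "psem S Abort = (\<lambda>\<rho>. zero_op)"
| "psem S (Init qs \<psi>) = (\<lambda>\<rho> x y. \<Sum>\<^sub>\<infinity>n\<in>reg_basis S qs.
     conjug (configs S) (extend S qs (ketbra \<psi> (ket n))) \<rho> x y)"
| "psem S (Circ C) = (\<lambda>\<rho>. conjug (configs S) (csem S C) \<rho>)"
| "psem S (Seq P1 P2) = psem S P2 \<circ> psem S P1"
| "psem S (Meas qs outs M P) = (\<lambda>\<rho> x y. \<Sum>\<^sub>\<infinity>m\<in>outs. psem S (P m) (meas_op S qs (M m) \<rho>) x y)"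
| "psem S (While qs M P) = (\<lambda>\<rho> x y. \<Sum>n.
     (meas_op S qs (M 0) \<circ> (psem S P \<circ> meas_op S qs (M 1)) ^^ n) \<rho> x y)"
| "psem S Ident = undefined"

text \<open>\<open>P\<^sub>0 \<triangleleft> M \<triangleright> P\<^sub>1\<close>, with the measured register made explicit.\<close>

definition Cond :: "'v list \<Rightarrow> ('v, 'b) prog \<Rightarrow> (nat \<Rightarrow> 'b list oper) \<Rightarrow> ('v, 'b) prog \<Rightarrow> ('v, 'b) prog"
  where "Cond qs P0 M P1 = Meas qs {0, 1} M (\<lambda>m. if m = 0 then P0 else P1)"


section \<open>Recursion\<close>

primrec subst :: "('v, 'b) prog \<Rightarrow> ('v, 'b) prog \<Rightarrow> ('v, 'b) prog" where
  "subst Skip R = Skip"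
| "subst Abort R = Abort"
| "subst (Init qs \<psi>) R = Init qs \<psi>"
| "subst (Circ C) R = Circ C"
| "subst (Seq P1 P2) R = Seq (subst P1 R) (subst P2 R)"
| "subst (Meas qs outs M P) R = Meas qs outs M (\<lambda>m. subst (P m) R)"
| "subst (While qs M P) R = While qs M (subst P R)"
| "subst Ident R = R"

primrec approx :: "('v, 'b) prog \<Rightarrow> nat \<Rightarrow> ('v, 'b) prog" where
  "approx F 0 = Abort"
| "approx F (Suc n) = subst F (approx F n)"

text \<open>\<open>Mu F\<close> stands for \<open>\<mu>X. F(X)\<close>.\<close>

datatype ('v, 'b) rprog = Plain "('v, 'b) prog" | Mu "('v, 'b) prog"

primrec den :: "('v, 'b) qsystem \<Rightarrow> ('v, 'b) rprog \<Rightarrow> ('v \<Rightarrow> 'b) oper \<Rightarrow> ('v \<Rightarrow> 'b) oper" where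
  "den S (Plain P) = psem S P"
| "den S (Mu F) =
     supr (qop_order (configs S)) UNIV (\<lambda>n. restrict_tc (configs S) (psem S (approx F n)))"

definition prog_equiv :: "('v, 'b) qsystem \<Rightarrow> ('v, 'b) rprog \<Rightarrow> ('v, 'b) rprog \<Rightarrow> bool" where
  "prog_equiv S P Q \<longleftrightarrow> (\<forall>\<rho>\<in>partial_density (configs S). den S P \<rho> = den S Q \<rho>)"

end

theory Submission
  imports Defs
begin

text \<open>
  Unfolding the recursion \<open>n\<close> times gives \<open>[[Q]] \<circ> \<Sum>\<^sub>k\<^sub><\<^sub>n \<E>\<^sub>0 \<circ> ([[P]] \<circ> \<E>\<^sub>1)\<^sup>k\<close>, by induction on \<open>n\<close>
  and linearity of \<open>[[Q]]\<close>. The right-hand side is \<open>[[Q]]\<close> applied to the full series, so the claim is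
  that these partial sums have the composite as least upper bound. This needs that every program
  denotes a quantum operation and that quantum operations are normal.

  Trace class operators are handled through their matrices: a matrix with summable diagonal is a
  positive trace class operator iff all its finite quadratic forms are nonnegative, a property that
  survives entrywise limits. Its entries satisfy \<open>\<bar>\<rho>\<^sub>x\<^sub>y\<bar>\<^sup>2 \<le> \<rho>\<^sub>x\<^sub>x \<rho>\<^sub>y\<^sub>y\<close>, which makes all matrix products
  converge absolutely and reduces trace norm convergence of increasing sequences to convergence of
  the diagonal entries. Circuits and measurements enter only as contractions, a condition
  on finite submatrices.
\<close>

section \<open>Positive semidefinite kernels\<close>

text \<open>\<open>supr\<close> is a Hilbert choice of a least upper bound among all quantum
  operations, so only its order properties are known. The competing upper bounds are arbitrary maps,
  given without any Kraus form. They are compared with the limit one partial density at a time: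
  positivity of a difference passes to entrywise limits, and two bounds below each other agree there
  by \<open>psd_antisym\<close>. Infinite sums arise from the basis of an initialised register, the
  outcomes of a measurement and the iterations of a loop. All three go through
  \<open>qop_infsum\<close>, which asks that the traces of any finitely many terms together stay
  below the trace of the input. This joint condition is stronger than trace nonincrease of each
  term. It is the reason for stacking operators into one matrix; for loops it comes from a
  telescoping estimate. Contractions replace isometries because a finite submatrix of an isometry is
  only a contraction. The delicate construct is the quantum if-statement: a sum of contractions is
  in general no contraction, and orthogonality of the branches can be exploited only because the
  branch circuits act trivially on the control register, which is tracked by
  \<open>trivial_on\<close>.\<close>

definition psd :: "'k set \<Rightarrow> ('k \<Rightarrow> 'k \<Rightarrow> complex) \<Rightarrow> bool" where
  "psd K R \<longleftrightarrow> (\<forall>F c. finite F \<and> F \<subseteq> K \<longrightarrow>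
     (\<Sum>x\<in>F. \<Sum>y\<in>F. cnj (c x) * R x y * c y) \<in> \<real>\<^sub>\<ge>\<^sub>0)"

lemma psdD:
  "psd K R \<Longrightarrow> finite F \<Longrightarrow> F \<subseteq> K \<Longrightarrow> (\<Sum>x\<in>F. \<Sum>y\<in>F. cnj (c x) * R x y * c y) \<in> \<real>\<^sub>\<ge>\<^sub>0"
  by (auto simp: psd_def)

lemma psd_subset: "psd K R \<Longrightarrow> L \<subseteq> K \<Longrightarrow> psd L R"
  unfolding psd_def by (meson subset_trans)

lemma psd_cong:
  assumes "psd K R" "\<And>x y. x \<in> K \<Longrightarrow> y \<in> K \<Longrightarrow> R' x y = R x y"
  shows "psd K R'"
  unfolding psd_def
proof (intro allI impI)
  fix F c assume F: "finite F \<and> F \<subseteq> K"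
  have "(\<Sum>x\<in>F. \<Sum>y\<in>F. cnj (c x) * R' x y * c y) = (\<Sum>x\<in>F. \<Sum>y\<in>F. cnj (c x) * R x y * c y)"
    using F assms(2) by (intro sum.cong refl) (auto simp: subset_iff)
  then show "(\<Sum>x\<in>F. \<Sum>y\<in>F. cnj (c x) * R' x y * c y) \<in> \<real>\<^sub>\<ge>\<^sub>0"
    using psdD[OF assms(1), of F c] F by simp
qed

text \<open>Each form involves finitely many entries, and the nonnegative reals are closed in the
  complex plane. The filter is arbitrary because limits are taken along \<open>sequentially\<close>
  as well as along finite subsets.\<close>

lemma psd_limit:
  assumes "\<F> \<noteq> bot" "eventually (\<lambda>t. psd K (R t)) \<F>"
    and "\<And>x y. x \<in> K \<Longrightarrow> y \<in> K \<Longrightarrow> ((\<lambda>t. R t x y) \<longlongrightarrow> R' x y) \<F>"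
  shows "psd K R'"
  unfolding psd_def
proof (intro allI impI)
  fix F c assume F: "finite F \<and> F \<subseteq> K"
  show "(\<Sum>x\<in>F. \<Sum>y\<in>F. cnj (c x) * R' x y * c y) \<in> \<real>\<^sub>\<ge>\<^sub>0"
  proof (rule Lim_in_closed_set[OF closed_nonneg_Reals_complex])
    show "((\<lambda>t. \<Sum>x\<in>F. \<Sum>y\<in>F. cnj (c x) * R t x y * c y) \<longlongrightarrow>
        (\<Sum>x\<in>F. \<Sum>y\<in>F. cnj (c x) * R' x y * c y)) \<F>"
      using F assms(3) by (intro tendsto_sum tendsto_mult tendsto_const) auto
    show "\<forall>\<^sub>F t in \<F>. (\<Sum>x\<in>F. \<Sum>y\<in>F. cnj (c x) * R t x y * c y) \<in> \<real>\<^sub>\<ge>\<^sub>0"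
      using assms(2) by eventually_elim (use F psdD in blast)
  qed (use assms(1) in auto)
qed

lemma psd_add:
  assumes "psd K R" "psd K R'"
  shows "psd K (\<lambda>x y. R x y + R' x y)"
  unfolding psd_def
proof (intro allI impI)
  fix F c assume F: "finite F \<and> F \<subseteq> K"
  have "(\<Sum>x\<in>F. \<Sum>y\<in>F. cnj (c x) * (R x y + R' x y) * c y) =
      (\<Sum>x\<in>F. \<Sum>y\<in>F. cnj (c x) * R x y * c y) + (\<Sum>x\<in>F. \<Sum>y\<in>F. cnj (c x) * R' x y * c y)"
    by (simp add: algebra_simps sum.distrib)
  then show "(\<Sum>x\<in>F. \<Sum>y\<in>F. cnj (c x) * (R x y + R' x y) * c y) \<in> \<real>\<^sub>\<ge>\<^sub>0"
    using psdD[OF assms(1), of F c] psdD[OF assms(2), of F c] F by simp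
qed

lemma psd_zero: "psd K (\<lambda>_ _. 0)"
  by (simp add: psd_def)

lemma psd_sum:
  "(\<And>j. j \<in> J \<Longrightarrow> psd K (R j)) \<Longrightarrow> psd K (\<lambda>x y. \<Sum>j\<in>J. R j x y)"
  by (induction J rule: infinite_finite_induct) (auto simp: psd_zero psd_add)

lemma psd_scale:
  assumes "psd K R" "0 \<le> t"
  shows "psd K (\<lambda>x y. complex_of_real t * R x y)"
  unfolding psd_def
proof (intro allI impI)
  fix F c assume F: "finite F \<and> F \<subseteq> K"
  have "(\<Sum>x\<in>F. \<Sum>y\<in>F. cnj (c x) * (of_real t * R x y) * c y) =
      of_real t * (\<Sum>x\<in>F. \<Sum>y\<in>F. cnj (c x) * R x y * c y)"
    by (simp add: sum_distrib_left mult_ac)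
  then show "(\<Sum>x\<in>F. \<Sum>y\<in>F. cnj (c x) * (of_real t * R x y) * c y) \<in> \<real>\<^sub>\<ge>\<^sub>0"
    using psdD[OF assms(1), of F c] assms(2) F by simp
qed

lemma psd_diag: "psd K R \<Longrightarrow> x \<in> K \<Longrightarrow> R x x \<in> \<real>\<^sub>\<ge>\<^sub>0"
  using psdD[of K R "{x}" "\<lambda>_. 1"] by simp

lemma psd_diag_Re: "psd K R \<Longrightarrow> x \<in> K \<Longrightarrow> 0 \<le> Re (R x x) \<and> R x x = of_real (Re (R x x))"
  using psd_diag[of K R x] by (auto simp: complex_nonneg_Reals_iff complex_eq_iff)

lemma psd_pair:
  assumes "psd K R" "x \<in> K" "y \<in> K" "x \<noteq> y"
  shows "cnj a * R x x * a + cnj a * R x y * b + (cnj b * R y x * a + cnj b * R y y * b) \<in> \<real>\<^sub>\<ge>\<^sub>0"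
  using psdD[OF assms(1), of "{x,y}" "\<lambda>z. if z = x then a else b"] assms by auto

text \<open>Hermitian symmetry is hidden in the forms being real: the vector \<open>(1, 1)\<close>
  makes the imaginary parts of \<open>R x y\<close> and \<open>R y x\<close> opposite, and
  \<open>(1, \<i>)\<close> makes their real parts equal.\<close>

lemma psd_hermitian:
  assumes "psd K R" "x \<in> K" "y \<in> K"
  shows "R y x = cnj (R x y)"
proof (cases "x = y")
  case True
  then show ?thesis using psd_diag[OF assms(1,2)] by (auto simp: complex_nonneg_Reals_iff complex_eq_iff)
next
  case False
  from psd_pair[OF assms False, of 1 1] psd_pair[OF assms False, of 1 \<i>]
    psd_diag[OF assms(1,2)] psd_diag[OF assms(1,3)]
  show ?thesis by (auto simp: complex_nonneg_Reals_iff complex_eq_iff)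
qed

lemma psd_Cauchy_Schwarz:
  assumes "psd K R" "x \<in> K" "y \<in> K"
  shows "(cmod (R x y))\<^sup>2 \<le> Re (R x x) * Re (R y y)"
proof (cases "x = y")
  case True
  have "cmod (R y y) = Re (R y y)"
    using psd_diag_Re[OF assms(1,3)] by (metis abs_of_nonneg norm_of_real)
  then show ?thesis using True by (simp add: power2_eq_square)
next
  case False
  define p q n where "p = Re (R x x)" and "q = Re (R y y)" and "n = (cmod (R x y))\<^sup>2"
  have pq: "0 \<le> p" "R x x = of_real p" "0 \<le> q" "R y y = of_real q"
    using psd_diag_Re[OF assms(1,2)] psd_diag_Re[OF assms(1,3)] by (auto simp: p_def q_def)
  have yx: "R y x = cnj (R x y)"
    by (rule psd_hermitian[OF assms])
  \<comment> \<open>The form at the vector \<open>(R x y, - s)\<close>: its phase turns both mixed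
    terms into the real number \<open>- s * n\<close>, which leaves a real quadratic polynomial in
    \<open>s\<close>.\<close>
  have key: "0 \<le> n * p - 2 * s * n + s\<^sup>2 * q" for s
  proof -
    have n: "cnj (R x y) * R x y = of_real n" "R x y * cnj (R x y) = of_real n"
      unfolding n_def complex_norm_square by (simp_all add: mult.commute)
    have "cnj (R x y) * R x x * R x y = of_real (n * p)"
      using n pq by (simp add: mult_ac)
    moreover have "cnj (R x y) * R x y * of_real (- s) = of_real (- s * n)"
      using n by simp
    moreover have "cnj (of_real (- s)) * R y x * R x y = of_real (- s * n)"
      using n yx by (simp add: mult.assoc)
    moreover have "cnj (of_real (- s)) * R y y * of_real (- s) = of_real (s\<^sup>2 * q)"
      using pq by (simp add: power2_eq_square mult_ac)
    ultimately have "complex_of_real (n * p) + of_real (- s * n) + (of_real (- s * n) + of_real (s\<^sup>2 * q)) \<in> \<real>\<^sub>\<ge>\<^sub>0"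
      using psd_pair[OF assms False, of "R x y" "of_real (- s)"] by metis
    then have "complex_of_real (n * p - 2 * s * n + s\<^sup>2 * q) \<in> \<real>\<^sub>\<ge>\<^sub>0"
      by (simp add: algebra_simps)
    then show ?thesis by (simp only: nonneg_Reals_of_real_iff)
  qed
  have "n \<le> p * q"
  proof (cases "q = 0")
    case True
    show ?thesis
    proof (rule ccontr)
      assume "\<not> n \<le> p * q"
      then have "n > 0" using True by simp
      \<comment> \<open>For \<open>q = 0\<close> the polynomial is linear in \<open>s\<close> with
        slope \<open>- 2 * n\<close>, and \<open>s = p + 1\<close> is large enough to make it
        negative.\<close>
      moreover have "0 \<le> n * (p - 2 * (p + 1))"
        using key[of "p + 1"] True by (simp add: algebra_simps)
      ultimately show False using pq by (simp add: zero_le_mult_iff)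
    qed
  next
    case False
    then have q: "q > 0" using pq by simp
    \<comment> \<open>The minimum of the polynomial is at \<open>s = n / q\<close>.\<close>
    have "0 \<le> n * p - n * n / q"
      using key[of "n / q"] q by (simp add: power2_eq_square field_simps)
    then have "n * n \<le> n * (p * q)"
      using q by (simp add: field_simps)
    moreover have "n \<ge> 0" by (simp add: n_def)
    ultimately show ?thesis
      using pq by (cases "n = 0") auto
  qed
  then show ?thesis by (simp add: n_def p_def q_def)
qed

text \<open>The induction step splits off the Schur complement of one diagonal entry.\<close>

lemma psd_decompose:
  assumes "finite F" "psd F R"
  shows "\<exists>v. \<forall>x\<in>F. \<forall>y\<in>F. R x y = (\<Sum>k\<in>F. v k x * cnj (v k y))"
  using assms
proof (induction F arbitrary: R rule: finite_induct)
  case empty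
  then show ?case by simp
next
  case (insert a F)
  define p where "p = Re (R a a)"
  have p: "0 \<le> p" "R a a = of_real p"
    using psd_diag_Re[OF insert.prems, of a] by (auto simp: p_def)
  have herm: "R y x = cnj (R x y)" if "x \<in> insert a F" "y \<in> insert a F" for x y
    using psd_hermitian[OF insert.prems that] .
  show ?case
  proof (cases "p = 0")
    case True
    \<comment> \<open>By Cauchy-Schwarz a zero diagonal entry kills its row and column.\<close>
    have z: "R a x = 0" "R x a = 0" if "x \<in> insert a F" for x
      using psd_Cauchy_Schwarz[OF insert.prems _ that, of a] herm[of a x] that True
      by (auto simp: p_def)
    obtain v where v: "\<forall>x\<in>F. \<forall>y\<in>F. R x y = (\<Sum>k\<in>F. v k x * cnj (v k y))"
      using insert.IH[OF psd_subset[OF insert.prems]] by blast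
    define w where "w k x = (if k = a \<or> x = a then 0 else v k x)" for k x
    have "R x y = (\<Sum>k\<in>insert a F. w k x * cnj (w k y))"
      if "x \<in> insert a F" "y \<in> insert a F" for x y
    proof (cases "x = a \<or> y = a")
      case True
      then show ?thesis using z that by (auto simp: w_def)
    next
      case False
      have "(\<Sum>k\<in>insert a F. w k x * cnj (w k y)) = (\<Sum>k\<in>F. w k x * cnj (w k y))"
        using insert.hyps by (simp add: w_def)
      also have "\<dots> = (\<Sum>k\<in>F. v k x * cnj (v k y))"
        using insert.hyps False by (intro sum.cong) (auto simp: w_def)
      finally show ?thesis using v that False by simp
    qed
    then show ?thesis by blast
  next
    case False
    then have p0: "p > 0" using p by simp
    define R' where "R' x y = R x y - R x a * R a y / of_real p" for x y
    have "psd F R'"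
      unfolding psd_def
    proof (intro allI impI)
      fix G c assume G: "finite G \<and> G \<subseteq> F"
      then have aG: "a \<notin> G" using insert.hyps by auto
      define s where "s = (\<Sum>y\<in>G. R a y * c y)"
      have s': "(\<Sum>x\<in>G. cnj (c x) * R x a) = cnj s"
        using herm[of a] G by (auto simp: s_def mult.commute intro!: sum.cong)
      \<comment> \<open>The value at \<open>a\<close> that minimises the form once the other
        coordinates are fixed; the minimum is the form of the Schur complement \<open>R'\<close> at
        \<open>c\<close>.\<close>
      define c' where "c' x = (if x = a then - s / of_real p else c x)" for x
      have c': "c' x = c x" if "x \<in> G" for x
        using that aG by (auto simp: c'_def)
      have c'a: "c' a = - s / of_real p" by (simp add: c'_def)
      have "(\<Sum>x\<in>insert a G. \<Sum>y\<in>insert a G. cnj (c' x) * R x y * c' y) =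
          cnj (c' a) * R a a * c' a + (\<Sum>y\<in>G. cnj (c' a) * R a y * c y) +
          ((\<Sum>x\<in>G. cnj (c x) * R x a * c' a) + (\<Sum>x\<in>G. \<Sum>y\<in>G. cnj (c x) * R x y * c y))"
        using G aG by (simp add: c' sum.distrib algebra_simps)
      also have "(\<Sum>y\<in>G. cnj (c' a) * R a y * c y) = cnj (c' a) * s"
        by (simp add: s_def sum_distrib_left mult.assoc)
      also have "(\<Sum>x\<in>G. cnj (c x) * R x a * c' a) = cnj s * c' a"
        by (simp flip: s' add: sum_distrib_right)
      also have "cnj (c' a) * R a a * c' a + cnj (c' a) * s +
          (cnj s * c' a + (\<Sum>x\<in>G. \<Sum>y\<in>G. cnj (c x) * R x y * c y)) =
          (\<Sum>x\<in>G. \<Sum>y\<in>G. cnj (c x) * R x y * c y) - cnj s * s / of_real p"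
        using p0 p by (simp add: c'a field_simps)
      also have "cnj s * s / of_real p = (\<Sum>x\<in>G. \<Sum>y\<in>G. cnj (c x) * (R x a * R a y / of_real p) * c y)"
        unfolding s'[symmetric] unfolding s_def sum_product sum_divide_distrib by (simp add: mult_ac)
      also have "(\<Sum>x\<in>G. \<Sum>y\<in>G. cnj (c x) * R x y * c y) - \<dots> =
          (\<Sum>x\<in>G. \<Sum>y\<in>G. cnj (c x) * R' x y * c y)"
        by (simp add: R'_def sum_subtractf[symmetric] algebra_simps)
      finally show "(\<Sum>x\<in>G. \<Sum>y\<in>G. cnj (c x) * R' x y * c y) \<in> \<real>\<^sub>\<ge>\<^sub>0"
        using psdD[OF insert.prems, of "insert a G" c'] G by auto
    qed
    from insert.IH[OF this]
    obtain v where v: "\<forall>x\<in>F. \<forall>y\<in>F. R' x y = (\<Sum>k\<in>F. v k x * cnj (v k y))"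
      by blast
    \<comment> \<open>As in the Cholesky factorisation, the new vector is column \<open>a\<close>
      divided by \<open>sqrt p\<close>, and the old vectors are extended by zero at
      \<open>a\<close>.\<close>
    define w where
      "w k x = (if k = a then R x a / of_real (sqrt p) else if x = a then 0 else v k x)" for k x
    have "R x y = (\<Sum>k\<in>insert a F. w k x * cnj (w k y))"
      if xy: "x \<in> insert a F" "y \<in> insert a F" for x y
    proof -
      have "w a x * cnj (w a y) = R x a * R a y / (of_real (sqrt p) * of_real (sqrt p))"
        using herm[of y a] xy by (simp add: w_def)
      also have "\<dots> = R x a * R a y / of_real p"
        using p0 by (simp flip: of_real_mult)
      finally have "(\<Sum>k\<in>insert a F. w k x * cnj (w k y)) =
          R x a * R a y / of_real p + (\<Sum>k\<in>F. w k x * cnj (w k y))"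
        using insert.hyps by simp
      moreover have "(\<Sum>k\<in>F. w k x * cnj (w k y)) = R' x y"
      proof (cases "x = a \<or> y = a")
        case True
        then show ?thesis
          using insert.hyps p0 p by (auto simp: w_def R'_def intro!: sum.neutral)
      next
        case False
        have "(\<Sum>k\<in>F. w k x * cnj (w k y)) = (\<Sum>k\<in>F. v k x * cnj (v k y))"
          using insert.hyps False by (intro sum.cong) (auto simp: w_def)
        then show ?thesis using v xy False by simp
      qed
      ultimately show ?thesis by (simp add: R'_def)
    qed
    then show ?thesis by blast
  qed
qed


section \<open>Square summable families and contractions\<close>

abbreviation sq_summable :: "'k set \<Rightarrow> ('k \<Rightarrow> 'a::real_normed_vector) \<Rightarrow> bool" where
  "sq_summable K f \<equiv> (\<lambda>x. (norm (f x))\<^sup>2) summable_on K"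

lemma sq_summable_mult:
  fixes f g :: "'k \<Rightarrow> 'a::real_normed_algebra"
  assumes "sq_summable K f" "sq_summable K g"
  shows "(\<lambda>x. norm (f x * g x)) summable_on K"
proof (rule Infinite_Sum.abs_summable_on_comparison_test')
  show "(\<lambda>x. (norm (f x))\<^sup>2 + (norm (g x))\<^sup>2) summable_on K"
    using assms by (rule summable_on_add)
  show "norm (f x * g x) \<le> (norm (f x))\<^sup>2 + (norm (g x))\<^sup>2" for x
  proof -
    have "norm (f x * g x) \<le> norm (f x) * norm (g x)" by (rule norm_mult_ineq)
    moreover have "2 * (norm (f x) * norm (g x)) \<le> (norm (f x))\<^sup>2 + (norm (g x))\<^sup>2"
      using sum_squares_bound[of "norm (f x)" "norm (g x)"] by simp
    moreover have "0 \<le> norm (f x) * norm (g x)" by simp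
    ultimately show ?thesis by linarith
  qed
qed

lemma sq_summable_mult_summable:
  fixes f g :: "'k \<Rightarrow> complex"
  assumes "sq_summable K f" "sq_summable K g"
  shows "(\<lambda>x. f x * g x) summable_on K"
  by (rule abs_summable_summable[OF sq_summable_mult[OF assms]])

lemma sq_summable_add:
  fixes f g :: "'k \<Rightarrow> 'a::real_normed_vector"
  assumes "sq_summable K f" "sq_summable K g"
  shows "sq_summable K (\<lambda>x. f x + g x)"
proof (rule summable_on_comparison_test)
  show "(\<lambda>x. 2 * (norm (f x))\<^sup>2 + 2 * (norm (g x))\<^sup>2) summable_on K"
    using assms by (intro summable_on_add summable_on_cmult_right)
  show "(norm (f x + g x))\<^sup>2 \<le> 2 * (norm (f x))\<^sup>2 + 2 * (norm (g x))\<^sup>2" for x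
  proof -
    have "(norm (f x + g x))\<^sup>2 \<le> (norm (f x) + norm (g x))\<^sup>2"
      by (simp add: norm_triangle_ineq power_mono)
    also have "\<dots> \<le> 2 * (norm (f x))\<^sup>2 + 2 * (norm (g x))\<^sup>2"
      using sum_squares_bound[of "norm (f x)" "norm (g x)"]
      by (simp add: power2_eq_square algebra_simps)
    finally show ?thesis .
  qed
qed auto

lemma sq_summable_scale:
  fixes f :: "'k \<Rightarrow> 'a::real_normed_div_algebra"
  shows "sq_summable K f \<Longrightarrow> sq_summable K (\<lambda>x. c * f x)"
  by (simp add: norm_mult power_mult_distrib summable_on_cmult_right)

lemma has_sum_finite_sum:
  fixes f :: "'j \<Rightarrow> 'k \<Rightarrow> 'a::{topological_comm_monoid_add}"
  assumes "\<And>j. j \<in> J \<Longrightarrow> (f j has_sum s j) K"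
  shows "((\<lambda>x. \<Sum>j\<in>J. f j x) has_sum (\<Sum>j\<in>J. s j)) K"
  using assms by (induction J rule: infinite_finite_induct) (auto intro: has_sum_add)

lemma nonneg_bounded_summable:
  fixes f :: "'k \<Rightarrow> real"
  assumes "\<And>x. x \<in> K \<Longrightarrow> 0 \<le> f x" "\<And>F. finite F \<Longrightarrow> F \<subseteq> K \<Longrightarrow> sum f F \<le> B"
  shows "f summable_on K" "infsum f K \<le> B"
proof -
  show "f summable_on K"
    using assms by (intro nonneg_bdd_above_summable_on) (auto intro!: bdd_aboveI)
  then show "infsum f K \<le> B"
    using assms(2) by (intro infsum_le_finite_sums) auto
qed

text \<open>
  The matrix \<open>A\<close> with rows indexed by \<open>K\<close> and columns by \<open>I\<close> is a contraction \<open>\<ell>\<^sup>2(I) \<rightarrow> \<ell>\<^sup>2(K)\<close>. A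
  family \<open>A\<^sub>m\<close>, \<open>m \<in> J\<close>, with \<open>\<Sum>\<^sub>m A\<^sub>m\<^sup>\<dagger> A\<^sub>m \<le> I\<close> is stacked into one matrix with rows \<open>J \<times> I\<close>.
\<close>

definition contraction :: "'k set \<Rightarrow> 'i set \<Rightarrow> ('k \<Rightarrow> 'i \<Rightarrow> complex) \<Rightarrow> bool" where
  "contraction K I A \<longleftrightarrow> (\<forall>X F c. finite X \<and> X \<subseteq> K \<and> finite F \<and> F \<subseteq> I \<longrightarrow>
     (\<Sum>k\<in>X. (cmod (\<Sum>z\<in>F. A k z * c z))\<^sup>2) \<le> (\<Sum>z\<in>F. (cmod (c z))\<^sup>2))"

lemma contractionD:
  "contraction K I A \<Longrightarrow> finite X \<Longrightarrow> X \<subseteq> K \<Longrightarrow> finite F \<Longrightarrow> F \<subseteq> I \<Longrightarrow>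
     (\<Sum>k\<in>X. (cmod (\<Sum>z\<in>F. A k z * c z))\<^sup>2) \<le> (\<Sum>z\<in>F. (cmod (c z))\<^sup>2)"
  by (auto simp: contraction_def)

lemma contraction_cong:
  assumes "contraction K I B" "\<And>k z. k \<in> K \<Longrightarrow> z \<in> I \<Longrightarrow> A k z = B k z"
  shows "contraction K I A"
  unfolding contraction_def
proof (intro allI impI)
  fix X F c assume XF: "finite X \<and> X \<subseteq> K \<and> finite F \<and> F \<subseteq> I"
  have "(\<Sum>z\<in>F. A k z * c z) = (\<Sum>z\<in>F. B k z * c z)" if "k \<in> X" for k
    using that XF assms(2) by (intro sum.cong refl) (auto simp: subset_iff)
  then show "(\<Sum>k\<in>X. (cmod (\<Sum>z\<in>F. A k z * c z))\<^sup>2) \<le> (\<Sum>z\<in>F. (cmod (c z))\<^sup>2)"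
    using contractionD[OF assms(1), of X F c] XF by simp
qed

text \<open>With \<open>b = A\<^sup>\<dagger>d\<close>, both sides of \<open>\<parallel>b\<parallel>\<^sup>2 = \<langle>d, A b\<rangle> \<le> \<parallel>d\<parallel> \<parallel>A b\<parallel> \<le> \<parallel>d\<parallel> \<parallel>b\<parallel>\<close> can be divided by \<open>\<parallel>b\<parallel>\<close>.\<close>

lemma contraction_adjoint:
  assumes "contraction K I A"
  shows "contraction I K (\<lambda>z k. cnj (A k z))"
  unfolding contraction_def
proof (intro allI impI)
  fix F X d assume FX: "finite F \<and> F \<subseteq> I \<and> finite X \<and> X \<subseteq> K"
  define b where "b z = (\<Sum>k\<in>X. cnj (A k z) * d k)" for z
  define e where "e k = (\<Sum>z\<in>F. A k z * b z)" for k
  define nb nd ne where "nb = (\<Sum>z\<in>F. (cmod (b z))\<^sup>2)" and "nd = (\<Sum>k\<in>X. (cmod (d k))\<^sup>2)"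
    and "ne = (\<Sum>k\<in>X. (cmod (e k))\<^sup>2)"
  have "complex_of_real nb = (\<Sum>z\<in>F. cnj (b z) * b z)"
    unfolding nb_def of_real_sum complex_norm_square by (simp add: mult.commute)
  also have "\<dots> = (\<Sum>z\<in>F. \<Sum>k\<in>X. A k z * cnj (d k) * b z)"
    by (subst b_def) (simp add: sum_distrib_right)
  also have "\<dots> = (\<Sum>k\<in>X. cnj (d k) * e k)"
    by (subst sum.swap) (simp add: e_def sum_distrib_left mult_ac)
  finally have eq: "complex_of_real nb = (\<Sum>k\<in>X. cnj (d k) * e k)" .
  have "nb \<ge> 0" by (auto simp: nb_def sum_nonneg)
  then have "nb = cmod (\<Sum>k\<in>X. cnj (d k) * e k)"
    by (simp flip: eq)
  also have "\<dots> \<le> (\<Sum>k\<in>X. cmod (d k) * cmod (e k))"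
    by (rule sum_norm_le) (simp add: norm_mult)
  finally have "nb\<^sup>2 \<le> (\<Sum>k\<in>X. cmod (d k) * cmod (e k))\<^sup>2"
    by (intro power_mono) (auto simp: nb_def sum_nonneg)
  also have "\<dots> \<le> nd * ne"
    unfolding nd_def ne_def by (rule Cauchy_Schwarz_ineq_sum)
  also have "\<dots> \<le> nd * nb"
    using contractionD[OF assms, of X F b] FX
    by (intro mult_left_mono) (auto simp: nb_def ne_def nd_def e_def sum_nonneg)
  finally have "nb * nb \<le> nd * nb" by (simp add: power2_eq_square)
  moreover have "nb \<ge> 0" "nd \<ge> 0" by (auto simp: nb_def nd_def sum_nonneg)
  ultimately have "nb \<le> nd"
    by (cases "nb = 0") auto
  then show "(\<Sum>z\<in>F. (cmod (\<Sum>k\<in>X. cnj (A k z) * d k))\<^sup>2) \<le> (\<Sum>k\<in>X. (cmod (d k))\<^sup>2)"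
    by (simp add: nb_def nd_def b_def)
qed

lemma contraction_column:
  assumes "contraction K I A" "z \<in> I"
  shows "sq_summable K (\<lambda>k. A k z)"
  using contractionD[OF assms(1), of _ "{z}" "\<lambda>_. 1"] assms(2)
  by (intro nonneg_bounded_summable(1)[where B = 1]) auto

lemma contraction_row:
  assumes "contraction K I A" "k \<in> K"
  shows "sq_summable I (\<lambda>z. A k z)"
  using contraction_column[OF contraction_adjoint[OF assms(1)] assms(2)] by simp

text \<open>The definition speaks of finitely supported vectors only. With the rows \<open>X\<close>
  fixed, both sides converge as the finite support grows to \<open>I\<close>.\<close>

lemma contraction_app:
  assumes "contraction K I A" "sq_summable I \<psi>" "finite X" "X \<subseteq> K"
  shows "(\<Sum>k\<in>X. (cmod (\<Sum>\<^sub>\<infinity>z\<in>I. A k z * \<psi> z))\<^sup>2) \<le> (\<Sum>\<^sub>\<infinity>z\<in>I. (cmod (\<psi> z))\<^sup>2)"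
proof (rule tendsto_le)
  have "((\<lambda>F. \<Sum>z\<in>F. A k z * \<psi> z) \<longlongrightarrow> (\<Sum>\<^sub>\<infinity>z\<in>I. A k z * \<psi> z)) (finite_subsets_at_top I)"
    if "k \<in> X" for k
    using that assms by (intro infsum_tendsto sq_summable_mult_summable contraction_row[OF assms(1)]) auto
  then show "((\<lambda>F. \<Sum>k\<in>X. (cmod (\<Sum>z\<in>F. A k z * \<psi> z))\<^sup>2) \<longlongrightarrow>
      (\<Sum>k\<in>X. (cmod (\<Sum>\<^sub>\<infinity>z\<in>I. A k z * \<psi> z))\<^sup>2)) (finite_subsets_at_top I)"
    by (intro tendsto_sum tendsto_power tendsto_norm)
  show "((\<lambda>F. \<Sum>z\<in>F. (cmod (\<psi> z))\<^sup>2) \<longlongrightarrow> (\<Sum>\<^sub>\<infinity>z\<in>I. (cmod (\<psi> z))\<^sup>2)) (finite_subsets_at_top I)"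
    by (rule infsum_tendsto[OF assms(2)])
  show "\<forall>\<^sub>F F in finite_subsets_at_top I.
      (\<Sum>k\<in>X. (cmod (\<Sum>z\<in>F. A k z * \<psi> z))\<^sup>2) \<le> (\<Sum>z\<in>F. (cmod (\<psi> z))\<^sup>2)"
    by (rule eventually_finite_subsets_at_top_weakI) (use contractionD[OF assms(1,3,4)] in auto)
qed auto

text \<open>Even for finitely supported \<open>c\<close> the intermediate vector \<open>B c\<close>
  has infinite support, so the estimate for \<open>A\<close> has to be taken from
  \<open>contraction_app\<close>.\<close>

lemma contraction_mult:
  assumes A: "contraction K L A" and B: "contraction L I B"
  shows "contraction K I (\<lambda>k z. \<Sum>\<^sub>\<infinity>l\<in>L. A k l * B l z)"
  unfolding contraction_def
proof (intro allI impI)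
  fix X F c assume XF: "finite X \<and> X \<subseteq> K \<and> finite F \<and> F \<subseteq> I"
  define \<phi> where "\<phi> l = (\<Sum>z\<in>F. B l z * c z)" for l
  have \<phi>: "sq_summable L \<phi>" "(\<Sum>\<^sub>\<infinity>l\<in>L. (cmod (\<phi> l))\<^sup>2) \<le> (\<Sum>z\<in>F. (cmod (c z))\<^sup>2)"
    unfolding \<phi>_def
    by (rule nonneg_bounded_summable; use contractionD[OF B] XF in auto)+
  have "(\<Sum>z\<in>F. (\<Sum>\<^sub>\<infinity>l\<in>L. A k l * B l z) * c z) = (\<Sum>\<^sub>\<infinity>l\<in>L. A k l * \<phi> l)" if "k \<in> X" for k
  proof -
    have "((\<lambda>l. A k l * B l z) has_sum (\<Sum>\<^sub>\<infinity>l\<in>L. A k l * B l z)) L" if "z \<in> F" for z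
      using that XF \<open>k \<in> X\<close> contraction_row[OF A] contraction_column[OF B]
      by (intro has_sum_infsum sq_summable_mult_summable) auto
    then have "((\<lambda>l. \<Sum>z\<in>F. A k l * B l z * c z) has_sum (\<Sum>z\<in>F. (\<Sum>\<^sub>\<infinity>l\<in>L. A k l * B l z) * c z)) L"
      by (intro has_sum_finite_sum has_sum_cmult_left) auto
    then show ?thesis
      by (simp add: \<phi>_def sum_distrib_left mult.assoc infsumI)
  qed
  then have "(\<Sum>k\<in>X. (cmod (\<Sum>z\<in>F. (\<Sum>\<^sub>\<infinity>l\<in>L. A k l * B l z) * c z))\<^sup>2) =
      (\<Sum>k\<in>X. (cmod (\<Sum>\<^sub>\<infinity>l\<in>L. A k l * \<phi> l))\<^sup>2)"
    by simp
  also have "\<dots> \<le> (\<Sum>\<^sub>\<infinity>l\<in>L. (cmod (\<phi> l))\<^sup>2)"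
    using contraction_app[OF A \<phi>(1)] XF by blast
  finally show "(\<Sum>k\<in>X. (cmod (\<Sum>z\<in>F. (\<Sum>\<^sub>\<infinity>l\<in>L. A k l * B l z) * c z))\<^sup>2) \<le> (\<Sum>z\<in>F. (cmod (c z))\<^sup>2)"
    using \<phi>(2) by linarith
qed

text \<open>Up to renaming, \<open>A\<close> is a submatrix of \<open>B\<close>; injectivity ensures
  that no row or column of \<open>B\<close> is counted twice.\<close>

lemma contraction_reindex:
  assumes "contraction K' I' B" "inj_on g K" "g ` K \<subseteq> K'" "inj_on h I" "h ` I \<subseteq> I'"
    and "\<And>k z. k \<in> K \<Longrightarrow> z \<in> I \<Longrightarrow> A k z = B (g k) (h z)"
  shows "contraction K I A"
  unfolding contraction_def
proof (intro allI impI)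
  fix X F and c :: "_ \<Rightarrow> complex" assume XF: "finite X \<and> X \<subseteq> K \<and> finite F \<and> F \<subseteq> I"
  have inj: "inj_on g X" "inj_on h F"
    using assms XF by (auto intro: inj_on_subset)
  define c' where "c' = c \<circ> inv_into F h"
  have c': "c' (h z) = c z" if "z \<in> F" for z
    using inj that by (simp add: c'_def)
  have "(\<Sum>k\<in>X. (cmod (\<Sum>z\<in>F. A k z * c z))\<^sup>2) = (\<Sum>k\<in>X. (cmod (\<Sum>z\<in>F. B (g k) (h z) * c' (h z)))\<^sup>2)"
    using assms(6) XF by (intro sum.cong arg_cong[where f = "\<lambda>t. (cmod t)\<^sup>2"] refl) (auto simp: c' subset_iff)
  also have "\<dots> = (\<Sum>k\<in>g ` X. (cmod (\<Sum>z\<in>h ` F. B k z * c' z))\<^sup>2)"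
    using inj by (simp add: sum.reindex o_def)
  also have "\<dots> \<le> (\<Sum>z\<in>h ` F. (cmod (c' z))\<^sup>2)"
    using assms(3,5) XF by (intro contractionD[OF assms(1)]) (auto simp: image_subset_iff subset_iff)
  also have "\<dots> = (\<Sum>z\<in>F. (cmod (c z))\<^sup>2)"
    using inj by (simp add: sum.reindex o_def c')
  finally show "(\<Sum>k\<in>X. (cmod (\<Sum>z\<in>F. A k z * c z))\<^sup>2) \<le> (\<Sum>z\<in>F. (cmod (c z))\<^sup>2)" .
qed

text \<open>Rows and columns carry labels \<open>f\<close> and \<open>g\<close>, and
  \<open>A\<close> is block diagonal with respect to them. Different blocks read disjoint parts of
  the vector, so their estimates add up.\<close>

lemma contraction_fibres:
  assumes off: "\<And>k z. k \<in> K \<Longrightarrow> z \<in> I \<Longrightarrow> f k \<noteq> g z \<Longrightarrow> A k z = 0"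
    and fibre: "\<And>r. contraction {k \<in> K. f k = r} {z \<in> I. g z = r} A"
  shows "contraction K I A"
  unfolding contraction_def
proof (intro allI impI)
  fix X F c assume XF: "finite X \<and> X \<subseteq> K \<and> finite F \<and> F \<subseteq> I"
  define R where "R = f ` X \<union> g ` F"
  have R: "finite R" using XF by (simp add: R_def)
  have split: "(\<Sum>z\<in>F. A k z * c z) = (\<Sum>z\<in>{z \<in> F. g z = f k}. A k z * c z)" if "k \<in> X" for k
  proof (rule sum.mono_neutral_right)
    show "\<forall>z\<in>F - {z \<in> F. g z = f k}. A k z * c z = 0"
    proof
      fix z assume "z \<in> F - {z \<in> F. g z = f k}"
      then have "A k z = 0"
        using off[of k z] that XF by (auto simp: subset_iff)
      then show "A k z * c z = 0" by simp
    qed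
  qed (use XF in auto)
  have "(\<Sum>k\<in>X. (cmod (\<Sum>z\<in>F. A k z * c z))\<^sup>2) =
      (\<Sum>r\<in>R. \<Sum>k\<in>{k \<in> X. f k = r}. (cmod (\<Sum>z\<in>F. A k z * c z))\<^sup>2)"
    using XF R by (intro sum.group[symmetric]) (auto simp: R_def)
  also have "\<dots> = (\<Sum>r\<in>R. \<Sum>k\<in>{k \<in> X. f k = r}. (cmod (\<Sum>z\<in>{z \<in> F. g z = r}. A k z * c z))\<^sup>2)"
    by (intro sum.cong refl) (auto simp: split)
  also have "\<dots> \<le> (\<Sum>r\<in>R. \<Sum>z\<in>{z \<in> F. g z = r}. (cmod (c z))\<^sup>2)"
    using XF by (intro sum_mono contractionD[OF fibre]) auto
  also have "\<dots> = (\<Sum>z\<in>F. (cmod (c z))\<^sup>2)"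
    using XF R by (intro sum.group) (auto simp: R_def)
  finally show "(\<Sum>k\<in>X. (cmod (\<Sum>z\<in>F. A k z * c z))\<^sup>2) \<le> (\<Sum>z\<in>F. (cmod (c z))\<^sup>2)" .
qed

text \<open>With \<open>\<rho>\<close> a sum of rank one terms built from vectors
  \<open>v l\<close>, the left-hand side is the sum of the squared norms of \<open>A (v l)\<close>
  on the rows \<open>X\<close>, and the right-hand side is the sum of those of
  \<open>v l\<close>.\<close>

lemma contraction_trace:
  assumes A: "contraction K I A" and X: "finite X" "X \<subseteq> K" and F: "finite F" "F \<subseteq> I" and \<rho>: "psd F \<rho>"
  shows "Re (\<Sum>k\<in>X. \<Sum>z\<in>F. \<Sum>w\<in>F. A k z * \<rho> z w * cnj (A k w)) \<le> Re (\<Sum>z\<in>F. \<rho> z z)"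
proof -
  obtain v where v: "\<forall>x\<in>F. \<forall>y\<in>F. \<rho> x y = (\<Sum>l\<in>F. v l x * cnj (v l y))"
    using psd_decompose[OF F(1) \<rho>] by blast
  have "(\<Sum>z\<in>F. \<Sum>w\<in>F. A k z * \<rho> z w * cnj (A k w)) = (\<Sum>l\<in>F. of_real ((cmod (\<Sum>z\<in>F. A k z * v l z))\<^sup>2))"
    for k
  proof -
    have "(\<Sum>l\<in>F. of_real ((cmod (\<Sum>z\<in>F. A k z * v l z))\<^sup>2)) =
        (\<Sum>l\<in>F. \<Sum>z\<in>F. \<Sum>w\<in>F. A k z * v l z * cnj (A k w * v l w))"
      unfolding complex_norm_square by (simp add: sum_product)
    also have "\<dots> = (\<Sum>z\<in>F. \<Sum>w\<in>F. \<Sum>l\<in>F. A k z * v l z * cnj (A k w * v l w))"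
      by (subst sum.swap) (intro sum.cong refl sum.swap)
    also have "\<dots> = (\<Sum>z\<in>F. \<Sum>w\<in>F. A k z * \<rho> z w * cnj (A k w))"
      using v by (intro sum.cong refl) (simp add: sum_distrib_left sum_distrib_right mult_ac)
    finally show ?thesis by simp
  qed
  then have "Re (\<Sum>k\<in>X. \<Sum>z\<in>F. \<Sum>w\<in>F. A k z * \<rho> z w * cnj (A k w)) =
      (\<Sum>l\<in>F. \<Sum>k\<in>X. (cmod (\<Sum>z\<in>F. A k z * v l z))\<^sup>2)"
    by (subst sum.swap) simp
  also have "\<dots> \<le> (\<Sum>l\<in>F. \<Sum>z\<in>F. (cmod (v l z))\<^sup>2)"
    by (intro sum_mono contractionD[OF A X F])
  also have "\<dots> = Re (\<Sum>z\<in>F. \<rho> z z)"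
    using v by (subst sum.swap) (simp add: complex_norm_square[symmetric] del: of_real_power)
  finally show ?thesis .
qed


section \<open>Trace class operators\<close>

text \<open>Squares are cofinal among the finite subsets of \<open>I \<times> I\<close>. So an
  absolutely convergent double sum is a limit of sums with both indices in the same finite set,
  which is the shape of the forms in \<open>psd\<close>.\<close>

lemma filterlim_square_finite_subsets:
  "filterlim (\<lambda>F. F \<times> F) (finite_subsets_at_top (I \<times> I)) (finite_subsets_at_top I)"
  unfolding filterlim_iff eventually_finite_subsets_at_top
proof (intro allI impI)
  fix P assume "\<exists>X. finite X \<and> X \<subseteq> I \<times> I \<and> (\<forall>Y. finite Y \<and> X \<subseteq> Y \<and> Y \<subseteq> I \<times> I \<longrightarrow> P Y)"
  then obtain X where X: "finite X" "X \<subseteq> I \<times> I" "\<And>Y. finite Y \<and> X \<subseteq> Y \<and> Y \<subseteq> I \<times> I \<Longrightarrow> P Y"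
    by blast
  have sub: "X \<subseteq> Y \<times> Y" if "fst ` X \<union> snd ` X \<subseteq> Y" for Y
    using that by (auto simp: image_subset_iff)
  show "\<exists>X. finite X \<and> X \<subseteq> I \<and> (\<forall>Y. finite Y \<and> X \<subseteq> Y \<and> Y \<subseteq> I \<longrightarrow> P (Y \<times> Y))"
  proof (intro exI[of _ "fst ` X \<union> snd ` X"] conjI allI impI)
    fix Y assume "finite Y \<and> fst ` X \<union> snd ` X \<subseteq> Y \<and> Y \<subseteq> I"
    then show "P (Y \<times> Y)"
      using sub[of Y] by (intro X(3)) auto
  qed (use X(1,2) in auto)
qed

lemma sum_Times: "(\<Sum>p\<in>A \<times> B. f p) = (\<Sum>a\<in>A. \<Sum>b\<in>B. f (a, b))"
  by (simp add: sum.cartesian_product)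

text \<open>For positive matrices \<open>r\<close> is the square root of the diagonal. Unlike
  positivity, the condition passes to linear combinations and hence to the whole trace class, and it
  is still strong enough for absolute convergence.\<close>

definition dominated :: "'i set \<Rightarrow> 'i oper \<Rightarrow> bool" where
  "dominated I T \<longleftrightarrow> (\<forall>x y. x \<notin> I \<or> y \<notin> I \<longrightarrow> T x y = 0) \<and>
     (\<exists>r :: 'i \<Rightarrow> real. sq_summable I r \<and> (\<forall>x\<in>I. 0 \<le> r x) \<and> (\<forall>x\<in>I. \<forall>y\<in>I. cmod (T x y) \<le> r x * r y))"

text \<open>The majorant splits into a product of the families \<open>cmod (f z) * r z\<close> and
  \<open>cmod (g w) * r w\<close>, each of which is summable.\<close>

lemma dominated_summable:
  assumes "dominated I T" "sq_summable I f" "sq_summable I g"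
  shows "(\<lambda>(z, w). f z * T z w * g w) summable_on I \<times> I"
proof -
  obtain r :: "'a \<Rightarrow> real" where r: "sq_summable I r" "\<And>x. x \<in> I \<Longrightarrow> 0 \<le> r x"
    "\<And>x y. x \<in> I \<Longrightarrow> y \<in> I \<Longrightarrow> cmod (T x y) \<le> r x * r y"
    using assms(1) by (auto simp: dominated_def)
  have f: "(\<lambda>z. cmod (f z) * r z) summable_on I"
    using assms(2) r(1) by (intro abs_summable_summable[OF sq_summable_mult]) simp_all
  have g: "(\<lambda>w. cmod (g w) * r w) summable_on I"
    using assms(3) r(1) by (intro abs_summable_summable[OF sq_summable_mult]) simp_all
  have "(\<lambda>p. norm ((\<lambda>(z, w). f z * T z w * g w) p)) summable_on I \<times> I"
  proof (rule Infinite_Sum.abs_summable_on_comparison_test')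
    show "(\<lambda>(z, w). (cmod (f z) * r z) * (cmod (g w) * r w)) summable_on I \<times> I"
    proof (rule summable_on_SigmaI)
      show "((\<lambda>w. (\<lambda>(z, w). (cmod (f z) * r z) * (cmod (g w) * r w)) (z, w)) has_sum
          (cmod (f z) * r z) * (\<Sum>\<^sub>\<infinity>w\<in>I. cmod (g w) * r w)) I" for z
        using g by (simp only: case_prod_conv) (intro has_sum_cmult_right has_sum_infsum)
      show "(\<lambda>z. (cmod (f z) * r z) * (\<Sum>\<^sub>\<infinity>w\<in>I. cmod (g w) * r w)) summable_on I"
        using f by (intro summable_on_cmult_left)
    qed (use r(2) in auto)
    show "norm ((\<lambda>(z, w). f z * T z w * g w) p) \<le> (\<lambda>(z, w). (cmod (f z) * r z) * (cmod (g w) * r w)) p"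
      if "p \<in> I \<times> I" for p
    proof -
      obtain z w where p: "p = (z, w)" "z \<in> I" "w \<in> I" using \<open>p \<in> I \<times> I\<close> by auto
      have "cmod (f z) * cmod (T z w) * cmod (g w) \<le> cmod (f z) * (r z * r w) * cmod (g w)"
        using r(3) p by (intro mult_right_mono mult_left_mono) auto
      then show ?thesis using p by (simp add: norm_mult mult_ac)
    qed
  qed
  then show ?thesis by (rule abs_summable_summable)
qed

text \<open>By Fubini both iterated sums equal the double sum. The first has the nesting of
  \<open>conjug\<close>, the second that of \<open>cinner\<close> with \<open>app\<close>.\<close>

lemma dominated_form_tendsto:
  assumes "dominated I T" "sq_summable I f" "sq_summable I g"
  shows "((\<lambda>Z. \<Sum>z\<in>Z. \<Sum>w\<in>Z. f z * T z w * g w) \<longlongrightarrow> (\<Sum>\<^sub>\<infinity>w\<in>I. (\<Sum>\<^sub>\<infinity>z\<in>I. f z * T z w) * g w))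
      (finite_subsets_at_top I)"
    and "((\<lambda>Z. \<Sum>z\<in>Z. \<Sum>w\<in>Z. f z * T z w * g w) \<longlongrightarrow> (\<Sum>\<^sub>\<infinity>z\<in>I. f z * (\<Sum>\<^sub>\<infinity>w\<in>I. T z w * g w)))
      (finite_subsets_at_top I)"
proof -
  note S = dominated_summable[OF assms]
  have "(sum (\<lambda>(z, w). f z * T z w * g w) \<longlongrightarrow> infsum (\<lambda>(z, w). f z * T z w * g w) (I \<times> I))
      (finite_subsets_at_top (I \<times> I))"
    by (rule infsum_tendsto[OF S])
  from filterlim_compose[OF this filterlim_square_finite_subsets]
  have lim: "((\<lambda>Z. \<Sum>z\<in>Z. \<Sum>w\<in>Z. f z * T z w * g w) \<longlongrightarrow> infsum (\<lambda>(z, w). f z * T z w * g w) (I \<times> I))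
      (finite_subsets_at_top I)"
    by (simp add: sum.cartesian_product)
  have z: "infsum (\<lambda>(z, w). f z * T z w * g w) (I \<times> I) = (\<Sum>\<^sub>\<infinity>z\<in>I. \<Sum>\<^sub>\<infinity>w\<in>I. f z * T z w * g w)"
    using infsum_Sigma'_banach[OF S] by simp
  also have "\<dots> = (\<Sum>\<^sub>\<infinity>z\<in>I. f z * (\<Sum>\<^sub>\<infinity>w\<in>I. T z w * g w))"
    by (simp add: infsum_cmult_right'[symmetric] mult.assoc)
  finally show "((\<lambda>Z. \<Sum>z\<in>Z. \<Sum>w\<in>Z. f z * T z w * g w) \<longlongrightarrow> (\<Sum>\<^sub>\<infinity>z\<in>I. f z * (\<Sum>\<^sub>\<infinity>w\<in>I. T z w * g w)))
      (finite_subsets_at_top I)"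
    using lim by simp
  have "(\<Sum>\<^sub>\<infinity>z\<in>I. \<Sum>\<^sub>\<infinity>w\<in>I. f z * T z w * g w) = (\<Sum>\<^sub>\<infinity>w\<in>I. \<Sum>\<^sub>\<infinity>z\<in>I. f z * T z w * g w)"
    by (rule infsum_swap_banach[OF S])
  also have "\<dots> = (\<Sum>\<^sub>\<infinity>w\<in>I. (\<Sum>\<^sub>\<infinity>z\<in>I. f z * T z w) * g w)"
    by (simp add: infsum_cmult_left')
  finally show "((\<lambda>Z. \<Sum>z\<in>Z. \<Sum>w\<in>Z. f z * T z w * g w) \<longlongrightarrow> (\<Sum>\<^sub>\<infinity>w\<in>I. (\<Sum>\<^sub>\<infinity>z\<in>I. f z * T z w) * g w))
      (finite_subsets_at_top I)"
    using lim z by simp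
qed

lemma conjug_tendsto:
  assumes "dominated I T" "sq_summable I (A x)" "sq_summable I (A y)"
  shows "((\<lambda>Z. \<Sum>z\<in>Z. \<Sum>w\<in>Z. A x z * T z w * cnj (A y w)) \<longlongrightarrow> conjug I A T x y)
      (finite_subsets_at_top I)"
  using dominated_form_tendsto(1)[OF assms(1,2), of "\<lambda>w. cnj (A y w)"] assms(3)
  by (simp add: conjug_def mult_def adj_def)

lemma cinner_app_tendsto:
  assumes "dominated I T" "\<phi> \<in> ell2 I" "\<psi> \<in> ell2 I"
  shows "((\<lambda>Z. \<Sum>z\<in>Z. \<Sum>w\<in>Z. cnj (\<phi> z) * T z w * \<psi> w) \<longlongrightarrow> cinner I \<phi> (app I T \<psi>))
      (finite_subsets_at_top I)"
  using dominated_form_tendsto(2)[OF assms(1), of "\<lambda>w. cnj (\<phi> w)" \<psi>] assms(2,3)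
  by (simp add: cinner_def app_def ell2_def)

lemma cinner_app_finite:
  assumes "finite G" "G \<subseteq> I" "\<And>x. x \<notin> G \<Longrightarrow> \<phi> x = 0" "\<And>x. x \<notin> G \<Longrightarrow> \<psi> x = 0"
  shows "cinner I \<phi> (app I T \<psi>) = (\<Sum>x\<in>G. \<Sum>y\<in>G. cnj (\<phi> x) * T x y * \<psi> y)"
proof -
  have "app I T \<psi> x = (\<Sum>y\<in>G. T x y * \<psi> y)" for x
  proof -
    have "app I T \<psi> x = (\<Sum>\<^sub>\<infinity>y\<in>G. T x y * \<psi> y)"
      unfolding app_def using assms by (intro infsum_cong_neutral) auto
    then show ?thesis using assms(1) by simp
  qed
  moreover have "cinner I \<phi> \<xi> = (\<Sum>x\<in>G. cnj (\<phi> x) * \<xi> x)" for \<xi>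
  proof -
    have "cinner I \<phi> \<xi> = (\<Sum>\<^sub>\<infinity>x\<in>G. cnj (\<phi> x) * \<xi> x)"
      unfolding cinner_def using assms by (intro infsum_cong_neutral) auto
    then show ?thesis using assms(1) by simp
  qed
  ultimately show ?thesis
    by (simp add: sum_distrib_left mult.assoc)
qed

lemma finite_support_ell2:
  assumes "finite G" "G \<subseteq> I" "\<And>x. x \<notin> G \<Longrightarrow> \<phi> x = 0"
  shows "\<phi> \<in> ell2 I"
proof -
  have "sq_summable G \<phi>" using assms(1) by simp
  then have "sq_summable I \<phi>"
    using assms by (subst summable_on_cong_neutral[where T = G and g = "\<lambda>x. (cmod (\<phi> x))\<^sup>2"]) auto
  then show ?thesis using assms by (auto simp: ell2_def)
qed

text \<open>Vectors of finite support are admissible tests, and at them all infinite sums collapse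
  to finite ones.\<close>

lemma positive_op_psd:
  assumes "positive_op I T"
  shows "psd I T"
  unfolding psd_def
proof (intro allI impI)
  fix F and c :: "_ \<Rightarrow> complex" assume F: "finite F \<and> F \<subseteq> I"
  define \<psi> where "\<psi> x = (if x \<in> F then c x else 0)" for x
  have "cinner I \<psi> (app I T \<psi>) \<in> \<real>\<^sub>\<ge>\<^sub>0"
    using assms finite_support_ell2[of F I \<psi>] F by (auto simp: positive_op_def \<psi>_def)
  also have "cinner I \<psi> (app I T \<psi>) = (\<Sum>x\<in>F. \<Sum>y\<in>F. cnj (\<psi> x) * T x y * \<psi> y)"
    using F by (intro cinner_app_finite) (auto simp: \<psi>_def)
  finally show "(\<Sum>x\<in>F. \<Sum>y\<in>F. cnj (c x) * T x y * c y) \<in> \<real>\<^sub>\<ge>\<^sub>0"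
    by (simp add: \<psi>_def)
qed

lemma dominated_bounded_op:
  assumes "dominated I T"
  shows "bounded_op I T"
proof -
  obtain r :: "'a \<Rightarrow> real" where r: "sq_summable I r" "\<And>x. x \<in> I \<Longrightarrow> 0 \<le> r x"
    "\<And>x y. x \<in> I \<Longrightarrow> y \<in> I \<Longrightarrow> cmod (T x y) \<le> r x * r y"
    and supp: "\<And>x y. x \<notin> I \<or> y \<notin> I \<Longrightarrow> T x y = 0"
    using assms by (auto simp: dominated_def)
  \<comment> \<open>\<open>K\<close> is the operator norm of the rank one majorant with entries
    \<open>r x * r y\<close>.\<close>
  define K where "K = (\<Sum>\<^sub>\<infinity>x\<in>I. (r x)\<^sup>2)"
  have K: "0 \<le> K" by (simp add: K_def infsum_nonneg)
  have r2: "(\<lambda>x. (r x)\<^sup>2) summable_on I" using r(1) by simp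
  have main: "(\<lambda>y. T x y * \<psi> y) summable_on I"
    "(cmod (app I T \<psi> x))\<^sup>2 \<le> (r x)\<^sup>2 * (K * (\<Sum>\<^sub>\<infinity>y\<in>I. (cmod (\<psi> y))\<^sup>2))"
    if \<psi>: "\<psi> \<in> ell2 I" and x: "x \<in> I" for \<psi> x
  proof -
    have \<psi>s: "sq_summable I \<psi>" using \<psi> by (simp add: ell2_def)
    have "sq_summable I (T x)"
    proof (rule summable_on_comparison_test)
      show "(\<lambda>y. (r x)\<^sup>2 * (r y)\<^sup>2) summable_on I" by (rule summable_on_cmult_right[OF r2])
      show "(cmod (T x y))\<^sup>2 \<le> (r x)\<^sup>2 * (r y)\<^sup>2" if "y \<in> I" for y
        using power_mono[OF r(3)[OF x that], of 2] by (simp add: power_mult_distrib)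
    qed auto
    then show sm: "(\<lambda>y. T x y * \<psi> y) summable_on I"
      using \<psi>s by (rule sq_summable_mult_summable)
    show "(cmod (app I T \<psi> x))\<^sup>2 \<le> (r x)\<^sup>2 * (K * (\<Sum>\<^sub>\<infinity>y\<in>I. (cmod (\<psi> y))\<^sup>2))"
    proof (rule tendsto_le[OF finite_subsets_at_top_neq_bot tendsto_const])
      show "((\<lambda>F. (cmod (\<Sum>y\<in>F. T x y * \<psi> y))\<^sup>2) \<longlongrightarrow> (cmod (app I T \<psi> x))\<^sup>2) (finite_subsets_at_top I)"
        unfolding app_def by (intro tendsto_power tendsto_norm infsum_tendsto sm)
      show "\<forall>\<^sub>F F in finite_subsets_at_top I. (cmod (\<Sum>y\<in>F. T x y * \<psi> y))\<^sup>2 \<le>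
          (r x)\<^sup>2 * (K * (\<Sum>\<^sub>\<infinity>y\<in>I. (cmod (\<psi> y))\<^sup>2))"
      proof (rule eventually_finite_subsets_at_top_weakI)
        fix F assume F: "finite F" "F \<subseteq> I"
        have "cmod (\<Sum>y\<in>F. T x y * \<psi> y) \<le> (\<Sum>y\<in>F. r x * (r y * cmod (\<psi> y)))"
        proof (rule sum_norm_le)
          fix y assume "y \<in> F"
          then have "cmod (T x y) * cmod (\<psi> y) \<le> r x * r y * cmod (\<psi> y)"
            using F r(3)[OF x] by (intro mult_right_mono) auto
          then show "cmod (T x y * \<psi> y) \<le> r x * (r y * cmod (\<psi> y))"
            by (simp add: norm_mult mult.assoc)
        qed
        then have "(cmod (\<Sum>y\<in>F. T x y * \<psi> y))\<^sup>2 \<le> (r x * (\<Sum>y\<in>F. r y * cmod (\<psi> y)))\<^sup>2"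
          by (intro power_mono) (auto simp: sum_distrib_left)
        also have "\<dots> \<le> (r x)\<^sup>2 * ((\<Sum>y\<in>F. (r y)\<^sup>2) * (\<Sum>y\<in>F. (cmod (\<psi> y))\<^sup>2))"
          unfolding power_mult_distrib by (intro mult_left_mono Cauchy_Schwarz_ineq_sum) auto
        also have "\<dots> \<le> (r x)\<^sup>2 * (K * (\<Sum>\<^sub>\<infinity>y\<in>I. (cmod (\<psi> y))\<^sup>2))"
          unfolding K_def using F r2 \<psi>s K
          by (intro mult_left_mono mult_mono finite_sum_le_infsum) (auto simp: sum_nonneg infsum_nonneg)
        finally show "(cmod (\<Sum>y\<in>F. T x y * \<psi> y))\<^sup>2 \<le> (r x)\<^sup>2 * (K * (\<Sum>\<^sub>\<infinity>y\<in>I. (cmod (\<psi> y))\<^sup>2))" .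
      qed
    qed
  qed
  have "app I T \<psi> \<in> ell2 I \<and> norm2 I (app I T \<psi>) \<le> K * norm2 I \<psi>" if \<psi>: "\<psi> \<in> ell2 I" for \<psi>
  proof -
    define N where "N = (\<Sum>\<^sub>\<infinity>y\<in>I. (cmod (\<psi> y))\<^sup>2)"
    have N: "0 \<le> N" by (simp add: N_def infsum_nonneg)
    have bnd: "(\<Sum>x\<in>F. (cmod (app I T \<psi> x))\<^sup>2) \<le> K * (K * N)" if F: "finite F" "F \<subseteq> I" for F
    proof -
      have "(\<Sum>x\<in>F. (cmod (app I T \<psi> x))\<^sup>2) \<le> (\<Sum>x\<in>F. (r x)\<^sup>2 * (K * N))"
        using main(2)[OF \<psi>] F by (intro sum_mono) (auto simp: N_def)
      also have "\<dots> = (\<Sum>x\<in>F. (r x)\<^sup>2) * (K * N)" by (simp add: sum_distrib_right)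
      also have "\<dots> \<le> K * (K * N)"
        unfolding K_def using F r2 K N
        by (intro mult_right_mono finite_sum_le_infsum) (auto simp: infsum_nonneg)
      finally show ?thesis .
    qed
    have s: "sq_summable I (app I T \<psi>)" "(\<Sum>\<^sub>\<infinity>x\<in>I. (cmod (app I T \<psi> x))\<^sup>2) \<le> K * (K * N)"
      by (rule nonneg_bounded_summable; use bnd in auto)+
    have "app I T \<psi> x = 0" if "x \<notin> I" for x
      using that supp by (simp add: app_def)
    moreover have "norm2 I (app I T \<psi>) \<le> K * norm2 I \<psi>"
      unfolding norm2_def N_def[symmetric]
    proof (rule real_le_lsqrt)
      show "(\<Sum>\<^sub>\<infinity>x\<in>I. (cmod (app I T \<psi> x))\<^sup>2) \<le> (K * sqrt N)\<^sup>2"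
        using s(2) N by (simp add: power_mult_distrib power2_eq_square mult_ac)
    qed (use K N in \<open>auto simp: infsum_nonneg\<close>)
    ultimately show ?thesis using s(1) by (auto simp: ell2_def)
  qed
  then show ?thesis
    unfolding bounded_op_def using supp main(1) by blast
qed

lemma positive_op_iff_psd:
  assumes "dominated I T"
  shows "positive_op I T \<longleftrightarrow> psd I T"
proof
  assume psd: "psd I T"
  have "cinner I \<psi> (app I T \<psi>) \<in> \<real>\<^sub>\<ge>\<^sub>0" if "\<psi> \<in> ell2 I" for \<psi>
    by (rule Lim_in_closed_set[OF closed_nonneg_Reals_complex _ _ cinner_app_tendsto[OF assms that that]])
      (auto intro!: eventually_finite_subsets_at_top_weakI psdD[OF psd])
  then show "positive_op I T"
    by (simp add: positive_op_def dominated_bounded_op[OF assms])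
qed (rule positive_op_psd)

text \<open>A block matrix is a kernel indexed by pairs of a block number and a point of
  \<open>I\<close>, so complete positivity becomes a statement about \<open>psd\<close> on a larger
  index set.\<close>

lemma block_positive_iff_psd:
  assumes "\<And>a b. a < n \<Longrightarrow> b < n \<Longrightarrow> dominated I (R a b)"
  shows "block_positive I n R \<longleftrightarrow> psd ({..<n} \<times> I) (\<lambda>p q. R (fst p) (fst q) (snd p) (snd q))"
proof
  assume psd: "psd ({..<n} \<times> I) (\<lambda>p q. R (fst p) (fst q) (snd p) (snd q))"
  show "block_positive I n R"
    unfolding block_positive_def
  proof (intro allI impI)
    fix \<psi> assume \<psi>: "\<forall>a<n. \<psi> a \<in> ell2 I"
    show "(\<Sum>a<n. \<Sum>b<n. cinner I (\<psi> a) (app I (R a b) (\<psi> b))) \<in> \<real>\<^sub>\<ge>\<^sub>0"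
    proof (rule Lim_in_closed_set[OF closed_nonneg_Reals_complex])
      show "((\<lambda>Z. \<Sum>a<n. \<Sum>b<n. \<Sum>z\<in>Z. \<Sum>w\<in>Z. cnj (\<psi> a z) * R a b z w * \<psi> b w) \<longlongrightarrow>
          (\<Sum>a<n. \<Sum>b<n. cinner I (\<psi> a) (app I (R a b) (\<psi> b)))) (finite_subsets_at_top I)"
        using \<psi> assms by (intro tendsto_sum cinner_app_tendsto) auto
      show "\<forall>\<^sub>F Z in finite_subsets_at_top I.
          (\<Sum>a<n. \<Sum>b<n. \<Sum>z\<in>Z. \<Sum>w\<in>Z. cnj (\<psi> a z) * R a b z w * \<psi> b w) \<in> \<real>\<^sub>\<ge>\<^sub>0"
      proof (rule eventually_finite_subsets_at_top_weakI)
        fix Z assume Z: "finite Z" "Z \<subseteq> I"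
        have "(\<Sum>a<n. \<Sum>b<n. \<Sum>z\<in>Z. \<Sum>w\<in>Z. cnj (\<psi> a z) * R a b z w * \<psi> b w) =
            (\<Sum>a<n. \<Sum>z\<in>Z. \<Sum>b<n. \<Sum>w\<in>Z. cnj (\<psi> a z) * R a b z w * \<psi> b w)"
          by (intro sum.cong refl sum.swap)
        also have "\<dots> = (\<Sum>p\<in>{..<n} \<times> Z. \<Sum>q\<in>{..<n} \<times> Z.
            cnj (\<psi> (fst p) (snd p)) * R (fst p) (fst q) (snd p) (snd q) * \<psi> (fst q) (snd q))"
          by (simp add: sum_Times)
        also have "\<dots> \<in> \<real>\<^sub>\<ge>\<^sub>0"
          using psdD[OF psd, of "{..<n} \<times> Z" "\<lambda>p. \<psi> (fst p) (snd p)"] Z by auto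
        finally show "(\<Sum>a<n. \<Sum>b<n. \<Sum>z\<in>Z. \<Sum>w\<in>Z. cnj (\<psi> a z) * R a b z w * \<psi> b w) \<in> \<real>\<^sub>\<ge>\<^sub>0" .
      qed
    qed auto
  qed
next
  assume bp: "block_positive I n R"
  show "psd ({..<n} \<times> I) (\<lambda>p q. R (fst p) (fst q) (snd p) (snd q))"
    unfolding psd_def
  proof (intro allI impI)
    fix F and c :: "_ \<Rightarrow> complex" assume F: "finite F \<and> F \<subseteq> {..<n} \<times> I"
    \<comment> \<open>Cutting \<open>c\<close> off outside \<open>F\<close> allows \<open>F\<close>
      to be enlarged to a rectangle without changing the form.\<close>
    define \<psi> where "\<psi> a x = (if (a, x) \<in> F then c (a, x) else 0)" for a x
    define G where "G = snd ` F"
    have G: "finite G" "G \<subseteq> I" "F \<subseteq> {..<n} \<times> G"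
      using F by (force simp: G_def)+
    have \<psi>0: "\<psi> a x = 0" if "x \<notin> G" for a x
      using that by (force simp: G_def \<psi>_def)
    have "(\<Sum>a<n. \<Sum>b<n. cinner I (\<psi> a) (app I (R a b) (\<psi> b))) \<in> \<real>\<^sub>\<ge>\<^sub>0"
      using bp finite_support_ell2[OF G(1,2)] \<psi>0 by (auto simp: block_positive_def)
    also have "(\<Sum>a<n. \<Sum>b<n. cinner I (\<psi> a) (app I (R a b) (\<psi> b))) =
        (\<Sum>a<n. \<Sum>b<n. \<Sum>x\<in>G. \<Sum>y\<in>G. cnj (\<psi> a x) * R a b x y * \<psi> b y)"
      using G \<psi>0 by (intro sum.cong refl cinner_app_finite) auto
    also have "\<dots> = (\<Sum>a<n. \<Sum>x\<in>G. \<Sum>b<n. \<Sum>y\<in>G. cnj (\<psi> a x) * R a b x y * \<psi> b y)"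
      by (intro sum.cong refl sum.swap)
    also have "\<dots> = (\<Sum>p\<in>{..<n} \<times> G. \<Sum>q\<in>{..<n} \<times> G.
        cnj (\<psi> (fst p) (snd p)) * R (fst p) (fst q) (snd p) (snd q) * \<psi> (fst q) (snd q))"
      by (simp add: sum_Times)
    also have "\<dots> = (\<Sum>p\<in>F. \<Sum>q\<in>{..<n} \<times> G.
        cnj (\<psi> (fst p) (snd p)) * R (fst p) (fst q) (snd p) (snd q) * \<psi> (fst q) (snd q))"
      using G by (intro sum.mono_neutral_right) (auto simp: \<psi>_def)
    also have "\<dots> = (\<Sum>p\<in>F. \<Sum>q\<in>F.
        cnj (\<psi> (fst p) (snd p)) * R (fst p) (fst q) (snd p) (snd q) * \<psi> (fst q) (snd q))"
      using G by (intro sum.cong[OF refl] sum.mono_neutral_right) (auto simp: \<psi>_def)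
    also have "\<dots> = (\<Sum>p\<in>F. \<Sum>q\<in>F. cnj (c p) * R (fst p) (fst q) (snd p) (snd q) * c q)"
      by (intro sum.cong refl) (auto simp: \<psi>_def)
    finally show "(\<Sum>p\<in>F. \<Sum>q\<in>F. cnj (c p) * R (fst p) (fst q) (snd p) (snd q) * c q) \<in> \<real>\<^sub>\<ge>\<^sub>0" .
  qed
qed

lemma dominated_zero: "dominated I zero_op"
  by (auto simp: dominated_def zero_op_def intro!: exI[of _ "\<lambda>_. 0"])

lemma dominated_scale:
  assumes "dominated I T"
  shows "dominated I (\<lambda>x y. c * T x y)"
proof -
  obtain r :: "'a \<Rightarrow> real" where r: "sq_summable I r" "\<And>x. x \<in> I \<Longrightarrow> 0 \<le> r x"
    "\<And>x y. x \<in> I \<Longrightarrow> y \<in> I \<Longrightarrow> cmod (T x y) \<le> r x * r y"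
    and supp: "\<And>x y. x \<notin> I \<or> y \<notin> I \<Longrightarrow> T x y = 0"
    using assms by (auto simp: dominated_def)
  \<comment> \<open>The majorant contains \<open>r\<close> twice, so each factor receives the square
    root of \<open>cmod c\<close>.\<close>
  define s where "s = sqrt (cmod c)"
  have s: "s * s = cmod c" "0 \<le> s" by (auto simp: s_def)
  have "cmod (c * T x y) \<le> (s * r x) * (s * r y)" if "x \<in> I" "y \<in> I" for x y
  proof -
    have "cmod (c * T x y) \<le> s * s * (r x * r y)"
      using r(3)[OF that] s by (auto simp: norm_mult intro!: mult_left_mono)
    then show ?thesis by (simp add: mult_ac)
  qed
  then show ?thesis
    using supp r s sq_summable_scale[OF r(1), of s] unfolding dominated_def
    by (auto intro!: exI[of _ "\<lambda>x. s * r x"])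
qed

lemma dominated_add:
  assumes "dominated I T" "dominated I T'"
  shows "dominated I (\<lambda>x y. T x y + T' x y)"
proof -
  obtain r :: "'a \<Rightarrow> real" where r: "sq_summable I r" "\<And>x. x \<in> I \<Longrightarrow> 0 \<le> r x"
    "\<And>x y. x \<in> I \<Longrightarrow> y \<in> I \<Longrightarrow> cmod (T x y) \<le> r x * r y"
    and supp: "\<And>x y. x \<notin> I \<or> y \<notin> I \<Longrightarrow> T x y = 0"
    using assms(1) by (auto simp: dominated_def)
  obtain r' :: "'a \<Rightarrow> real" where r': "sq_summable I r'" "\<And>x. x \<in> I \<Longrightarrow> 0 \<le> r' x"
    "\<And>x y. x \<in> I \<Longrightarrow> y \<in> I \<Longrightarrow> cmod (T' x y) \<le> r' x * r' y"
    and supp': "\<And>x y. x \<notin> I \<or> y \<notin> I \<Longrightarrow> T' x y = 0"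
    using assms(2) by (auto simp: dominated_def)
  have "cmod (T x y + T' x y) \<le> (r x + r' x) * (r y + r' y)" if xy: "x \<in> I" "y \<in> I" for x y
  proof -
    have "cmod (T x y + T' x y) \<le> r x * r y + r' x * r' y"
      using norm_triangle_ineq[of "T x y" "T' x y"] r(3)[OF xy] r'(3)[OF xy] by linarith
    moreover have "0 \<le> r x * r' y" "0 \<le> r' x * r y"
      using r(2) r'(2) xy by auto
    ultimately show ?thesis by (simp add: algebra_simps)
  qed
  then show ?thesis
    using supp supp' r r' sq_summable_add[OF r(1) r'(1)] unfolding dominated_def
    by (auto intro!: exI[of _ "\<lambda>x. r x + r' x"])
qed

text \<open>The cone spanned by the partial densities. Boundedness is left out because it follows,
  by \<open>pos_trace_class_dominated\<close> and \<open>dominated_bounded_op\<close>.\<close>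

definition pos_trace_class :: "'i set \<Rightarrow> 'i oper \<Rightarrow> bool" where
  "pos_trace_class I \<rho> \<longleftrightarrow> (\<forall>x y. x \<notin> I \<or> y \<notin> I \<longrightarrow> \<rho> x y = 0) \<and> psd I \<rho> \<and>
     (\<lambda>x. Re (\<rho> x x)) summable_on I"

definition tr :: "'i set \<Rightarrow> 'i oper \<Rightarrow> real" where
  "tr I \<rho> = (\<Sum>\<^sub>\<infinity>x\<in>I. Re (\<rho> x x))"

lemma pos_trace_class_dominated:
  assumes "pos_trace_class I \<rho>"
  shows "dominated I \<rho>"
proof -
  have psd: "psd I \<rho>" using assms by (simp add: pos_trace_class_def)
  define r where "r x = sqrt (Re (\<rho> x x))" for x
  have nn: "0 \<le> Re (\<rho> x x)" if "x \<in> I" for x using psd_diag_Re[OF psd that] by simp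
  have "sq_summable I r"
    using assms by (subst summable_on_cong[where g = "\<lambda>x. Re (\<rho> x x)"]) (auto simp: r_def nn pos_trace_class_def)
  moreover have "cmod (\<rho> x y) \<le> r x * r y" if "x \<in> I" "y \<in> I" for x y
    unfolding r_def real_sqrt_mult[symmetric]
    by (rule real_le_rsqrt[OF psd_Cauchy_Schwarz[OF psd that]])
  moreover have "0 \<le> r x" if "x \<in> I" for x using nn[OF that] by (simp add: r_def)
  ultimately show ?thesis
    using assms by (auto simp: dominated_def pos_trace_class_def)
qed

lemma pos_trace_class_trace:
  assumes "pos_trace_class I \<rho>"
  shows "((\<lambda>x. \<rho> x x) has_sum of_real (tr I \<rho>)) I" "trace I \<rho> = of_real (tr I \<rho>)"
proof -
  have "((\<lambda>x. complex_of_real (Re (\<rho> x x))) has_sum of_real (tr I \<rho>)) I"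
    using assms by (auto simp: pos_trace_class_def tr_def intro!: has_sum_of_real has_sum_infsum)
  then show "((\<lambda>x. \<rho> x x) has_sum of_real (tr I \<rho>)) I"
    using assms psd_diag_Re[of I \<rho>]
    by (subst has_sum_cong[where g = "\<lambda>x. of_real (Re (\<rho> x x))"]) (auto simp: pos_trace_class_def)
  then show "trace I \<rho> = of_real (tr I \<rho>)"
    by (simp add: trace_def infsumI)
qed

lemma partial_density_iff: "\<rho> \<in> partial_density I \<longleftrightarrow> pos_trace_class I \<rho> \<and> tr I \<rho> \<le> 1"
proof
  assume \<rho>: "\<rho> \<in> partial_density I"
  then have "pos_trace_class I \<rho>"
    using positive_op_psd[of I \<rho>]
    by (auto simp: partial_density_def pos_trace_class_def positive_op_def bounded_op_def intro: summable_on_Re)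
  then show "pos_trace_class I \<rho> \<and> tr I \<rho> \<le> 1"
    using pos_trace_class_trace(2)[of I \<rho>] \<rho> by (auto simp: partial_density_def)
next
  assume \<rho>: "pos_trace_class I \<rho> \<and> tr I \<rho> \<le> 1"
  then show "\<rho> \<in> partial_density I"
    using positive_op_iff_psd[OF pos_trace_class_dominated, of I \<rho>] pos_trace_class_trace[of I \<rho>]
    by (auto simp: partial_density_def pos_trace_class_def has_sum_imp_summable)
qed

lemma tr_nonneg: "pos_trace_class I \<rho> \<Longrightarrow> 0 \<le> tr I \<rho>"
  using psd_diag_Re[of I \<rho>] by (auto simp: tr_def pos_trace_class_def intro!: infsum_nonneg)

lemma sum_diag_le_tr:
  assumes "pos_trace_class I \<rho>" "finite X" "X \<subseteq> I"
  shows "(\<Sum>x\<in>X. Re (\<rho> x x)) \<le> tr I \<rho>"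
  using assms psd_diag_Re[of I \<rho>] by (auto simp: tr_def pos_trace_class_def intro!: finite_sum_le_infsum)

lemma psd_entry_le:
  assumes "psd K R" "x \<in> K" "y \<in> K"
  shows "cmod (R x y) \<le> Re (R x x) + Re (R y y)"
proof (rule power2_le_imp_le)
  have nn: "0 \<le> Re (R x x)" "0 \<le> Re (R y y)" using psd_diag_Re[OF assms(1,2)] psd_diag_Re[OF assms(1,3)] by auto
  have "(cmod (R x y))\<^sup>2 \<le> Re (R x x) * Re (R y y)" by (rule psd_Cauchy_Schwarz[OF assms])
  also have "\<dots> \<le> (Re (R x x) + Re (R y y))\<^sup>2"
    using nn by (simp add: power2_eq_square algebra_simps)
  finally show "(cmod (R x y))\<^sup>2 \<le> (Re (R x x) + Re (R y y))\<^sup>2" .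
  show "0 \<le> Re (R x x) + Re (R y y)" using nn by simp
qed

text \<open>An entry is bounded by the sum of two diagonal entries, each at most the trace; hence
  the factor 2. The bound is uniform in \<open>x\<close> and \<open>y\<close>, so smallness of
  traces yields entrywise convergence.\<close>

lemma pos_trace_class_entry_le:
  assumes "pos_trace_class I \<rho>"
  shows "cmod (\<rho> x y) \<le> 2 * tr I \<rho>"
proof (cases "x \<in> I \<and> y \<in> I")
  case True
  have "cmod (\<rho> x y) \<le> Re (\<rho> x x) + Re (\<rho> y y)"
    using assms True by (intro psd_entry_le) (auto simp: pos_trace_class_def)
  then show ?thesis
    using sum_diag_le_tr[OF assms, of "{x}"] sum_diag_le_tr[OF assms, of "{y}"] True by simp
next
  case False
  then show ?thesis using assms tr_nonneg[OF assms] by (auto simp: pos_trace_class_def)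
qed

lemma trace_class_zero: "zero_op \<in> trace_class I"
  unfolding trace_class_def mem_Collect_eq by (rule exI[of _ 0]) (auto simp: zero_op_def)

lemma trace_class_add_partial_density:
  assumes "T \<in> trace_class I" "\<rho> \<in> partial_density I"
  shows "(\<lambda>x y. T x y + c * \<rho> x y) \<in> trace_class I"
proof -
  obtain n :: nat and d \<sigma> where T: "\<forall>k<n. \<sigma> k \<in> partial_density I" "T = (\<lambda>x y. \<Sum>k<n. d k * \<sigma> k x y)"
    using assms(1) by (auto simp: trace_class_def)
  show ?thesis
    unfolding trace_class_def mem_Collect_eq
    by (rule exI[of _ "Suc n"], rule exI[of _ "d(n := c)"], rule exI[of _ "\<sigma>(n := \<rho>)"])
      (use T assms(2) in \<open>auto simp: less_Suc_eq\<close>)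
qed

text \<open>Properties stable under linear combinations are thereby reduced to partial densities,
  where positivity and the trace are available.\<close>

lemma trace_class_induct [consumes 1, case_names zero add]:
  assumes "T \<in> trace_class I" "P zero_op"
    and "\<And>T c \<rho>. T \<in> trace_class I \<Longrightarrow> P T \<Longrightarrow> \<rho> \<in> partial_density I \<Longrightarrow> P (\<lambda>x y. T x y + c * \<rho> x y)"
  shows "P T"
proof -
  obtain n :: nat and d \<sigma> where T: "\<forall>k<n. \<sigma> k \<in> partial_density I" "T = (\<lambda>x y. \<Sum>k<n. d k * \<sigma> k x y)"
    using assms(1) by (auto simp: trace_class_def)
  have "(\<lambda>x y. \<Sum>k<m. d k * \<sigma> k x y) \<in> trace_class I \<and> P (\<lambda>x y. \<Sum>k<m. d k * \<sigma> k x y)" if "m \<le> n" for m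
    using that
  proof (induction m)
    case 0
    then show ?case using assms(2) trace_class_zero[of I] by (simp add: zero_op_def)
  next
    case (Suc m)
    then show ?case
      using assms(3) T(1) trace_class_add_partial_density[of "\<lambda>x y. \<Sum>k<m. d k * \<sigma> k x y" I "\<sigma> m" "d m"]
      by (auto simp: Suc_le_eq)
  qed
  then show ?thesis using T(2) by blast
qed

lemma trace_class_add:
  assumes "A \<in> trace_class I" "B \<in> trace_class I"
  shows "(\<lambda>x y. A x y + B x y) \<in> trace_class I"
  using assms(2)
proof (induction rule: trace_class_induct)
  case zero
  then show ?case using assms(1) by (simp add: zero_op_def)
next
  case (add T c \<rho>)
  then show ?case
    using trace_class_add_partial_density[OF add.IH add.hyps(2), of c] by (simp add: add.assoc)
qed

lemma trace_class_scale:
  assumes "A \<in> trace_class I"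
  shows "(\<lambda>x y. c * A x y) \<in> trace_class I"
  using assms
proof (induction rule: trace_class_induct)
  case zero
  then show ?case using trace_class_zero[of I] by (simp add: zero_op_def)
next
  case (add T d \<rho>)
  then show ?case
    using trace_class_add_partial_density[OF add.IH add.hyps(2), of "c * d"] by (simp add: algebra_simps)
qed

lemma trace_class_dominated: "T \<in> trace_class I \<Longrightarrow> dominated I T"
proof (induction rule: trace_class_induct)
  case zero
  show ?case by (rule dominated_zero)
next
  case (add T c \<rho>)
  then show ?case
    by (intro dominated_add dominated_scale) (auto simp: partial_density_iff pos_trace_class_dominated)
qed

lemma pos_trace_class_scale:
  assumes "pos_trace_class I \<rho>" "0 \<le> t"
  shows "pos_trace_class I (\<lambda>x y. of_real t * \<rho> x y)" "tr I (\<lambda>x y. of_real t * \<rho> x y) = t * tr I \<rho>"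
  using assms by (auto simp: pos_trace_class_def tr_def infsum_cmult_right' intro: psd_scale summable_on_cmult_right)

text \<open>Left to right, \<open>T\<close> is a multiple of a partial density. Right to left, the
  diagonal of a dominated matrix is bounded by the summable function
  \<open>(r x)\<^sup>2\<close>.\<close>

lemma pos_trace_class_iff: "pos_trace_class I T \<longleftrightarrow> T \<in> trace_class I \<and> psd I T"
proof
  assume T: "pos_trace_class I T"
  \<comment> \<open>The maximum with 1 permits division by \<open>t\<close> when the trace
    vanishes.\<close>
  define t where "t = max 1 (tr I T)"
  have t: "t \<ge> 1" "tr I T \<le> t" by (auto simp: t_def)
  have "tr I (\<lambda>x y. of_real (1 / t) * T x y) \<le> 1"
    using pos_trace_class_scale(2)[OF T, of "1 / t"] t by simp
  then have "(\<lambda>x y. of_real (1 / t) * T x y) \<in> partial_density I"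
    unfolding partial_density_iff using pos_trace_class_scale(1)[OF T, of "1 / t"] t by simp
  from trace_class_add_partial_density[OF trace_class_zero this, of "of_real t"]
  have "T \<in> trace_class I" using t by (simp add: zero_op_def)
  then show "T \<in> trace_class I \<and> psd I T" using T by (simp add: pos_trace_class_def)
next
  assume T: "T \<in> trace_class I \<and> psd I T"
  then have "dominated I T" by (simp add: trace_class_dominated)
  then obtain r :: "'a \<Rightarrow> real" where r: "sq_summable I r"
    "\<And>x y. x \<in> I \<Longrightarrow> y \<in> I \<Longrightarrow> cmod (T x y) \<le> r x * r y"
    and supp: "\<And>x y. x \<notin> I \<or> y \<notin> I \<Longrightarrow> T x y = 0"
    by (auto simp: dominated_def)
  have "(\<lambda>x. Re (T x x)) summable_on I"
  proof (rule summable_on_comparison_test)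
    show "(\<lambda>x. (r x)\<^sup>2) summable_on I" using r(1) by simp
    show "Re (T x x) \<le> (r x)\<^sup>2" if "x \<in> I" for x
      using r(2)[OF that that] complex_Re_le_cmod[of "T x x"] by (simp add: power2_eq_square)
    show "0 \<le> Re (T x x)" if "x \<in> I" for x
      using psd_diag_Re[of I T x] T that by simp
  qed
  then show "pos_trace_class I T" using T supp by (simp add: pos_trace_class_def)
qed

lemma tr_diff:
  assumes "pos_trace_class I A" "pos_trace_class I B"
  shows "tr I (\<lambda>x y. A x y - B x y) = tr I A - tr I B"
  using assms infsum_add[of "\<lambda>x. Re (A x x)" I "\<lambda>x. - Re (B x x)"]
  by (simp add: tr_def pos_trace_class_def infsum_uminus summable_on_uminus)


section \<open>Quantum operations\<close>

abbreviation block :: "(nat \<Rightarrow> nat \<Rightarrow> 'i oper) \<Rightarrow> nat \<times> 'i \<Rightarrow> nat \<times> 'i \<Rightarrow> complex" where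
  "block R \<equiv> (\<lambda>p q. R (fst p) (fst q) (snd p) (snd q))"

text \<open>
  Unlike \<open>quantum_operation\<close>, this leaves the values outside the trace class unspecified, as the
  program semantics does.
\<close>

definition qop :: "'i set \<Rightarrow> ('i oper \<Rightarrow> 'i oper) \<Rightarrow> bool" where
  "qop I E \<longleftrightarrow>
     (\<forall>A\<in>trace_class I. E A \<in> trace_class I) \<and>
     (\<forall>A\<in>trace_class I. \<forall>B\<in>trace_class I. E (\<lambda>x y. A x y + B x y) = (\<lambda>x y. E A x y + E B x y)) \<and>
     (\<forall>c. \<forall>A\<in>trace_class I. E (\<lambda>x y. c * A x y) = (\<lambda>x y. c * E A x y)) \<and>
     (\<forall>n R. (\<forall>a<n. \<forall>b<n. R a b \<in> trace_class I) \<and> psd ({..<n} \<times> I) (block R) \<longrightarrow>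
        psd ({..<n} \<times> I) (block (\<lambda>a b. E (R a b)))) \<and>
     (\<forall>\<rho>. pos_trace_class I \<rho> \<longrightarrow> tr I (E \<rho>) \<le> tr I \<rho>)"

lemma qopI:
  assumes "\<And>A. A \<in> trace_class I \<Longrightarrow> E A \<in> trace_class I"
    and "\<And>A B. A \<in> trace_class I \<Longrightarrow> B \<in> trace_class I \<Longrightarrow> E (\<lambda>x y. A x y + B x y) = (\<lambda>x y. E A x y + E B x y)"
    and "\<And>c A. A \<in> trace_class I \<Longrightarrow> E (\<lambda>x y. c * A x y) = (\<lambda>x y. c * E A x y)"
    and "\<And>n R. (\<And>a b. a < n \<Longrightarrow> b < n \<Longrightarrow> R a b \<in> trace_class I) \<Longrightarrow> psd ({..<n} \<times> I) (block R) \<Longrightarrow>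
        psd ({..<n} \<times> I) (block (\<lambda>a b. E (R a b)))"
    and "\<And>\<rho>. pos_trace_class I \<rho> \<Longrightarrow> tr I (E \<rho>) \<le> tr I \<rho>"
  shows "qop I E"
  unfolding qop_def
proof (intro conjI allI ballI impI)
  fix n R assume "(\<forall>a<n. \<forall>b<n. R a b \<in> trace_class I) \<and> psd ({..<n} \<times> I) (block R)"
  then show "psd ({..<n} \<times> I) (block (\<lambda>a b. E (R a b)))" by (intro assms(4)) auto
qed (use assms(1,2,3,5) in auto)

lemma qop_trace_class: "qop I E \<Longrightarrow> A \<in> trace_class I \<Longrightarrow> E A \<in> trace_class I"
  by (simp add: qop_def)

lemma qop_add:
  "qop I E \<Longrightarrow> A \<in> trace_class I \<Longrightarrow> B \<in> trace_class I \<Longrightarrow> E (\<lambda>x y. A x y + B x y) = (\<lambda>x y. E A x y + E B x y)"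
  by (simp add: qop_def)

lemma qop_scale: "qop I E \<Longrightarrow> A \<in> trace_class I \<Longrightarrow> E (\<lambda>x y. c * A x y) = (\<lambda>x y. c * E A x y)"
  by (simp add: qop_def)

lemma qop_block:
  assumes "qop I E" "\<And>a b. a < n \<Longrightarrow> b < n \<Longrightarrow> R a b \<in> trace_class I" "psd ({..<n} \<times> I) (block R)"
  shows "psd ({..<n} \<times> I) (block (\<lambda>a b. E (R a b)))"
proof -
  have "\<forall>n R. (\<forall>a<n. \<forall>b<n. R a b \<in> trace_class I) \<and> psd ({..<n} \<times> I) (block R) \<longrightarrow>
      psd ({..<n} \<times> I) (block (\<lambda>a b. E (R a b)))"
    using assms(1) unfolding qop_def by (elim conjE)
  from this[rule_format, of n R] show ?thesis using assms(2,3) by simp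
qed

lemma qop_tr_le: "qop I E \<Longrightarrow> pos_trace_class I \<rho> \<Longrightarrow> tr I (E \<rho>) \<le> tr I \<rho>"
  by (simp add: qop_def)

lemma qop_zero: "qop I E \<Longrightarrow> E zero_op = zero_op"
  using qop_scale[of I E zero_op 0] trace_class_zero[of I] by (simp add: zero_op_def)

lemma trace_class_diff:
  assumes "A \<in> trace_class I" "B \<in> trace_class I"
  shows "(\<lambda>x y. A x y - B x y) \<in> trace_class I"
  using trace_class_add[OF assms(1) trace_class_scale[OF assms(2), of "-1"]] by simp

lemma qop_diff:
  assumes "qop I E" "A \<in> trace_class I" "B \<in> trace_class I"
  shows "E (\<lambda>x y. A x y - B x y) = (\<lambda>x y. E A x y - E B x y)"
  using qop_add[OF assms(1,2) trace_class_scale[OF assms(3), of "-1"]] qop_scale[OF assms(1,3), of "-1"]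
  by simp

text \<open>The case of a single block, in the form to which \<open>block\<close> with a constant
  argument reduces. It extracts ordinary positivity from complete positivity.\<close>

lemma psd_block_constant: "psd ({..<Suc 0} \<times> I) (\<lambda>p q. R (snd p) (snd q)) \<longleftrightarrow> psd I R"
proof
  assume psd: "psd ({..<Suc 0} \<times> I) (\<lambda>p q. R (snd p) (snd q))"
  show "psd I R"
    unfolding psd_def
  proof (intro allI impI)
    fix F and c :: "_ \<Rightarrow> complex" assume F: "finite F \<and> F \<subseteq> I"
    then show "(\<Sum>x\<in>F. \<Sum>y\<in>F. cnj (c x) * R x y * c y) \<in> \<real>\<^sub>\<ge>\<^sub>0"
      using psdD[OF psd, of "{..<Suc 0} \<times> F" "c \<circ> snd"] by (auto simp: sum_Times lessThan_Suc)
  qed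
next
  assume psd: "psd I R"
  show "psd ({..<Suc 0} \<times> I) (\<lambda>p q. R (snd p) (snd q))"
    unfolding psd_def
  proof (intro allI impI)
    fix F and c :: "_ \<Rightarrow> complex" assume F: "finite F \<and> F \<subseteq> {..<Suc 0} \<times> I"
    have inj: "inj_on snd F" using F by (auto simp: inj_on_def)
    have "c p = c (0, snd p)" if "p \<in> F" for p
      using that F by (cases p) auto
    then have "(\<Sum>p\<in>F. \<Sum>q\<in>F. cnj (c p) * R (snd p) (snd q) * c q) =
        (\<Sum>p\<in>F. \<Sum>q\<in>F. cnj (c (0, snd p)) * R (snd p) (snd q) * c (0, snd q))"
      by (intro sum.cong refl) metis
    also have "\<dots> = (\<Sum>x\<in>snd ` F. \<Sum>y\<in>snd ` F. cnj (c (0, x)) * R x y * c (0, y))"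
      using inj by (simp add: sum.reindex)
    also have "\<dots> \<in> \<real>\<^sub>\<ge>\<^sub>0"
      using F by (intro psdD[OF psd]) auto
    finally show "(\<Sum>p\<in>F. \<Sum>q\<in>F. cnj (c p) * R (snd p) (snd q) * c q) \<in> \<real>\<^sub>\<ge>\<^sub>0" .
  qed
qed

lemma qop_pos:
  assumes "qop I E" "pos_trace_class I \<rho>"
  shows "pos_trace_class I (E \<rho>)"
proof -
  have "psd ({..<Suc 0} \<times> I) (block (\<lambda>_ _. E \<rho>))"
    using assms(2) by (intro qop_block[OF assms(1)]) (auto simp: pos_trace_class_iff psd_block_constant)
  then show ?thesis
    using assms(2) qop_trace_class[OF assms(1)] by (auto simp: pos_trace_class_iff psd_block_constant)
qed

text \<open>The passage back to the CPO: cutting off outside the trace class supplies the dummy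
  value required there and leaves all values constrained by \<open>qop\<close> unchanged.\<close>

lemma quantum_operation_restrict_tc:
  assumes "qop I E"
  shows "quantum_operation I (restrict_tc I E)"
proof -
  have "completely_positive I (restrict_tc I E)"
    unfolding completely_positive_def
  proof (intro allI impI)
    fix n R assume R: "(\<forall>a<n. \<forall>b<n. R a b \<in> trace_class I) \<and> block_positive I n R"
    then have "psd ({..<n} \<times> I) (block R)"
      by (subst block_positive_iff_psd[symmetric]) (auto intro: trace_class_dominated)
    then have "psd ({..<n} \<times> I) (block (\<lambda>a b. E (R a b)))"
      using R by (intro qop_block[OF assms]) auto
    then have "psd ({..<n} \<times> I) (block (\<lambda>a b. restrict_tc I E (R a b)))"
      by (rule psd_cong) (use R in \<open>auto simp: restrict_tc_def\<close>)
    then show "block_positive I n (\<lambda>a b. restrict_tc I E (R a b))"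
      using R qop_trace_class[OF assms]
      by (subst block_positive_iff_psd) (auto intro!: trace_class_dominated simp: restrict_tc_def)
  qed
  moreover have "Re (trace I (restrict_tc I E \<rho>)) \<le> Re (trace I \<rho>)" if "\<rho> \<in> partial_density I" for \<rho>
  proof -
    have \<rho>: "pos_trace_class I \<rho>" using that by (simp add: partial_density_iff)
    then have "restrict_tc I E \<rho> = E \<rho>" by (simp add: restrict_tc_def pos_trace_class_iff)
    then show ?thesis
      using pos_trace_class_trace(2)[OF \<rho>] pos_trace_class_trace(2)[OF qop_pos[OF assms \<rho>]] qop_tr_le[OF assms \<rho>]
      by simp
  qed
  ultimately show ?thesis
    unfolding quantum_operation_def
    by (intro conjI ballI allI impI)
      (simp_all add: restrict_tc_def trace_class_add trace_class_scale qop_trace_class[OF assms]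
        qop_add[OF assms] qop_scale[OF assms])
qed

lemma qop_cong:
  assumes "qop I E" "\<And>A. A \<in> trace_class I \<Longrightarrow> E' A = E A"
  shows "qop I E'"
proof (rule qopI)
  fix n R assume R: "\<And>a b. a < n \<Longrightarrow> b < n \<Longrightarrow> R a b \<in> trace_class I" "psd ({..<n} \<times> I) (block R)"
  show "psd ({..<n} \<times> I) (block (\<lambda>a b. E' (R a b)))"
    by (rule psd_cong[OF qop_block[OF assms(1) R]]) (auto simp: assms(2) R(1))
qed (simp_all add: assms(2) trace_class_add trace_class_scale qop_trace_class[OF assms(1)] qop_add[OF assms(1)]
  qop_scale[OF assms(1)] qop_tr_le[OF assms(1)] pos_trace_class_iff)

lemma qop_id: "qop I (\<lambda>\<rho>. \<rho>)"
  by (rule qopI) simp_all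

lemma qop_abort: "qop I (\<lambda>_. zero_op)"
proof (rule qopI)
  show "tr I zero_op \<le> tr I \<rho>" if "pos_trace_class I \<rho>" for \<rho>
    using tr_nonneg[OF that] by (simp add: tr_def zero_op_def)
qed (simp_all add: trace_class_zero, simp_all add: zero_op_def psd_zero)

lemma qop_comp:
  assumes "qop I E" "qop I F"
  shows "qop I (F \<circ> E)"
proof (rule qopI)
  fix n R assume R: "\<And>a b. a < n \<Longrightarrow> b < n \<Longrightarrow> R a b \<in> trace_class I" "psd ({..<n} \<times> I) (block R)"
  show "psd ({..<n} \<times> I) (block (\<lambda>a b. (F \<circ> E) (R a b)))"
    using qop_block[OF assms(2), of n "\<lambda>a b. E (R a b)"] qop_block[OF assms(1) R] qop_trace_class[OF assms(1)] R(1)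
    by simp
next
  show "tr I ((F \<circ> E) \<rho>) \<le> tr I \<rho>" if "pos_trace_class I \<rho>" for \<rho>
    using qop_tr_le[OF assms(1) that] qop_tr_le[OF assms(2) qop_pos[OF assms(1) that]] by simp
qed (simp_all add: qop_trace_class[OF assms(1)] qop_add[OF assms(1)] qop_scale[OF assms(1)]
  qop_trace_class[OF assms(2)] qop_add[OF assms(2)] qop_scale[OF assms(2)])

text \<open>The form of \<open>B R B\<^sup>\<dagger>\<close> at \<open>c\<close> is the form of
  \<open>R\<close> at \<open>d = B\<^sup>\<dagger> c\<close>.\<close>

lemma psd_congruence:
  assumes "psd L R" "finite G" "G \<subseteq> L"
  shows "psd K (\<lambda>p q. \<Sum>l\<in>G. \<Sum>m\<in>G. B p l * R l m * cnj (B q m))"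
  unfolding psd_def
proof (intro allI impI)
  fix F and c :: "_ \<Rightarrow> complex" assume F: "finite F \<and> F \<subseteq> K"
  define d where "d l = (\<Sum>q\<in>F. cnj (B q l) * c q)" for l
  have "(\<Sum>p\<in>F. \<Sum>q\<in>F. cnj (c p) * (\<Sum>l\<in>G. \<Sum>m\<in>G. B p l * R l m * cnj (B q m)) * c q) =
      (\<Sum>p\<in>F. \<Sum>q\<in>F. \<Sum>l\<in>G. \<Sum>m\<in>G. cnj (c p) * B p l * R l m * cnj (B q m) * c q)"
    by (simp add: sum_distrib_left sum_distrib_right mult_ac)
  also have "\<dots> = (\<Sum>p\<in>F. \<Sum>l\<in>G. \<Sum>q\<in>F. \<Sum>m\<in>G. cnj (c p) * B p l * R l m * cnj (B q m) * c q)"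
    by (intro sum.cong refl sum.swap)
  also have "\<dots> = (\<Sum>l\<in>G. \<Sum>p\<in>F. \<Sum>q\<in>F. \<Sum>m\<in>G. cnj (c p) * B p l * R l m * cnj (B q m) * c q)"
    by (rule sum.swap)
  also have "\<dots> = (\<Sum>l\<in>G. \<Sum>p\<in>F. \<Sum>m\<in>G. \<Sum>q\<in>F. cnj (c p) * B p l * R l m * cnj (B q m) * c q)"
    by (intro sum.cong refl sum.swap)
  also have "\<dots> = (\<Sum>l\<in>G. \<Sum>m\<in>G. \<Sum>p\<in>F. \<Sum>q\<in>F. cnj (c p) * B p l * R l m * cnj (B q m) * c q)"
    by (intro sum.cong refl sum.swap)
  also have "\<dots> = (\<Sum>l\<in>G. \<Sum>m\<in>G. cnj (d l) * R l m * d m)"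
    by (intro sum.cong refl) (simp add: d_def sum_distrib_left sum_distrib_right mult_ac)
  also have "\<dots> \<in> \<real>\<^sub>\<ge>\<^sub>0"
    by (rule psdD[OF assms])
  finally show "(\<Sum>p\<in>F. \<Sum>q\<in>F. cnj (c p) * (\<Sum>l\<in>G. \<Sum>m\<in>G. B p l * R l m * cnj (B q m)) * c q) \<in> \<real>\<^sub>\<ge>\<^sub>0" .
qed

section \<open>Conjugation by the members of a jointly contractive family\<close>

context
  fixes I :: "'i set" and J :: "'j set" and A :: "'j \<Rightarrow> 'i oper"
  assumes contr: "contraction (J \<times> I) I (\<lambda>(j, x). A j x)"
    and supp: "\<And>j x y. x \<notin> I \<Longrightarrow> A j x y = 0"
begin

lemma family_row:
  assumes "j \<in> J"
  shows "sq_summable I (A j x)"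
proof (cases "x \<in> I")
  case True
  then show ?thesis using contraction_row[OF contr, of "(j, x)"] assms by simp
qed (simp add: supp)

lemma conjug_family_tendsto:
  assumes "j \<in> J" "T \<in> trace_class I"
  shows "((\<lambda>Z. \<Sum>z\<in>Z. \<Sum>w\<in>Z. A j x z * T z w * cnj (A j y w)) \<longlongrightarrow> conjug I (A j) T x y)
      (finite_subsets_at_top I)"
  using assms family_row by (intro conjug_tendsto trace_class_dominated) auto

text \<open>\<open>conjug\<close> is an iterated infinite sum. Linearity is inherited from the
  finite forms converging to it, by uniqueness of limits.\<close>

lemma conjug_family_add:
  assumes "j \<in> J" "T \<in> trace_class I" "T' \<in> trace_class I"
  shows "conjug I (A j) (\<lambda>x y. T x y + T' x y) = (\<lambda>x y. conjug I (A j) T x y + conjug I (A j) T' x y)"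
proof (intro ext)
  fix x y
  have "((\<lambda>Z. \<Sum>z\<in>Z. \<Sum>w\<in>Z. A j x z * (T z w + T' z w) * cnj (A j y w)) \<longlongrightarrow>
      conjug I (A j) T x y + conjug I (A j) T' x y) (finite_subsets_at_top I)"
    using tendsto_add[OF conjug_family_tendsto[OF assms(1,2), of x y] conjug_family_tendsto[OF assms(1,3), of x y]]
    by (simp add: algebra_simps sum.distrib)
  with conjug_family_tendsto[OF assms(1) trace_class_add[OF assms(2,3)], of x y]
  show "conjug I (A j) (\<lambda>x y. T x y + T' x y) x y = conjug I (A j) T x y + conjug I (A j) T' x y"
    by (intro tendsto_unique[OF finite_subsets_at_top_neq_bot])
qed

lemma conjug_family_scale:
  assumes "j \<in> J" "T \<in> trace_class I"
  shows "conjug I (A j) (\<lambda>x y. c * T x y) = (\<lambda>x y. c * conjug I (A j) T x y)"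
proof (intro ext)
  fix x y
  have "((\<lambda>Z. \<Sum>z\<in>Z. \<Sum>w\<in>Z. A j x z * (c * T z w) * cnj (A j y w)) \<longlongrightarrow>
      c * conjug I (A j) T x y) (finite_subsets_at_top I)"
    using tendsto_mult[OF tendsto_const conjug_family_tendsto[OF assms, of x y], of c]
    by (simp add: sum_distrib_left mult_ac)
  with conjug_family_tendsto[OF assms(1) trace_class_scale[OF assms(2), of c], of x y]
  show "conjug I (A j) (\<lambda>x y. c * T x y) x y = c * conjug I (A j) T x y"
    by (intro tendsto_unique[OF finite_subsets_at_top_neq_bot])
qed

lemma conjug_family_block:
  assumes "j \<in> J" "\<And>a b. a < n \<Longrightarrow> b < n \<Longrightarrow> R a b \<in> trace_class I" "psd ({..<n} \<times> I) (block R)"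
  shows "psd ({..<n} \<times> I) (block (\<lambda>a b. conjug I (A j) (R a b)))"
proof (rule psd_limit[OF finite_subsets_at_top_neq_bot])
  show "\<forall>\<^sub>F Z in finite_subsets_at_top I.
      psd ({..<n} \<times> I) (block (\<lambda>a b x y. \<Sum>z\<in>Z. \<Sum>w\<in>Z. A j x z * R a b z w * cnj (A j y w)))"
  proof (rule eventually_finite_subsets_at_top_weakI)
    fix Z assume Z: "finite Z" "Z \<subseteq> I"
    \<comment> \<open>The truncated map on blocks is congruence with the identity on block numbers
      tensored with \<open>A j\<close>.\<close>
    define B where "B p l = (if fst p = fst l then A j (snd p) (snd l) else 0)" for p l :: "nat \<times> 'i"
    have "psd ({..<n} \<times> I) (\<lambda>p q. \<Sum>l\<in>{..<n} \<times> Z. \<Sum>m\<in>{..<n} \<times> Z. B p l * block R l m * cnj (B q m))"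
      using Z by (intro psd_congruence[OF assms(3)]) auto
    then show "psd ({..<n} \<times> I) (block (\<lambda>a b x y. \<Sum>z\<in>Z. \<Sum>w\<in>Z. A j x z * R a b z w * cnj (A j y w)))"
    proof (rule psd_cong)
      fix p q assume "p \<in> {..<n} \<times> I" "q \<in> {..<n} \<times> I"
      then obtain a b x y where pq: "p = (a, x)" "q = (b, y)" "a < n" "b < n" by auto
      have delta: "(\<Sum>a'<n. \<Sum>z\<in>Z. if a = a' then h a' z else 0) = (\<Sum>z\<in>Z. h a z)"
        if "a < n" for a and h :: "nat \<Rightarrow> 'i \<Rightarrow> complex"
        by (subst sum.swap) (simp add: that)
      have "(\<Sum>l\<in>{..<n} \<times> Z. \<Sum>m\<in>{..<n} \<times> Z. B p l * block R l m * cnj (B q m)) =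
          (\<Sum>a'<n. \<Sum>z\<in>Z. if a = a' then \<Sum>b'<n. \<Sum>w\<in>Z. if b = b' then A j x z * R a' b' z w * cnj (A j y w) else 0 else 0)"
        unfolding sum_Times by (intro sum.cong refl) (auto simp: B_def pq intro!: sum.cong)
      also have "\<dots> = (\<Sum>z\<in>Z. \<Sum>w\<in>Z. A j x z * R a b z w * cnj (A j y w))"
        by (simp add: delta pq(3,4))
      finally show "block (\<lambda>a b x y. \<Sum>z\<in>Z. \<Sum>w\<in>Z. A j x z * R a b z w * cnj (A j y w)) p q =
          (\<Sum>l\<in>{..<n} \<times> Z. \<Sum>m\<in>{..<n} \<times> Z. B p l * block R l m * cnj (B q m))"
        by (simp add: pq)
    qed
  qed
  show "((\<lambda>Z. block (\<lambda>a b x y. \<Sum>z\<in>Z. \<Sum>w\<in>Z. A j x z * R a b z w * cnj (A j y w)) p q) \<longlongrightarrow>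
      block (\<lambda>a b. conjug I (A j) (R a b)) p q) (finite_subsets_at_top I)"
    if "p \<in> {..<n} \<times> I" "q \<in> {..<n} \<times> I" for p q
    using that assms(1,2) by (intro conjug_family_tendsto) auto
qed

text \<open>The pairs in \<open>J0 \<times> X\<close> are rows of the stacked matrix, so one
  application of \<open>contraction_trace\<close> bounds all members of the family together; then
  the truncation \<open>Z\<close> of \<open>\<rho>\<close> grows to \<open>I\<close>.\<close>

lemma conjug_family_diag_le:
  assumes \<rho>: "pos_trace_class I \<rho>" and J0: "finite J0" "J0 \<subseteq> J" and X: "finite X" "X \<subseteq> I"
  shows "(\<Sum>j\<in>J0. \<Sum>x\<in>X. Re (conjug I (A j) \<rho> x x)) \<le> tr I \<rho>"
proof (rule tendsto_le[OF finite_subsets_at_top_neq_bot tendsto_const])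
  have T: "\<rho> \<in> trace_class I" "psd I \<rho>" using \<rho> by (auto simp: pos_trace_class_iff)
  show "((\<lambda>Z. \<Sum>j\<in>J0. \<Sum>x\<in>X. Re (\<Sum>z\<in>Z. \<Sum>w\<in>Z. A j x z * \<rho> z w * cnj (A j x w))) \<longlongrightarrow>
      (\<Sum>j\<in>J0. \<Sum>x\<in>X. Re (conjug I (A j) \<rho> x x))) (finite_subsets_at_top I)"
    using J0 T(1) by (intro tendsto_sum tendsto_Re conjug_family_tendsto) auto
  show "\<forall>\<^sub>F Z in finite_subsets_at_top I.
      (\<Sum>j\<in>J0. \<Sum>x\<in>X. Re (\<Sum>z\<in>Z. \<Sum>w\<in>Z. A j x z * \<rho> z w * cnj (A j x w))) \<le> tr I \<rho>"
  proof (rule eventually_finite_subsets_at_top_weakI)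
    fix Z assume Z: "finite Z" "Z \<subseteq> I"
    have "(\<Sum>j\<in>J0. \<Sum>x\<in>X. Re (\<Sum>z\<in>Z. \<Sum>w\<in>Z. A j x z * \<rho> z w * cnj (A j x w))) =
        Re (\<Sum>k\<in>J0 \<times> X. \<Sum>z\<in>Z. \<Sum>w\<in>Z. (\<lambda>(j, x). A j x) k z * \<rho> z w * cnj ((\<lambda>(j, x). A j x) k w))"
      by (simp add: sum_Times)
    also have "\<dots> \<le> Re (\<Sum>z\<in>Z. \<rho> z z)"
      using J0 X Z by (intro contraction_trace[OF contr] psd_subset[OF T(2)]) auto
    also have "\<dots> \<le> tr I \<rho>"
      using sum_diag_le_tr[OF \<rho> Z] by simp
    finally show "(\<Sum>j\<in>J0. \<Sum>x\<in>X. Re (\<Sum>z\<in>Z. \<Sum>w\<in>Z. A j x z * \<rho> z w * cnj (A j x w))) \<le> tr I \<rho>" .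
  qed
qed

lemma conjug_family_support: "x \<notin> I \<or> y \<notin> I \<Longrightarrow> conjug I (A j) T x y = 0"
  by (auto simp: conjug_def mult_def adj_def supp)

lemma conjug_family_pos:
  assumes \<rho>: "pos_trace_class I \<rho>" and j: "j \<in> J"
  shows "pos_trace_class I (conjug I (A j) \<rho>)"
proof -
  have T: "\<rho> \<in> trace_class I" "psd I \<rho>" using \<rho> by (auto simp: pos_trace_class_iff)
  have "psd ({..<Suc 0} \<times> I) (block (\<lambda>_ _. conjug I (A j) \<rho>))"
    using T by (intro conjug_family_block[OF j]) (auto simp: psd_block_constant)
  then have psd: "psd I (conjug I (A j) \<rho>)" by (simp add: psd_block_constant)
  have "(\<lambda>x. Re (conjug I (A j) \<rho> x x)) summable_on I"
    using conjug_family_diag_le[OF \<rho>, of "{j}"] j psd_diag_Re[OF psd]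
    by (intro nonneg_bounded_summable(1)[where B = "tr I \<rho>"]) auto
  then show ?thesis
    using psd conjug_family_support by (simp add: pos_trace_class_def)
qed

lemma conjug_family_trace_class:
  assumes j: "j \<in> J" and T: "T \<in> trace_class I"
  shows "conjug I (A j) T \<in> trace_class I"
  using T
proof (induction rule: trace_class_induct)
  case zero
  have "conjug I (A j) zero_op = zero_op"
    using conjug_family_scale[OF j trace_class_zero, of 0] by (simp add: zero_op_def)
  then show ?case by (simp add: trace_class_zero)
next
  case (add T c \<rho>)
  have \<rho>: "pos_trace_class I \<rho>" using add by (simp add: partial_density_iff)
  then have "\<rho> \<in> trace_class I" by (simp add: pos_trace_class_iff)
  moreover have "conjug I (A j) \<rho> \<in> trace_class I"
    using conjug_family_pos[OF \<rho> j] by (simp add: pos_trace_class_iff)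
  ultimately show ?case
    using add by (simp add: conjug_family_add[OF j] conjug_family_scale[OF j] trace_class_add trace_class_scale)
qed

lemma conjug_family_tr_le:
  assumes \<rho>: "pos_trace_class I \<rho>" and J0: "finite J0" "J0 \<subseteq> J"
  shows "(\<Sum>j\<in>J0. tr I (conjug I (A j) \<rho>)) \<le> tr I \<rho>"
proof -
  have pos: "pos_trace_class I (conjug I (A j) \<rho>)" if "j \<in> J0" for j
    using that J0 conjug_family_pos[OF \<rho>] by auto
  have "((\<lambda>x. \<Sum>j\<in>J0. Re (conjug I (A j) \<rho> x x)) has_sum (\<Sum>j\<in>J0. tr I (conjug I (A j) \<rho>))) I"
    using pos unfolding tr_def by (intro has_sum_finite_sum has_sum_infsum) (auto simp: pos_trace_class_def)
  moreover have "sum (\<lambda>x. \<Sum>j\<in>J0. Re (conjug I (A j) \<rho> x x)) X \<le> tr I \<rho>" if "finite X" "X \<subseteq> I" for X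
    using conjug_family_diag_le[OF \<rho> J0 that] by (subst sum.swap)
  ultimately show ?thesis
    by (rule has_sum_le_finite_sums) 
qed

lemma qop_conjug_family:
  assumes "j \<in> J"
  shows "qop I (conjug I (A j))"
proof (rule qopI)
  show "tr I (conjug I (A j) \<rho>) \<le> tr I \<rho>" if "pos_trace_class I \<rho>" for \<rho>
    using conjug_family_tr_le[OF that, of "{j}"] assms by simp
qed (use assms in \<open>simp_all add: conjug_family_trace_class conjug_family_add conjug_family_scale conjug_family_block\<close>)

end

text \<open>A single contraction is a family over the one-element index set.\<close>

lemma qop_conjug:
  assumes "contraction I I A" "\<And>x y. x \<notin> I \<Longrightarrow> A x y = 0"
  shows "qop I (conjug I A)"
proof (rule qop_conjug_family[where J = "{()}" and A = "\<lambda>_. A"])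
  show "contraction ({()} \<times> I) I (\<lambda>(j, x). A x)"
    by (rule contraction_reindex[OF assms(1), of snd _ id]) (auto simp: inj_on_def)
qed (use assms(2) in auto)

section \<open>Infinite sums of quantum operations with a joint trace bound\<close>

context
  fixes I :: "'i set" and J :: "'j set" and E :: "'j \<Rightarrow> 'i oper \<Rightarrow> 'i oper"
  assumes E: "\<And>j. j \<in> J \<Longrightarrow> qop I (E j)"
    and bound: "\<And>\<rho> J0. pos_trace_class I \<rho> \<Longrightarrow> finite J0 \<Longrightarrow> J0 \<subseteq> J \<Longrightarrow> (\<Sum>j\<in>J0. tr I (E j \<rho>)) \<le> tr I \<rho>"
begin

text \<open>For partial densities the entries are majorised by \<open>2 * tr I (E j \<rho>)\<close>,
  which is summable over \<open>j\<close> by the joint bound; linearity does the rest.\<close>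

lemma qop_family_summable:
  assumes "T \<in> trace_class I"
  shows "(\<lambda>j. E j T x y) summable_on J"
  using assms
proof (induction rule: trace_class_induct)
  case zero
  have "(\<lambda>j. E j zero_op x y) summable_on J \<longleftrightarrow> (\<lambda>j. 0 :: complex) summable_on J"
    by (rule summable_on_cong) (use qop_zero[OF E] in \<open>simp add: zero_op_def\<close>)
  then show ?case by simp
next
  case (add T c \<rho>)
  have \<rho>: "pos_trace_class I \<rho>" using add by (simp add: partial_density_iff)
  then have \<rho>': "\<rho> \<in> trace_class I" by (simp add: pos_trace_class_iff)
  have "(\<lambda>j. tr I (E j \<rho>)) summable_on J"
    using bound[OF \<rho>] tr_nonneg[OF qop_pos[OF E \<rho>]] by (intro nonneg_bounded_summable(1)[where B = "tr I \<rho>"]) auto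
  then have "(\<lambda>j. 2 * tr I (E j \<rho>)) summable_on J"
    by (rule summable_on_cmult_right)
  then have "(\<lambda>j. cmod (E j \<rho> x y)) summable_on J"
    by (rule Infinite_Sum.abs_summable_on_comparison_test') (rule pos_trace_class_entry_le[OF qop_pos[OF E \<rho>]])
  then have "(\<lambda>j. E j \<rho> x y) summable_on J"
    by (rule abs_summable_summable)
  then have "(\<lambda>j. E j T x y + c * E j \<rho> x y) summable_on J"
    using add by (intro summable_on_add summable_on_cmult_right)
  moreover have "E j (\<lambda>x y. T x y + c * \<rho> x y) x y = E j T x y + c * E j \<rho> x y" if "j \<in> J" for j
    using qop_add[OF E[OF that] add(1) trace_class_scale[OF \<rho>', of c]] qop_scale[OF E[OF that] \<rho>', of c] by simp
  ultimately show ?case by (simp cong: summable_on_cong)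
qed

lemma qop_family_has_sum:
  "T \<in> trace_class I \<Longrightarrow> ((\<lambda>j. E j T x y) has_sum (\<Sum>\<^sub>\<infinity>j\<in>J. E j T x y)) J"
  by (rule has_sum_infsum[OF qop_family_summable])

lemma qop_family_tendsto:
  "T \<in> trace_class I \<Longrightarrow>
    ((\<lambda>J0. \<Sum>j\<in>J0. E j T x y) \<longlongrightarrow> (\<Sum>\<^sub>\<infinity>j\<in>J. E j T x y)) (finite_subsets_at_top J)"
  by (rule infsum_tendsto[OF qop_family_summable])

lemma qop_family_block:
  assumes "\<And>a b. a < n \<Longrightarrow> b < n \<Longrightarrow> R a b \<in> trace_class I" "psd ({..<n} \<times> I) (block R)"
  shows "psd ({..<n} \<times> I) (block (\<lambda>a b x y. \<Sum>\<^sub>\<infinity>j\<in>J. E j (R a b) x y))"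
proof (rule psd_limit[OF finite_subsets_at_top_neq_bot])
  show "\<forall>\<^sub>F J0 in finite_subsets_at_top J. psd ({..<n} \<times> I) (block (\<lambda>a b x y. \<Sum>j\<in>J0. E j (R a b) x y))"
  proof (rule eventually_finite_subsets_at_top_weakI)
    fix J0 assume "J0 \<subseteq> J"
    then have "psd ({..<n} \<times> I) (block (\<lambda>a b. E j (R a b)))" if "j \<in> J0" for j
      using that qop_block[OF E[of j], of n R] assms by auto
    then show "psd ({..<n} \<times> I) (block (\<lambda>a b x y. \<Sum>j\<in>J0. E j (R a b) x y))"
      by (rule psd_sum)
  qed
  show "((\<lambda>J0. block (\<lambda>a b x y. \<Sum>j\<in>J0. E j (R a b) x y) p q) \<longlongrightarrow>
      block (\<lambda>a b x y. \<Sum>\<^sub>\<infinity>j\<in>J. E j (R a b) x y) p q) (finite_subsets_at_top J)"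
    if "p \<in> {..<n} \<times> I" "q \<in> {..<n} \<times> I" for p q
    using that assms(1) by (simp add: mem_Times_iff qop_family_tendsto)
qed

text \<open>The limit over finite \<open>J0\<close> is taken with the finite set \<open>X\<close> of
  diagonal entries fixed. The bound is uniform in \<open>X\<close>, and as the diagonal is
  nonnegative it yields both summability and the trace estimate.\<close>

lemma qop_family_pos:
  assumes \<rho>: "pos_trace_class I \<rho>"
  shows "pos_trace_class I (\<lambda>x y. \<Sum>\<^sub>\<infinity>j\<in>J. E j \<rho> x y)" "tr I (\<lambda>x y. \<Sum>\<^sub>\<infinity>j\<in>J. E j \<rho> x y) \<le> tr I \<rho>"
proof -
  have T: "\<rho> \<in> trace_class I" "psd I \<rho>" using \<rho> by (auto simp: pos_trace_class_iff)
  have pos: "pos_trace_class I (E j \<rho>)" if "j \<in> J" for j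
    using qop_pos[OF E[OF that] \<rho>] .
  have "psd ({..<Suc 0} \<times> I) (block (\<lambda>_ _ x y. \<Sum>\<^sub>\<infinity>j\<in>J. E j \<rho> x y))"
    using T by (intro qop_family_block) (auto simp: psd_block_constant)
  then have psd: "psd I (\<lambda>x y. \<Sum>\<^sub>\<infinity>j\<in>J. E j \<rho> x y)"
    by (rule psd_block_constant[THEN iffD1])
  have bnd: "(\<Sum>x\<in>X. Re (\<Sum>\<^sub>\<infinity>j\<in>J. E j \<rho> x x)) \<le> tr I \<rho>" if X: "finite X" "X \<subseteq> I" for X
  proof (rule tendsto_le[OF finite_subsets_at_top_neq_bot tendsto_const])
    show "((\<lambda>J0. \<Sum>x\<in>X. Re (\<Sum>j\<in>J0. E j \<rho> x x)) \<longlongrightarrow> (\<Sum>x\<in>X. Re (\<Sum>\<^sub>\<infinity>j\<in>J. E j \<rho> x x))) (finite_subsets_at_top J)"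
      by (intro tendsto_sum tendsto_Re qop_family_tendsto T)
    show "\<forall>\<^sub>F J0 in finite_subsets_at_top J. (\<Sum>x\<in>X. Re (\<Sum>j\<in>J0. E j \<rho> x x)) \<le> tr I \<rho>"
    proof (rule eventually_finite_subsets_at_top_weakI)
      fix J0 assume J0: "finite J0" "J0 \<subseteq> J"
      have "(\<Sum>x\<in>X. Re (\<Sum>j\<in>J0. E j \<rho> x x)) = (\<Sum>j\<in>J0. \<Sum>x\<in>X. Re (E j \<rho> x x))"
        by (simp add: sum.swap[of _ X])
      also have "\<dots> \<le> (\<Sum>j\<in>J0. tr I (E j \<rho>))"
        using J0 X by (intro sum_mono sum_diag_le_tr pos) auto
      also have "\<dots> \<le> tr I \<rho>" by (rule bound[OF \<rho> J0])
      finally show "(\<Sum>x\<in>X. Re (\<Sum>j\<in>J0. E j \<rho> x x)) \<le> tr I \<rho>" .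
    qed
  qed
  have nn: "0 \<le> Re (\<Sum>\<^sub>\<infinity>j\<in>J. E j \<rho> x x)" if "x \<in> I" for x
    using psd_diag_Re[OF psd that] by simp
  have sm: "(\<lambda>x. Re (\<Sum>\<^sub>\<infinity>j\<in>J. E j \<rho> x x)) summable_on I"
    by (rule nonneg_bounded_summable(1)[OF nn bnd])
  have "(\<Sum>\<^sub>\<infinity>j\<in>J. E j \<rho> x y) = 0" if "x \<notin> I \<or> y \<notin> I" for x y
    using pos that by (intro infsum_0) (auto simp: pos_trace_class_def)
  then show "pos_trace_class I (\<lambda>x y. \<Sum>\<^sub>\<infinity>j\<in>J. E j \<rho> x y)"
    using psd sm by (simp add: pos_trace_class_def)
  show "tr I (\<lambda>x y. \<Sum>\<^sub>\<infinity>j\<in>J. E j \<rho> x y) \<le> tr I \<rho>"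
    unfolding tr_def[of I "\<lambda>x y. \<Sum>\<^sub>\<infinity>j\<in>J. E j \<rho> x y"]
    by (rule nonneg_bounded_summable(2)[OF nn bnd])
qed

lemma qop_family_add:
  assumes T: "T \<in> trace_class I" and T': "T' \<in> trace_class I"
  shows "(\<Sum>\<^sub>\<infinity>j\<in>J. E j (\<lambda>x y. T x y + T' x y) x y) = (\<Sum>\<^sub>\<infinity>j\<in>J. E j T x y) + (\<Sum>\<^sub>\<infinity>j\<in>J. E j T' x y)"
proof -
  have "(\<Sum>\<^sub>\<infinity>j\<in>J. E j (\<lambda>x y. T x y + T' x y) x y) = (\<Sum>\<^sub>\<infinity>j\<in>J. E j T x y + E j T' x y)"
    by (intro infsum_cong) (simp add: qop_add[OF E T T'])
  then show ?thesis
    by (simp add: infsum_add qop_family_summable T T')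
qed

lemma qop_family_scale:
  assumes T: "T \<in> trace_class I"
  shows "(\<Sum>\<^sub>\<infinity>j\<in>J. E j (\<lambda>x y. c * T x y) x y) = c * (\<Sum>\<^sub>\<infinity>j\<in>J. E j T x y)"
proof -
  have "(\<Sum>\<^sub>\<infinity>j\<in>J. E j (\<lambda>x y. c * T x y) x y) = (\<Sum>\<^sub>\<infinity>j\<in>J. c * E j T x y)"
    by (intro infsum_cong) (simp add: qop_scale[OF E T])
  then show ?thesis
    by (simp add: infsum_cmult_right')
qed

lemma qop_family_trace_class:
  assumes "T \<in> trace_class I"
  shows "(\<lambda>x y. \<Sum>\<^sub>\<infinity>j\<in>J. E j T x y) \<in> trace_class I"
  using assms
proof (induction rule: trace_class_induct)
  case zero
  have "(\<lambda>x y. \<Sum>\<^sub>\<infinity>j\<in>J. E j zero_op x y) = zero_op"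
    by (intro ext) (use qop_zero[OF E] in \<open>auto simp: zero_op_def intro!: infsum_0\<close>)
  then show ?case by (simp add: trace_class_zero)
next
  case (add T c \<rho>)
  have \<rho>: "pos_trace_class I \<rho>" using add by (simp add: partial_density_iff)
  then have "\<rho> \<in> trace_class I" by (simp add: pos_trace_class_iff)
  moreover have "(\<lambda>x y. \<Sum>\<^sub>\<infinity>j\<in>J. E j \<rho> x y) \<in> trace_class I"
    using qop_family_pos(1)[OF \<rho>] by (simp add: pos_trace_class_iff)
  ultimately show ?case
    using add by (simp add: qop_family_add qop_family_scale trace_class_add trace_class_scale)
qed

lemma qop_infsum: "qop I (\<lambda>\<rho> x y. \<Sum>\<^sub>\<infinity>j\<in>J. E j \<rho> x y)"
  by (rule qopI)
    (simp_all add: qop_family_trace_class qop_family_add qop_family_scale qop_family_block qop_family_pos(2))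

end

text \<open>
  The entries of the positive operator \<open>Q (\<sigma> - \<sigma>\<^sub>n)\<close> are bounded by twice its trace, hence by
  \<open>2 tr (\<sigma> - \<sigma>\<^sub>n)\<close>, so that normality of \<open>Q\<close> needs no topology beyond entrywise convergence.
\<close>

lemma qop_continuous:
  assumes Q: "qop I Q" and \<sigma>n: "\<And>n. pos_trace_class I (\<sigma>n n)" and \<sigma>: "pos_trace_class I \<sigma>"
    and le: "\<And>n. psd I (\<lambda>x y. \<sigma> x y - \<sigma>n n x y)"
    and lim: "\<And>x. (\<lambda>n. \<sigma>n n x x) \<longlonglongrightarrow> \<sigma> x x"
  shows "(\<lambda>n. Q (\<sigma>n n) x y) \<longlonglongrightarrow> Q \<sigma> x y"
proof -
  define \<delta> where "\<delta> n = (\<lambda>x y. \<sigma> x y - \<sigma>n n x y)" for n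
  have \<delta>: "pos_trace_class I (\<delta> n)" for n
    using le \<sigma> \<sigma>n by (simp add: \<delta>_def pos_trace_class_iff trace_class_diff)
  have "(\<lambda>n. tr I (\<delta> n)) \<longlonglongrightarrow> 0"
  proof (rule LIMSEQ_I)
    fix \<epsilon> :: real assume \<epsilon>: "0 < \<epsilon>"
    \<comment> \<open>All but \<open>\<epsilon> / 2\<close> of the trace of \<open>\<sigma>\<close>
      lies on \<open>X\<close>. Since the diagonal of \<open>\<sigma>n n\<close> is nonnegative, the
      part of \<open>tr I (\<delta> n)\<close> outside \<open>X\<close> is at most
      \<open>\<epsilon> / 2\<close> for every \<open>n\<close>, and on \<open>X\<close> only
      finitely many entries have to converge.\<close>
    obtain X where X: "finite X" "X \<subseteq> I" "dist (\<Sum>x\<in>X. Re (\<sigma> x x)) (tr I \<sigma>) \<le> \<epsilon> / 2"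
      using infsum_finite_approximation[of "\<lambda>x. Re (\<sigma> x x)" I "\<epsilon> / 2"] \<sigma> \<epsilon>
      by (auto simp: pos_trace_class_def tr_def)
    have "(\<lambda>n. \<Sum>x\<in>X. Re (\<delta> n x x)) \<longlonglongrightarrow> (\<Sum>x\<in>X. Re (\<sigma> x x - \<sigma> x x))"
      unfolding \<delta>_def by (intro tendsto_sum tendsto_Re tendsto_diff tendsto_const lim)
    then have "(\<lambda>n. \<Sum>x\<in>X. Re (\<delta> n x x)) \<longlonglongrightarrow> 0" by simp
    then have "\<forall>\<^sub>F n in sequentially. (\<Sum>x\<in>X. Re (\<delta> n x x)) < \<epsilon> / 2"
      using \<epsilon> by (intro order_tendstoD) auto
    then obtain n0 where n0: "\<And>n. n \<ge> n0 \<Longrightarrow> (\<Sum>x\<in>X. Re (\<delta> n x x)) < \<epsilon> / 2"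
      by (auto simp: eventually_sequentially)
    have "norm (tr I (\<delta> n) - 0) < \<epsilon>" if "n \<ge> n0" for n
    proof -
      have "tr I (\<delta> n) = tr I \<sigma> - tr I (\<sigma>n n)"
        unfolding \<delta>_def by (rule tr_diff[OF \<sigma> \<sigma>n])
      also have "\<dots> \<le> \<epsilon> / 2 + (\<Sum>x\<in>X. Re (\<sigma> x x)) - (\<Sum>x\<in>X. Re (\<sigma>n n x x))"
        using X(3) sum_diag_le_tr[OF \<sigma>n X(1,2), of n] unfolding dist_real_def by linarith
      also have "\<dots> = \<epsilon> / 2 + (\<Sum>x\<in>X. Re (\<delta> n x x))"
        by (simp add: \<delta>_def sum_subtractf)
      finally show ?thesis using n0[OF that] tr_nonneg[OF \<delta>, of n] by simp
    qed
    then show "\<exists>n0. \<forall>n\<ge>n0. norm (tr I (\<delta> n) - 0) < \<epsilon>" by blast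
  qed
  then have lim0: "(\<lambda>n. 2 * tr I (\<delta> n)) \<longlonglongrightarrow> 0"
    using tendsto_mult[OF tendsto_const, of _ 0 sequentially 2] by simp
  have "(\<lambda>n. Q (\<delta> n) x y) \<longlonglongrightarrow> 0"
  proof (rule Lim_null_comparison[OF _ lim0])
    show "\<forall>\<^sub>F n in sequentially. norm (Q (\<delta> n) x y) \<le> 2 * tr I (\<delta> n)"
      using pos_trace_class_entry_le[OF qop_pos[OF Q \<delta>], of _ x y] qop_tr_le[OF Q \<delta>]
      by (intro always_eventually allI) (meson mult_left_mono order_trans zero_le_numeral)
  qed
  moreover have "Q (\<delta> n) x y = Q \<sigma> x y - Q (\<sigma>n n) x y" for n
    unfolding \<delta>_def using \<sigma> \<sigma>n by (subst qop_diff[OF Q]) (auto simp: pos_trace_class_iff)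
  ultimately have "(\<lambda>n. Q \<sigma> x y - Q (\<sigma>n n) x y) \<longlonglongrightarrow> 0" by simp
  from tendsto_diff[OF tendsto_const[of "Q \<sigma> x y"] this] show ?thesis by simp
qed

text \<open>The difference has zero diagonal, and the diagonal bounds all other entries.\<close>

lemma psd_antisym:
  assumes "psd I (\<lambda>x y. A x y - B x y)" "psd I (\<lambda>x y. B x y - A x y)" "x \<in> I" "y \<in> I"
  shows "A x y = B x y"
proof -
  have "Re (A z z - B z z) = 0" if "z \<in> I" for z
    using psd_diag_Re[OF assms(1) that] psd_diag_Re[OF assms(2) that] by simp
  then show ?thesis
    using psd_entry_le[OF assms(1,3,4)] assms(3,4) by simp
qed

text \<open>An entrywise limit that lies above every \<open>E n\<close> is the least upper bound:
  any other bound \<open>G\<close> has \<open>G \<sigma> - E n \<sigma>\<close> positive for all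
  \<open>n\<close>, hence also in the limit. The conclusion is stated on partial densities because
  \<open>qop_le\<close> compares operations exactly there.\<close>

lemma supr_qop_order:
  assumes E: "\<And>n. qop I (E n)" and W: "qop I W"
    and le: "\<And>n \<rho>. \<rho> \<in> partial_density I \<Longrightarrow> psd I (\<lambda>x y. W \<rho> x y - E n \<rho> x y)"
    and lim: "\<And>\<rho> x y. \<rho> \<in> partial_density I \<Longrightarrow> (\<lambda>n. E n \<rho> x y) \<longlonglongrightarrow> W \<rho> x y"
    and \<rho>: "\<rho> \<in> partial_density I"
  shows "supr (qop_order I) UNIV (\<lambda>n. restrict_tc I (E n)) \<rho> = W \<rho>"
proof -
  let ?L = "qop_order I" and ?A = "range (\<lambda>n. restrict_tc I (E n))"
  have tc: "\<sigma> \<in> trace_class I" if "\<sigma> \<in> partial_density I" for \<sigma>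
    using that by (simp add: partial_density_iff pos_trace_class_iff)
  have diff: "dominated I (\<lambda>x y. A x y - B x y)" if "A \<in> trace_class I" "B \<in> trace_class I" for A B
    using that by (intro trace_class_dominated trace_class_diff)
  have res: "restrict_tc I F \<sigma> = F \<sigma>" if "\<sigma> \<in> partial_density I" for F \<sigma>
    using tc[OF that] by (simp add: restrict_tc_def)
  have W_upper: "restrict_tc I W \<in> Upper ?L ?A"
  proof -
    have "qop_le I (restrict_tc I (E n)) (restrict_tc I W)" for n
      unfolding qop_le_def
    proof
      fix \<sigma> assume \<sigma>: "\<sigma> \<in> partial_density I"
      then show "positive_op I (\<lambda>x y. restrict_tc I W \<sigma> x y - restrict_tc I (E n) \<sigma> x y)"
        using positive_op_iff_psd[OF diff[OF qop_trace_class[OF W tc] qop_trace_class[OF E tc]]] le[OF \<sigma>]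
        by (simp add: res)
    qed
    then show ?thesis
      using quantum_operation_restrict_tc[OF W] by (auto simp: Upper_def qop_order_def)
  qed
  have W_least: "qop_le I (restrict_tc I W) G" if G: "G \<in> Upper ?L ?A" for G
    unfolding qop_le_def
  proof
    fix \<sigma> assume \<sigma>: "\<sigma> \<in> partial_density I"
    have Gtc: "G \<sigma> \<in> trace_class I"
      using G tc[OF \<sigma>] by (auto simp: Upper_def qop_order_def quantum_operation_def)
    have "psd I (\<lambda>x y. G \<sigma> x y - W \<sigma> x y)"
    proof (rule psd_limit)
      have "psd I (\<lambda>x y. G \<sigma> x y - E n \<sigma> x y)" for n
      proof -
        have "qop_le I (restrict_tc I (E n)) G"
          using G quantum_operation_restrict_tc[OF E] by (auto simp: Upper_def qop_order_def)
        then have "positive_op I (\<lambda>x y. G \<sigma> x y - E n \<sigma> x y)"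
          using \<sigma> res[OF \<sigma>] by (auto simp: qop_le_def)
        then show ?thesis by (rule positive_op_psd)
      qed
      then show "\<forall>\<^sub>F n in sequentially. psd I (\<lambda>x y. G \<sigma> x y - E n \<sigma> x y)" by simp
      show "(\<lambda>n. G \<sigma> x y - E n \<sigma> x y) \<longlonglongrightarrow> G \<sigma> x y - W \<sigma> x y" for x y
        by (intro tendsto_diff tendsto_const lim[OF \<sigma>])
    qed simp
    then show "positive_op I (\<lambda>x y. G \<sigma> x y - restrict_tc I W \<sigma> x y)"
      using positive_op_iff_psd[OF diff[OF Gtc qop_trace_class[OF W tc[OF \<sigma>]]]] by (simp add: res[OF \<sigma>])
  qed
  have "least ?L (restrict_tc I W) (Upper ?L ?A)"
    unfolding least_def using W_upper W_least by (auto simp: Upper_def qop_order_def)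
  \<comment> \<open>The existence of one least upper bound is what makes the choice in
    \<open>supr\<close> meaningful; it may choose a different \<open>G\<close>, which is then
    compared with \<open>W\<close> at \<open>\<rho>\<close>.\<close>
  then have "least ?L (supr ?L UNIV (\<lambda>n. restrict_tc I (E n))) (Upper ?L ?A)"
    unfolding supr_def sup_def by (rule someI[of "\<lambda>l. least ?L l (Upper ?L ?A)"])
  then obtain G where G: "supr ?L UNIV (\<lambda>n. restrict_tc I (E n)) = G" "G \<in> Upper ?L ?A" "qop_le I G (restrict_tc I W)"
    using W_upper by (auto simp: least_def qop_order_def)
  have Gtc: "G \<rho> \<in> trace_class I"
    using G(2) tc[OF \<rho>] by (auto simp: Upper_def qop_order_def quantum_operation_def)
  have "psd I (\<lambda>x y. G \<rho> x y - W \<rho> x y)" "psd I (\<lambda>x y. W \<rho> x y - G \<rho> x y)"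
    using bspec[OF W_least[OF G(2), unfolded qop_le_def] \<rho>] bspec[OF G(3)[unfolded qop_le_def] \<rho>]
    by (simp_all add: res[OF \<rho>] positive_op_psd)
  then have "G \<rho> x y = W \<rho> x y" if "x \<in> I" "y \<in> I" for x y
    using that by (rule psd_antisym)
  moreover have "G \<rho> x y = W \<rho> x y" if "x \<notin> I \<or> y \<notin> I" for x y
    using that trace_class_dominated[OF Gtc] trace_class_dominated[OF qop_trace_class[OF W tc[OF \<rho>]]]
    by (auto simp: dominated_def)
  ultimately show ?thesis using G(1) by (intro ext) blast
qed


section \<open>Operators on registers\<close>

text \<open>The hybrid differs from \<open>ref S\<close> only where one of the two configurations
  does, so it stays in the basis of the incomplete tensor product.\<close>

lemma configs_override:
  assumes "x \<in> configs S" "w \<in> configs S"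
  shows "override_on x w W \<in> configs S"
proof -
  have "{v \<in> vars S. override_on x w W v \<noteq> ref S v} \<subseteq>
      {v \<in> vars S. x v \<noteq> ref S v} \<union> {v \<in> vars S. w v \<noteq> ref S v}"
    by (auto simp: override_on_def)
  moreover have "finite \<dots>" using assms by (simp add: configs_def)
  ultimately have "finite {v \<in> vars S. override_on x w W v \<noteq> ref S v}" by (rule finite_subset)
  then show ?thesis
    using assms by (auto simp: configs_def PiE_iff extensional_def override_on_def)
qed

lemma map_in_reg_basis:
  assumes "x \<in> configs S" "register S qs"
  shows "map x qs \<in> reg_basis S qs"
proof -
  have "set qs \<subseteq> vars S" using assms(2) by (simp add: register_def)
  then show ?thesis
    unfolding reg_basis_def
    using assms(1) by (induction qs) (auto simp: set_Cons_def configs_def)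
qed

lemma eq_if_agree:
  assumes "map x qs = map y qs" "\<And>v. v \<notin> set qs \<Longrightarrow> x v = y v"
  shows "x = y"
proof
  show "x v = y v" for v
    using assms by (cases "v \<in> set qs") auto
qed

text \<open>The values off the register label the blocks, since \<open>extend\<close> connects only
  configurations that agree there. Within a block a configuration is determined by its register
  values, so the block is a submatrix of the stacked \<open>M\<close>.\<close>

lemma contraction_extend:
  assumes "register S qs" and M: "contraction (J \<times> reg_basis S qs) (reg_basis S qs) (\<lambda>(j, u). M j u)"
  shows "contraction (J \<times> configs S) (configs S) (\<lambda>(j, x). extend S qs (M j) x)"
proof (rule contraction_fibres[where f = "\<lambda>(j, x). restrict x (- set qs)" and g = "\<lambda>z. restrict z (- set qs)"])
  have agree: "x v = y v" if "restrict x (- set qs) = restrict y (- set qs)" "v \<notin> set qs" for x y :: "'a \<Rightarrow> 'b" and v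
    using fun_cong[OF that(1), of v] that(2) by simp
  have restr: "restrict x (- set qs) = restrict y (- set qs)" if "\<forall>v. v \<notin> set qs \<longrightarrow> x v = y v"
    for x y :: "'a \<Rightarrow> 'b"
    using that by (auto simp: restrict_def)
  have inj: "x = y" if "restrict x (- set qs) = restrict y (- set qs)" "map x qs = map y qs" for x y :: "'a \<Rightarrow> 'b"
    by (rule eq_if_agree[OF that(2)]) (rule agree[OF that(1)])
  show "(\<lambda>(j, x). extend S qs (M j) x) k z = 0"
    if "(\<lambda>(j, x). restrict x (- set qs)) k \<noteq> restrict z (- set qs)" for k z
    using that by (cases k) (auto simp: extend_def dest: restr)
  fix r
  show "contraction {k \<in> J \<times> configs S. (\<lambda>(j, x). restrict x (- set qs)) k = r}
      {z \<in> configs S. restrict z (- set qs) = r} (\<lambda>(j, x). extend S qs (M j) x)"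
  proof (rule contraction_reindex[OF M, of "\<lambda>(j, x). (j, map x qs)" _ "\<lambda>z. map z qs"])
    show "inj_on (\<lambda>(j, x). (j, map x qs)) {k \<in> J \<times> configs S. (\<lambda>(j, x). restrict x (- set qs)) k = r}"
      by (rule inj_onI, clarsimp simp del: map_eq_conv) (rule inj, simp_all)
    show "inj_on (\<lambda>z. map z qs) {z \<in> configs S. restrict z (- set qs) = r}"
      by (rule inj_onI, rule inj) auto
  qed (use assms(1) map_in_reg_basis agree in \<open>auto simp: extend_def\<close>)
qed

section \<open>Contractions from unitaries, measurements, orthonormal families and
  initialisation\<close>

lemma contraction_unit: "contraction ({()} \<times> K) I (\<lambda>(j, k). A k) \<longleftrightarrow> contraction K I A"
proof
  assume "contraction ({()} \<times> K) I (\<lambda>(j, k). A k)"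
  then show "contraction K I A"
    by (rule contraction_reindex[of _ _ _ "Pair ()" _ id]) (auto simp: inj_on_def)
next
  assume "contraction K I A"
  then show "contraction ({()} \<times> K) I (\<lambda>(j, k). A k)"
    by (rule contraction_reindex[of _ _ _ snd _ id]) (auto simp: inj_on_def)
qed

lemma contraction_empty: "contraction {} I A"
  by (simp add: contraction_def sum_nonneg)

text \<open>The Gram condition makes the stacked matrix an isometry on finitely supported vectors,
  and selecting finitely many rows can only decrease the norm.\<close>

lemma contraction_isometric_family:
  assumes col: "\<And>j z. j \<in> J \<Longrightarrow> z \<in> I \<Longrightarrow> sq_summable K (\<lambda>k. A j k z)"
    and gram: "\<And>w z. w \<in> I \<Longrightarrow> z \<in> I \<Longrightarrow>
      ((\<lambda>j. \<Sum>\<^sub>\<infinity>k\<in>K. cnj (A j k w) * A j k z) has_sum (if w = z then 1 else 0)) J"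
  shows "contraction (J \<times> K) I (\<lambda>(j, k). A j k)"
  unfolding contraction_def
proof (intro allI impI)
  fix X F and c :: "_ \<Rightarrow> complex" assume XF: "finite X \<and> X \<subseteq> J \<times> K \<and> finite F \<and> F \<subseteq> I"
  define b where "b j k = (\<Sum>z\<in>F. A j k z * c z)" for j k
  \<comment> \<open>The squared norm of \<open>A j\<close> applied to \<open>c\<close>, written
    through Gram entries because the hypothesis sums those over \<open>j\<close>.\<close>
  define h where "h j = (\<Sum>w\<in>F. \<Sum>z\<in>F. (cnj (c w) * c z) * (\<Sum>\<^sub>\<infinity>k\<in>K. cnj (A j k w) * A j k z))" for j
  have sum_h: "(h has_sum (\<Sum>w\<in>F. \<Sum>z\<in>F. (cnj (c w) * c z) * (if w = z then 1 else 0))) J"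
    unfolding h_def using XF by (intro has_sum_finite_sum has_sum_cmult_right gram) auto
  have "(\<Sum>w\<in>F. \<Sum>z\<in>F. (cnj (c w) * c z) * (if w = z then 1 else 0)) = (\<Sum>z\<in>F. cnj (c z) * c z)"
    using XF by (intro sum.cong refl) (simp add: if_distrib[of "\<lambda>t. _ * t"] cong: if_cong)
  also have "\<dots> = of_real (\<Sum>z\<in>F. (cmod (c z))\<^sup>2)"
    unfolding of_real_sum complex_norm_square by (simp add: mult.commute)
  finally have Re_h: "((\<lambda>j. Re (h j)) has_sum (\<Sum>z\<in>F. (cmod (c z))\<^sup>2)) J"
    using has_sum_Re[OF sum_h] by simp
  have b_sum: "((\<lambda>k. (cmod (b j k))\<^sup>2) has_sum Re (h j)) K" if j: "j \<in> J" for j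
  proof -
    have "((\<lambda>k. \<Sum>w\<in>F. \<Sum>z\<in>F. (cnj (c w) * c z) * (cnj (A j k w) * A j k z)) has_sum h j) K"
      unfolding h_def using XF col[OF j]
      by (intro has_sum_finite_sum has_sum_cmult_right has_sum_infsum sq_summable_mult_summable) auto
    moreover have "(\<Sum>w\<in>F. \<Sum>z\<in>F. (cnj (c w) * c z) * (cnj (A j k w) * A j k z)) = of_real ((cmod (b j k))\<^sup>2)" for k
    proof -
      have "complex_of_real ((cmod (b j k))\<^sup>2) = cnj (b j k) * b j k"
        unfolding complex_norm_square by (rule mult.commute)
      also have "\<dots> = (\<Sum>w\<in>F. \<Sum>z\<in>F. cnj (A j k w * c w) * (A j k z * c z))"
        by (simp add: b_def sum_product)
      finally show ?thesis by (simp add: mult_ac)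
    qed
    ultimately have "((\<lambda>k. complex_of_real ((cmod (b j k))\<^sup>2)) has_sum h j) K" by simp
    from has_sum_Re[OF this] show ?thesis by simp
  qed
  define J0 where "J0 = fst ` X"
  define K0 where "K0 = snd ` X"
  have JK: "finite J0" "J0 \<subseteq> J" "finite K0" "K0 \<subseteq> K" "X \<subseteq> J0 \<times> K0"
    using XF by (force simp: J0_def K0_def)+
  have "(\<Sum>k\<in>X. (cmod (\<Sum>z\<in>F. (\<lambda>(j, k). A j k) k z * c z))\<^sup>2) = (\<Sum>p\<in>X. (cmod (b (fst p) (snd p)))\<^sup>2)"
    by (simp add: b_def case_prod_beta)
  also have "\<dots> \<le> (\<Sum>p\<in>J0 \<times> K0. (cmod (b (fst p) (snd p)))\<^sup>2)"
    using JK by (intro sum_mono2) auto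
  also have "\<dots> = (\<Sum>j\<in>J0. \<Sum>k\<in>K0. (cmod (b j k))\<^sup>2)"
    by (simp add: sum_Times)
  also have "\<dots> \<le> (\<Sum>j\<in>J0. Re (h j))"
    using JK by (intro sum_mono finite_sum_le_has_sum[OF b_sum]) auto
  also have "\<dots> \<le> (\<Sum>z\<in>F. (cmod (c z))\<^sup>2)"
    using JK has_sum_nonneg[OF b_sum] by (intro finite_sum_le_has_sum[OF Re_h]) auto
  finally show "(\<Sum>k\<in>X. (cmod (\<Sum>z\<in>F. (\<lambda>(j, k). A j k) k z * c z))\<^sup>2) \<le> (\<Sum>z\<in>F. (cmod (c z))\<^sup>2)" .
qed

lemma bounded_op_column:
  assumes "bounded_op B A" "z \<in> B"
  shows "sq_summable B (\<lambda>u. A u z)"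
proof -
  have "ket z \<in> ell2 B"
    by (rule finite_support_ell2[of "{z}"]) (use assms(2) in \<open>auto simp: ket_def\<close>)
  then have "app B A (ket z) \<in> ell2 B" using assms(1) by (auto simp: bounded_op_def)
  moreover have "app B A (ket z) = (\<lambda>u. A u z)"
  proof
    fix u
    have "app B A (ket z) u = (\<Sum>\<^sub>\<infinity>y\<in>{z}. A u y * ket z y)"
      unfolding app_def using assms(2) by (intro infsum_cong_neutral) (auto simp: ket_def)
    then show "app B A (ket z) u = A u z" by (simp add: ket_def)
  qed
  ultimately show ?thesis by (simp add: ell2_def)
qed

lemma contraction_measurement:
  assumes "measurement S qs outs M"
  shows "contraction (outs \<times> reg_basis S qs) (reg_basis S qs) (\<lambda>(m, u). M m u)"
proof (rule contraction_isometric_family)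
  show "sq_summable (reg_basis S qs) (\<lambda>u. M m u z)" if "m \<in> outs" "z \<in> reg_basis S qs" for m z
    using that assms by (intro bounded_op_column) (auto simp: measurement_def)
  show "((\<lambda>m. \<Sum>\<^sub>\<infinity>u\<in>reg_basis S qs. cnj (M m u w) * M m u z) has_sum (if w = z then 1 else 0)) outs"
    if "w \<in> reg_basis S qs" "z \<in> reg_basis S qs" for w z
    using that assms by (auto simp: measurement_def mult_def adj_def id_op_def)
qed

lemma contraction_unitary:
  assumes "unitary B U"
  shows "contraction B B U"
proof (rule contraction_unit[THEN iffD1], rule contraction_isometric_family)
  show "sq_summable B (\<lambda>u. U u z)" if "z \<in> B" for z
    using that assms by (intro bounded_op_column) (auto simp: unitary_def)
  show "((\<lambda>j. \<Sum>\<^sub>\<infinity>u\<in>B. cnj (U u w) * U u z) has_sum (if w = z then 1 else 0)) {()}"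
    if "w \<in> B" "z \<in> B" for w z
  proof -
    have "mult B (adj U) U w z = id_op B w z" using assms by (simp add: unitary_def)
    then show ?thesis using that by (intro has_sum_finiteI) (auto simp: mult_def adj_def id_op_def)
  qed
qed

lemma contraction_orthonormal:
  assumes "\<And>k. k \<in> K \<Longrightarrow> \<psi> k \<in> ell2 B"
    and "\<And>k l. k \<in> K \<Longrightarrow> l \<in> K \<Longrightarrow> cinner B (\<psi> k) (\<psi> l) = (if k = l then 1 else 0)"
  shows "contraction B K (\<lambda>u k. \<psi> k u)"
proof (rule contraction_unit[THEN iffD1], rule contraction_isometric_family)
  show "sq_summable B (\<lambda>u. \<psi> k u)" if "k \<in> K" for k
    using assms(1)[OF that] by (simp add: ell2_def)
  show "((\<lambda>j. \<Sum>\<^sub>\<infinity>u\<in>B. cnj (\<psi> k u) * \<psi> l u) has_sum (if k = l then 1 else 0)) {()}"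
    if "k \<in> K" "l \<in> K" for k l
    using assms(2)[OF that] by (intro has_sum_finiteI) (auto simp: cinner_def)
qed

text \<open>In each \<open>|\<psi>\<rangle>\<langle>n|\<close> only column \<open>n\<close> is
  nonzero, and it equals the unit vector \<open>\<psi>\<close>. Labelling rows by \<open>n\<close>
  therefore leaves blocks with a single column.\<close>

lemma contraction_reset:
  fixes B :: "'i set"
  assumes "\<psi> \<in> ell2 B" "norm2 B \<psi> = 1"
  shows "contraction (B \<times> B) B (\<lambda>(n, u). ketbra \<psi> (ket n) u)"
proof (rule contraction_fibres[where f = fst and g = id])
  show "(\<lambda>(n, u). ketbra \<psi> (ket n) u) k z = 0" if "fst k \<noteq> id z" for k z
    using that by (cases k) (auto simp: ketbra_def ket_def)
  fix r :: 'i
  have \<psi>: "(\<Sum>u\<in>X. (cmod (\<psi> u))\<^sup>2) \<le> 1" if "finite X" "X \<subseteq> B" for X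
    using assms that finite_sum_le_infsum[of "\<lambda>u. (cmod (\<psi> u))\<^sup>2" B X] by (simp add: ell2_def norm2_def)
  have "contraction B {r} (\<lambda>u _. \<psi> u)"
    unfolding contraction_def
  proof (intro allI impI)
    fix X F and c :: "_ \<Rightarrow> complex" assume XF: "finite X \<and> X \<subseteq> B \<and> finite F \<and> F \<subseteq> {r}"
    then have "F = {} \<or> F = {r}" by auto
    then show "(\<Sum>k\<in>X. (cmod (\<Sum>z\<in>F. \<psi> k * c z))\<^sup>2) \<le> (\<Sum>z\<in>F. (cmod (c z))\<^sup>2)"
    proof
      assume "F = {r}"
      have "(\<Sum>k\<in>X. (cmod (\<psi> k * c r))\<^sup>2) = (\<Sum>u\<in>X. (cmod (\<psi> u))\<^sup>2) * (cmod (c r))\<^sup>2"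
        by (simp add: norm_mult power_mult_distrib sum_distrib_right)
      also have "\<dots> \<le> 1 * (cmod (c r))\<^sup>2"
        using \<psi> XF by (intro mult_right_mono) auto
      finally show ?thesis using \<open>F = {r}\<close> by simp
    qed simp
  qed
  then show "contraction {k \<in> B \<times> B. fst k = r} {z \<in> B. id z = r} (\<lambda>(n, u). ketbra \<psi> (ket n) u)"
    by (rule contraction_reindex[of _ _ _ snd _ id]) (auto simp: inj_on_def ketbra_def ket_def)
qed


section \<open>Circuits\<close>

lemma csem_support: "x \<notin> configs S \<Longrightarrow> csem S C x y = 0"
  by (induction C arbitrary: x y) (auto simp: id_op_def extend_def mult_def)

text \<open>\<open>A\<close> is the tensor product of the identity on the variables in \<open>W\<close> with some other operator.\<close>

definition trivial_on :: "('v, 'b) qsystem \<Rightarrow> 'v set \<Rightarrow> ('v \<Rightarrow> 'b) oper \<Rightarrow> bool" where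
  "trivial_on S W A \<longleftrightarrow>
     (\<forall>x\<in>configs S. \<forall>y\<in>configs S. (\<exists>v\<in>W. x v \<noteq> y v) \<longrightarrow> A x y = 0) \<and>
     (\<forall>x\<in>configs S. \<forall>y\<in>configs S. \<forall>w\<in>configs S. (\<forall>v\<in>W. x v = y v) \<longrightarrow>
        A (override_on x w W) (override_on y w W) = A x y)"

lemma trivial_onD1:
  "trivial_on S W A \<Longrightarrow> x \<in> configs S \<Longrightarrow> y \<in> configs S \<Longrightarrow> v \<in> W \<Longrightarrow> x v \<noteq> y v \<Longrightarrow> A x y = 0"
  by (auto simp: trivial_on_def)

lemma trivial_onD2:
  "trivial_on S W A \<Longrightarrow> x \<in> configs S \<Longrightarrow> y \<in> configs S \<Longrightarrow> w \<in> configs S \<Longrightarrow>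
    (\<And>v. v \<in> W \<Longrightarrow> x v = y v) \<Longrightarrow> A (override_on x w W) (override_on y w W) = A x y"
  by (auto simp: trivial_on_def)

lemma trivial_on_extend:
  assumes "set qs \<inter> W = {}"
  shows "trivial_on S W (extend S qs A)"
  unfolding trivial_on_def
proof (intro conjI ballI impI)
  fix x y assume xy: "x \<in> configs S" "y \<in> configs S"
  show "extend S qs A x y = 0" if "\<exists>v\<in>W. x v \<noteq> y v"
    using that assms by (auto simp: extend_def)
  fix w assume w: "w \<in> configs S" "\<forall>v\<in>W. x v = y v"
  have "map (override_on z w W) qs = map z qs" for z
    using assms by (auto simp: override_on_def)
  moreover have "(\<forall>v. v \<notin> set qs \<longrightarrow> override_on x w W v = override_on y w W v) \<longleftrightarrow>
      (\<forall>v. v \<notin> set qs \<longrightarrow> x v = y v)"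
    using w(2) by (auto simp: override_on_def)
  ultimately show "extend S qs A (override_on x w W) (override_on y w W) = extend S qs A x y"
    using xy w(1) by (auto simp: extend_def configs_override simp del: map_eq_conv)
qed

lemma trivial_on_id: "trivial_on S W (id_op (configs S))"
  unfolding trivial_on_def
proof (intro conjI ballI impI)
  fix x y assume xy: "x \<in> configs S" "y \<in> configs S"
  show "id_op (configs S) x y = 0" if "\<exists>v\<in>W. x v \<noteq> y v"
    using that by (auto simp: id_op_def)
  fix w assume w: "w \<in> configs S" "\<forall>v\<in>W. x v = y v"
  then have "override_on x w W = override_on y w W \<longleftrightarrow> x = y"
    unfolding fun_eq_iff override_on_def by metis
  then show "id_op (configs S) (override_on x w W) (override_on y w W) = id_op (configs S) x y"
    using xy w(1) by (simp add: id_op_def configs_override)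
qed

text \<open>Only intermediate configurations that agree with the row index on \<open>W\<close>
  contribute. Overriding \<open>W\<close> permutes the remaining choices without changing either
  factor.\<close>

lemma trivial_on_mult:
  assumes A: "trivial_on S W A" and B: "trivial_on S W B"
  shows "trivial_on S W (mult (configs S) A B)"
  unfolding trivial_on_def
proof (intro conjI ballI impI)
  fix x y assume xy: "x \<in> configs S" "y \<in> configs S"
  have restrict: "mult (configs S) A B x' y' = (\<Sum>\<^sub>\<infinity>z\<in>{z \<in> configs S. \<forall>v\<in>W. z v = x' v}. A x' z * B z y')"
    if "x' \<in> configs S" for x' y'
    unfolding mult_def
    by (rule infsum_cong_neutral) (use that trivial_onD1[OF A that] in fastforce)+
  show "mult (configs S) A B x y = 0" if "\<exists>v\<in>W. x v \<noteq> y v"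
  proof -
    from that obtain v where v: "v \<in> W" "x v \<noteq> y v" by blast
    have "B z y = 0" if "z \<in> configs S" "\<forall>v\<in>W. z v = x v" for z
      using trivial_onD1[OF B that(1) xy(2) v(1)] that(2) v by auto
    then show ?thesis
      unfolding restrict[OF xy(1)] by (intro infsum_0) auto
  qed
  fix w assume w: "w \<in> configs S" and eq: "\<forall>v\<in>W. x v = y v"
  let ?o = "\<lambda>z. override_on z w W"
  \<comment> \<open>The inverse puts back the values of \<open>x\<close>, which on the left-hand set
    are the values of \<open>z\<close> on \<open>W\<close>.\<close>
  have bij: "bij_betw ?o {z \<in> configs S. \<forall>v\<in>W. z v = x v} {z \<in> configs S. \<forall>v\<in>W. z v = ?o x v}"
    by (rule bij_betw_byWitness[where f' = "\<lambda>z. override_on z x W"])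
      (use xy w in \<open>auto simp: configs_override, auto simp: override_on_def fun_eq_iff\<close>)
  have "mult (configs S) A B (?o x) (?o y) =
      (\<Sum>\<^sub>\<infinity>z\<in>{z \<in> configs S. \<forall>v\<in>W. z v = ?o x v}. A (?o x) z * B z (?o y))"
    by (rule restrict) (use xy w configs_override in auto)
  also have "\<dots> = (\<Sum>\<^sub>\<infinity>z\<in>{z \<in> configs S. \<forall>v\<in>W. z v = x v}. A (?o x) (?o z) * B (?o z) (?o y))"
    by (rule infsum_reindex_bij_betw[OF bij, symmetric])
  also have "\<dots> = (\<Sum>\<^sub>\<infinity>z\<in>{z \<in> configs S. \<forall>v\<in>W. z v = x v}. A x z * B z y)"
    using trivial_onD2[OF A xy(1) _ w] trivial_onD2[OF B _ xy(2) w] eq by (intro infsum_cong) auto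
  also have "\<dots> = mult (configs S) A B x y"
    by (rule restrict[OF xy(1), symmetric])
  finally show "mult (configs S) A B (?o x) (?o y) = mult (configs S) A B x y" .
qed

lemma trivial_on_sum:
  assumes "\<And>i. i \<in> D \<Longrightarrow> trivial_on S W (A i)"
  shows "trivial_on S W (\<lambda>x y. \<Sum>i\<in>D. A i x y)"
  unfolding trivial_on_def
proof (intro conjI ballI impI)
  fix x y assume xy: "x \<in> configs S" "y \<in> configs S"
  show "(\<Sum>i\<in>D. A i x y) = 0" if "\<exists>v\<in>W. x v \<noteq> y v"
    using that trivial_onD1[OF assms xy] by (intro sum.neutral) blast
  fix w assume "w \<in> configs S" "\<forall>v\<in>W. x v = y v"
  then show "(\<Sum>i\<in>D. A i (override_on x w W) (override_on y w W)) = (\<Sum>i\<in>D. A i x y)"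
    using xy by (intro sum.cong refl trivial_onD2[OF assms]) auto
qed

text \<open>Turns the syntactic disjointness of the control register and the branches into the
  operator condition used in \<open>contraction_QIf\<close>.\<close>

lemma csem_trivial_on: "cvars C \<inter> W = {} \<Longrightarrow> trivial_on S W (csem S C)"
proof (induction C)
  case (QIf qs d \<psi> C)
  have "trivial_on S W (mult (configs S) (extend S qs (ketbra (\<psi> i) (\<psi> i))) (csem S (C i)))"
    if "i \<in> {1..d}" for i
  proof (rule trivial_on_mult)
    show "trivial_on S W (extend S qs (ketbra (\<psi> i) (\<psi> i)))"
      using QIf.prems by (intro trivial_on_extend) auto
    have "cvars (C i) \<inter> W = {}" using QIf.prems that by (auto simp del: atLeastAtMost_iff)
    then show "trivial_on S W (csem S (C i))" by (rule QIf.IH[OF rangeI])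
  qed
  then show ?case unfolding csem.simps by (rule trivial_on_sum)
qed (simp_all add: trivial_on_id trivial_on_extend trivial_on_mult Int_Un_distrib2)

lemma contraction_id: "contraction I I (id_op I)"
  unfolding contraction_def
proof (intro allI impI)
  fix X F and c :: "_ \<Rightarrow> complex" assume XF: "finite X \<and> X \<subseteq> I \<and> finite F \<and> F \<subseteq> I"
  have "(\<Sum>z\<in>F. id_op I k z * c z) = (if k \<in> F then c k else 0)" if "k \<in> X" for k
    using that XF by (auto simp: id_op_def if_distrib[of "\<lambda>t. t * _"] cong: if_cong)
  then have "(\<Sum>k\<in>X. (cmod (\<Sum>z\<in>F. id_op I k z * c z))\<^sup>2) = (\<Sum>k\<in>X. if k \<in> F then (cmod (c k))\<^sup>2 else 0)"
    by (intro sum.cong) auto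
  also have "\<dots> = (\<Sum>k\<in>X \<inter> F. (cmod (c k))\<^sup>2)"
    using XF by (simp add: sum.inter_restrict)
  also have "\<dots> \<le> (\<Sum>z\<in>F. (cmod (c z))\<^sup>2)"
    using XF by (intro sum_mono2) auto
  finally show "(\<Sum>k\<in>X. (cmod (\<Sum>z\<in>F. id_op I k z * c z))\<^sup>2) \<le> (\<Sum>z\<in>F. (cmod (c z))\<^sup>2)" .
qed

text \<open>
  Fixing a reference configuration \<open>w\<close> of the register, the quantum if-statement factors as
  \<open>V D V\<^sup>\<dagger>\<close>, where \<open>V (|i\<rangle> \<otimes> |s\<rangle>) = |\<psi>\<^sub>i\<rangle> \<otimes> |s\<rangle>\<close> is an isometry and \<open>D\<close> is the block diagonal
  operator with blocks \<open>[[C\<^sub>i]]\<close>.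
\<close>

lemma contraction_QIf:
  fixes d :: nat
  assumes reg: "register S qs" and onb: "orthonormal_basis (reg_basis S qs) {1..d} \<psi>"
    and C: "\<And>i. i \<in> {1..d} \<Longrightarrow> contraction (configs S) (configs S) (C i)"
    and triv: "\<And>i. i \<in> {1..d} \<Longrightarrow> trivial_on S (set qs) (C i)"
  shows "contraction (configs S) (configs S)
    (\<lambda>x y. \<Sum>i\<in>{1..d}. mult (configs S) (extend S qs (ketbra (\<psi> i) (\<psi> i))) (C i) x y)"
proof (cases "configs S = {}")
  case True
  then show ?thesis by (simp add: contraction_empty)
next
  case False
  then obtain w where w: "w \<in> configs S" by blast
  \<comment> \<open>Configurations with the register reset to \<open>w\<close> stand for those of
    the remaining variables. In \<open>V\<close> the index \<open>s\<close> ranges over all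
    configurations; columns with \<open>s\<close> outside the range of \<open>r\<close> are
    zero.\<close>
  define r where "r x = override_on x w (set qs)" for x
  have r: "r x \<in> configs S" if "x \<in> configs S" for x
    using that w by (simp add: r_def configs_override)
  have agree: "x v = y v" if "r x = r y" "v \<notin> set qs" for x y v
    using fun_cong[OF that(1), of v] that(2) by (simp add: r_def)
  have inj: "x = y" if "r x = r y" "map x qs = map y qs" for x y
    by (rule eq_if_agree[OF that(2)]) (rule agree[OF that(1)])
  define L where "L = {1..d} \<times> configs S"
  define V where "V x = (\<lambda>(i, s). if r x = s then \<psi> i (map x qs) else 0)" for x
  define D where "D = (\<lambda>(i, s) (j, t). if i = j then C i s t else 0)"
  have "contraction (reg_basis S qs) {1..d} (\<lambda>u i. \<psi> i u)"
    using onb by (intro contraction_orthonormal) (auto simp: orthonormal_basis_def)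
  \<comment> \<open>For fixed \<open>s\<close> the block of \<open>V\<close> is a submatrix of the
    matrix whose columns are the orthonormal vectors \<open>\<psi> i\<close>.\<close>
  then have fibre: "contraction {x \<in> configs S. r x = s} {l \<in> L. snd l = s} V" for s
  proof (rule contraction_reindex[of _ _ _ "\<lambda>x. map x qs" _ fst])
    show "inj_on (\<lambda>x. map x qs) {x \<in> configs S. r x = s}"
      by (rule inj_onI, rule inj) auto
  qed (use map_in_reg_basis[OF _ reg] in \<open>auto simp: L_def V_def inj_on_def\<close>)
  have V: "contraction (configs S) L V"
    by (rule contraction_fibres[OF _ fibre]) (auto simp: V_def)
  have D: "contraction L L D"
  proof (rule contraction_fibres[where f = fst and g = fst])
    show "contraction {l \<in> L. fst l = i} {l \<in> L. fst l = i} D" for i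
    proof (cases "i \<in> {1..d}")
      case True
      from C[OF this] show ?thesis
        by (rule contraction_reindex[of _ _ _ snd _ snd]) (auto simp: L_def D_def inj_on_def)
    next
      case False
      then have "{l \<in> L. fst l = i} = {}" by (auto simp: L_def)
      then show ?thesis by (simp only: contraction_empty)
    qed
  qed (auto simp: D_def)
  have "contraction (configs S) (configs S) (\<lambda>x z. \<Sum>\<^sub>\<infinity>l\<in>L. V x l * (\<Sum>\<^sub>\<infinity>l'\<in>L. D l l' * cnj (V z l')))"
    by (intro contraction_mult[OF V] contraction_mult[OF D] contraction_adjoint[OF V])
  then show ?thesis
  proof (rule contraction_cong)
    fix x z assume x: "x \<in> configs S" and z: "z \<in> configs S"
    have inner: "(\<Sum>\<^sub>\<infinity>l'\<in>L. D (i, s) l' * cnj (V z l')) = C i s (r z) * cnj (\<psi> i (map z qs))"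
      if i: "i \<in> {1..d}" for i s
    proof -
      have "(\<Sum>\<^sub>\<infinity>l'\<in>L. D (i, s) l' * cnj (V z l')) = (\<Sum>\<^sub>\<infinity>l'\<in>{(i, r z)}. D (i, s) l' * cnj (V z l'))"
        using i r[OF z] by (intro infsum_cong_neutral) (auto simp: L_def D_def V_def split: if_splits)
      then show ?thesis by (simp add: D_def V_def)
    qed
    have "(\<Sum>\<^sub>\<infinity>l\<in>L. V x l * (\<Sum>\<^sub>\<infinity>l'\<in>L. D l l' * cnj (V z l'))) =
        (\<Sum>\<^sub>\<infinity>l\<in>(\<lambda>i. (i, r x)) ` {1..d}. V x l * (\<Sum>\<^sub>\<infinity>l'\<in>L. D l l' * cnj (V z l')))"
      using r[OF x] by (intro infsum_cong_neutral) (auto simp: L_def V_def split: if_splits)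
    also have "\<dots> = (\<Sum>i\<in>{1..d}. V x (i, r x) * (\<Sum>\<^sub>\<infinity>l'\<in>L. D (i, r x) l' * cnj (V z l')))"
      by (simp add: sum.reindex inj_on_def)
    also have "\<dots> = (\<Sum>i\<in>{1..d}. \<psi> i (map x qs) * (C i (r x) (r z) * cnj (\<psi> i (map z qs))))"
      by (intro sum.cong refl) (simp add: inner, simp add: V_def)
    also have "\<dots> = (\<Sum>i\<in>{1..d}. mult (configs S) (extend S qs (ketbra (\<psi> i) (\<psi> i))) (C i) x z)"
    proof (intro sum.cong refl)
      fix i assume i: "i \<in> {1..d}"
      \<comment> \<open>The only intermediate configuration that contributes: \<open>extend\<close>
        forces agreement with \<open>x\<close> off the register, triviality of \<open>C i\<close>
        forces agreement with \<open>z\<close> on it.\<close>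
      define y0 where "y0 = override_on x z (set qs)"
      have y0: "y0 \<in> configs S" using x z by (simp add: y0_def configs_override)
      have zero: "extend S qs (ketbra (\<psi> i) (\<psi> i)) x y * C i y z = 0" if y: "y \<in> configs S" "y \<noteq> y0" for y
      proof (cases "\<forall>v. v \<notin> set qs \<longrightarrow> x v = y v")
        case True
        then have "\<exists>v\<in>set qs. y v \<noteq> z v"
          using y(2) by (auto simp: y0_def override_on_def fun_eq_iff split: if_splits)
        then show ?thesis using trivial_onD1[OF triv[OF i] y(1) z] by auto
      next
        case False
        then show ?thesis by (auto simp: extend_def)
      qed
      have "mult (configs S) (extend S qs (ketbra (\<psi> i) (\<psi> i))) (C i) x z =
          (\<Sum>\<^sub>\<infinity>y\<in>{y0}. extend S qs (ketbra (\<psi> i) (\<psi> i)) x y * C i y z)"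
        unfolding mult_def using y0 zero by (intro infsum_cong_neutral) auto
      also have "\<dots> = \<psi> i (map x qs) * cnj (\<psi> i (map y0 qs)) * C i y0 z"
        using x y0 by (auto simp: extend_def ketbra_def y0_def)
      also have "map y0 qs = map z qs" by (simp add: y0_def)
      \<comment> \<open>\<open>y0\<close> and \<open>z\<close> have equal register values, so both
        can be moved to the reference \<open>w\<close> at once.\<close>
      also have "C i y0 z = C i (r y0) (r z)"
        unfolding r_def by (rule trivial_onD2[OF triv[OF i] y0 z w, symmetric]) (simp add: y0_def)
      also have "r y0 = r x" by (auto simp: r_def y0_def override_on_def)
      finally show "\<psi> i (map x qs) * (C i (r x) (r z) * cnj (\<psi> i (map z qs))) =
          mult (configs S) (extend S qs (ketbra (\<psi> i) (\<psi> i))) (C i) x z"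
        by (simp add: mult_ac)
    qed
    finally show "(\<Sum>i\<in>{1..d}. mult (configs S) (extend S qs (ketbra (\<psi> i) (\<psi> i))) (C i) x z) =
        (\<Sum>\<^sub>\<infinity>l\<in>L. V x l * (\<Sum>\<^sub>\<infinity>l'\<in>L. D l l' * cnj (V z l')))" by simp
  qed
qed

lemma csem_contraction: "wf_circuit S C \<Longrightarrow> contraction (configs S) (configs S) (csem S C)"
proof (induction C)
  case CSkip
  then show ?case by (simp add: contraction_id)
next
  case (CGate U qs)
  then have "contraction ({()} \<times> configs S) (configs S) (\<lambda>(j, x). extend S qs U x)"
    by (intro contraction_extend) (auto simp: contraction_unit contraction_unitary)
  then show ?case by (simp add: contraction_unit)
next
  case (CSeq C1 C2)
  then show ?case by (simp add: mult_def contraction_mult)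
next
  case (QIf qs d \<psi> C)
  show ?case
    unfolding csem.simps
  proof (rule contraction_QIf)
    show "contraction (configs S) (configs S) (csem S (C i))" if "i \<in> {1..d}" for i
      using QIf.IH[OF rangeI] QIf.prems that by simp
    show "trivial_on S (set qs) (csem S (C i))" if "i \<in> {1..d}" for i
      using QIf.prems that by (intro csem_trivial_on) (auto simp: Int_commute)
  qed (use QIf.prems in auto)
qed


section \<open>Programs\<close>

lemma meas_op_qop:
  assumes "register S qs" "measurement S qs outs M" "m \<in> outs"
  shows "qop (configs S) (meas_op S qs (M m))"
  unfolding meas_op_def
  by (rule qop_conjug_family[OF contraction_extend[OF assms(1) contraction_measurement[OF assms(2)]] _ assms(3)])
    (simp add: extend_def)

lemma meas_op_tr_le:
  assumes "register S qs" "measurement S qs outs M"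
    and "pos_trace_class (configs S) \<rho>" "finite J0" "J0 \<subseteq> outs"
  shows "(\<Sum>m\<in>J0. tr (configs S) (meas_op S qs (M m) \<rho>)) \<le> tr (configs S) \<rho>"
  unfolding meas_op_def
  by (rule conjug_family_tr_le[OF contraction_extend[OF assms(1) contraction_measurement[OF assms(2)]] _ assms(3-5)])
    (simp add: extend_def)

text \<open>The body is an arbitrary map on operators, so that the loop facts apply inside the
  induction of \<open>psem_qop\<close>, where only its being a quantum operation is known.\<close>

definition loop_term :: "('v, 'b) qsystem \<Rightarrow> 'v list \<Rightarrow> (nat \<Rightarrow> 'b list oper) \<Rightarrow>
    (('v \<Rightarrow> 'b) oper \<Rightarrow> ('v \<Rightarrow> 'b) oper) \<Rightarrow> nat \<Rightarrow> ('v \<Rightarrow> 'b) oper \<Rightarrow> ('v \<Rightarrow> 'b) oper" where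
  "loop_term S qs M body n = meas_op S qs (M 0) \<circ> (body \<circ> meas_op S qs (M 1)) ^^ n"

context
  fixes S :: "('v, 'b) qsystem" and qs :: "'v list" and M :: "nat \<Rightarrow> 'b list oper"
    and body :: "('v \<Rightarrow> 'b) oper \<Rightarrow> ('v \<Rightarrow> 'b) oper"
  assumes reg: "register S qs" and meas: "measurement S qs {0, 1} M" and body: "qop (configs S) body"
begin

lemma qop_step: "qop (configs S) (body \<circ> meas_op S qs (M 1))"
  by (intro qop_comp body meas_op_qop[OF reg meas]) simp

lemma qop_step_power: "qop (configs S) ((body \<circ> meas_op S qs (M 1)) ^^ n)"
proof (induction n)
  case 0
  show ?case unfolding funpow.simps id_def by (rule qop_id)
next
  case (Suc n)
  show ?case unfolding funpow.simps by (rule qop_comp[OF Suc qop_step])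
qed

lemma qop_loop_term: "qop (configs S) (loop_term S qs M body n)"
  unfolding loop_term_def by (intro qop_comp qop_step_power meas_op_qop[OF reg meas]) simp

text \<open>The sum is the trace that has left the loop, the second summand the trace still inside.
  One more guard test splits the latter, and the body does not increase it.\<close>

lemma loop_term_tr_le_lessThan:
  assumes "pos_trace_class (configs S) \<rho>"
  shows "(\<Sum>n<N. tr (configs S) (loop_term S qs M body n \<rho>)) +
    tr (configs S) (((body \<circ> meas_op S qs (M 1)) ^^ N) \<rho>) \<le> tr (configs S) \<rho>"
proof (induction N)
  case 0
  then show ?case by simp
next
  case (Suc N)
  define \<sigma> where "\<sigma> = ((body \<circ> meas_op S qs (M 1)) ^^ N) \<rho>"
  have \<sigma>: "pos_trace_class (configs S) \<sigma>"
    unfolding \<sigma>_def by (rule qop_pos[OF qop_step_power assms])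
  have "tr (configs S) (meas_op S qs (M 0) \<sigma>) + tr (configs S) (meas_op S qs (M 1) \<sigma>) \<le> tr (configs S) \<sigma>"
    using meas_op_tr_le[OF reg meas \<sigma>, of "{0, 1}"] by simp
  moreover have "tr (configs S) (body (meas_op S qs (M 1) \<sigma>)) \<le> tr (configs S) (meas_op S qs (M 1) \<sigma>)"
    by (rule qop_tr_le[OF body qop_pos[OF meas_op_qop[OF reg meas] \<sigma>]]) simp
  moreover have "loop_term S qs M body N \<rho> = meas_op S qs (M 0) \<sigma>"
    by (simp add: loop_term_def \<sigma>_def)
  moreover have "((body \<circ> meas_op S qs (M 1)) ^^ Suc N) \<rho> = body (meas_op S qs (M 1) \<sigma>)"
    by (simp add: \<sigma>_def)
  ultimately show ?case
    using Suc.IH unfolding \<sigma>_def[symmetric] by (simp only: sum.lessThan_Suc)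
qed

lemma loop_term_tr_le:
  assumes \<rho>: "pos_trace_class (configs S) \<rho>" and J0: "finite J0"
  shows "(\<Sum>n\<in>J0. tr (configs S) (loop_term S qs M body n \<rho>)) \<le> tr (configs S) \<rho>"
proof -
  have nn: "0 \<le> tr (configs S) (loop_term S qs M body n \<rho>)" for n
    by (rule tr_nonneg[OF qop_pos[OF qop_loop_term \<rho>]])
  obtain N where "J0 \<subseteq> {..<N}" using finite_nat_iff_bounded[of J0] J0 by blast
  then have "(\<Sum>n\<in>J0. tr (configs S) (loop_term S qs M body n \<rho>)) \<le> (\<Sum>n<N. tr (configs S) (loop_term S qs M body n \<rho>))"
    using nn by (intro sum_mono2) auto
  then show ?thesis
    using loop_term_tr_le_lessThan[OF \<rho>, of N] tr_nonneg[OF qop_pos[OF qop_step_power \<rho>], of N] by linarith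
qed

text \<open>The loop semantics is an ordered series, whereas \<open>qop_infsum\<close> speaks of
  unconditional sums. They agree on the trace class, which is enough for
  \<open>qop_cong\<close>.\<close>

lemma loop_sums:
  assumes "T \<in> trace_class (configs S)"
  shows "(\<lambda>n. loop_term S qs M body n T x y) sums (\<Sum>\<^sub>\<infinity>n. loop_term S qs M body n T x y)"
  by (rule has_sum_imp_sums[OF qop_family_has_sum[OF qop_loop_term loop_term_tr_le assms]])

lemma qop_loop_infsum: "qop (configs S) (\<lambda>\<rho> x y. \<Sum>\<^sub>\<infinity>n. loop_term S qs M body n \<rho> x y)"
  by (rule qop_infsum[OF qop_loop_term loop_term_tr_le])

lemma qop_loop: "qop (configs S) (\<lambda>\<rho> x y. \<Sum>n. loop_term S qs M body n \<rho> x y)"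
  by (rule qop_cong[OF qop_loop_infsum]) (intro ext sums_unique[symmetric] loop_sums)

lemma qop_loop_partial: "qop (configs S) (\<lambda>\<rho> x y. \<Sum>k<n. loop_term S qs M body k \<rho> x y)"
  using qop_infsum[of "{..<n}" "configs S" "loop_term S qs M body", OF qop_loop_term loop_term_tr_le] by simp

text \<open>Peels off the first iteration rather than the last, because the recursion tests the
  guard before it calls itself.\<close>

lemma loop_partial_Suc:
  "(\<Sum>k<Suc n. loop_term S qs M body k \<rho> x y) =
    meas_op S qs (M 0) \<rho> x y + (\<Sum>k<n. loop_term S qs M body k (body (meas_op S qs (M 1) \<rho>)) x y)"
proof -
  have "loop_term S qs M body (Suc k) \<rho> = loop_term S qs M body k (body (meas_op S qs (M 1) \<rho>))" for k
    by (simp add: loop_term_def funpow_Suc_right del: funpow.simps)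
  then show ?thesis
    unfolding sum.lessThan_Suc_shift by (simp add: loop_term_def[of _ _ _ _ 0])
qed

lemma loop_partial_tendsto:
  assumes "T \<in> trace_class (configs S)"
  shows "(\<lambda>n. \<Sum>k<n. loop_term S qs M body k T x y) \<longlonglongrightarrow> (\<Sum>n. loop_term S qs M body n T x y)"
  using loop_sums[OF assms] by (simp add: sums_def sums_unique[OF loop_sums[OF assms], symmetric])

text \<open>The difference is the entrywise limit of finite segments of the series, each a sum of
  positive operators.\<close>

lemma loop_minus_partial_psd:
  assumes \<rho>: "pos_trace_class (configs S) \<rho>"
  shows "psd (configs S) (\<lambda>x y. (\<Sum>n. loop_term S qs M body n \<rho> x y) - (\<Sum>k<n. loop_term S qs M body k \<rho> x y))"
proof (rule psd_limit[of sequentially])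
  have T: "\<rho> \<in> trace_class (configs S)" using \<rho> by (simp add: pos_trace_class_iff)
  show "\<forall>\<^sub>F m in sequentially. psd (configs S) (\<lambda>x y. (\<Sum>k<m. loop_term S qs M body k \<rho> x y) - (\<Sum>k<n. loop_term S qs M body k \<rho> x y))"
    unfolding eventually_sequentially
  proof (intro exI allI impI)
    fix m assume "n \<le> m"
    then have "(\<Sum>k<m. loop_term S qs M body k \<rho> x y) - (\<Sum>k<n. loop_term S qs M body k \<rho> x y) = (\<Sum>k\<in>{n..<m}. loop_term S qs M body k \<rho> x y)" for x y
      using sum_diff_nat_ivl[of 0 n m "\<lambda>k. loop_term S qs M body k \<rho> x y"] by (simp add: lessThan_atLeast0)
    moreover have "psd (configs S) (\<lambda>x y. \<Sum>k\<in>{n..<m}. loop_term S qs M body k \<rho> x y)"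
      using qop_pos[OF qop_loop_term \<rho>] by (intro psd_sum) (simp add: pos_trace_class_iff)
    ultimately show "psd (configs S) (\<lambda>x y. (\<Sum>k<m. loop_term S qs M body k \<rho> x y) - (\<Sum>k<n. loop_term S qs M body k \<rho> x y))"
      by simp
  qed
  show "(\<lambda>m. (\<Sum>k<m. loop_term S qs M body k \<rho> x y) - (\<Sum>k<n. loop_term S qs M body k \<rho> x y)) \<longlonglongrightarrow>
      (\<Sum>n. loop_term S qs M body n \<rho> x y) - (\<Sum>k<n. loop_term S qs M body k \<rho> x y)" for x y
    by (intro tendsto_diff tendsto_const loop_partial_tendsto T)
qed simp

end

lemma psem_qop: "wf_prog S P \<Longrightarrow> \<not> calls P \<Longrightarrow> qop (configs S) (psem S P)"
proof (induction P)
  case Skip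
  then show ?case by (simp add: qop_id)
next
  case Abort
  then show ?case by (simp add: qop_abort)
next
  case (Init qs \<psi>)
  have contr: "contraction (reg_basis S qs \<times> configs S) (configs S)
      (\<lambda>(n, x). extend S qs (ketbra \<psi> (ket n)) x)"
    using Init by (intro contraction_extend contraction_reset) auto
  show ?case
    unfolding psem.simps
    by (rule qop_infsum)
      (rule qop_conjug_family[OF contr] conjug_family_tr_le[OF contr]; simp add: extend_def)+
next
  case (Circ C)
  then show ?case by (simp add: qop_conjug csem_contraction csem_support)
next
  case (Seq P1 P2)
  then show ?case unfolding psem.simps by (intro qop_comp) auto
next
  case (Meas qs outs M P)
  have reg: "register S qs" and meas: "measurement S qs outs M" using Meas.prems by auto
  have P: "qop (configs S) (psem S (P m))" if "m \<in> outs" for m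
    using Meas that by auto
  show ?case
    unfolding psem.simps
  proof (rule qop_infsum)
    show "qop (configs S) (\<lambda>\<rho>. psem S (P m) (meas_op S qs (M m) \<rho>))" if "m \<in> outs" for m
      using qop_comp[OF meas_op_qop[OF reg meas that] P[OF that]] by (simp add: o_def)
    fix \<rho> J0 assume \<rho>: "pos_trace_class (configs S) \<rho>" and J0: "finite J0" "J0 \<subseteq> outs"
    \<comment> \<open>The branches do not increase traces, so the joint bound is inherited from the
      measurement.\<close>
    have "(\<Sum>m\<in>J0. tr (configs S) (psem S (P m) (meas_op S qs (M m) \<rho>))) \<le>
        (\<Sum>m\<in>J0. tr (configs S) (meas_op S qs (M m) \<rho>))"
      using J0 by (intro sum_mono qop_tr_le[OF P] qop_pos[OF meas_op_qop[OF reg meas] \<rho>]) auto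
    also have "\<dots> \<le> tr (configs S) \<rho>"
      by (rule meas_op_tr_le[OF reg meas \<rho> J0])
    finally show "(\<Sum>m\<in>J0. tr (configs S) (psem S (P m) (meas_op S qs (M m) \<rho>))) \<le> tr (configs S) \<rho>" .
  qed
next
  case (While qs M P)
  then show ?case
    using qop_loop[of S qs M "psem S P"] by (simp add: loop_term_def)
next
  case Ident
  then show ?case by simp
qed

text \<open>Equality holds for denotations but can fail for syntax: \<open>calls\<close> ignores
  branches outside \<open>outs\<close>, where \<open>subst\<close> may still act.\<close>

lemma psem_subst: "\<not> calls P \<Longrightarrow> psem S (subst P R) = psem S P"
proof (induction P)
  case (Meas qs outs M P)
  then show ?case by (auto intro!: ext infsum_cong)
qed auto

theorem theorem6p1:
  fixes S :: "('v, 'b) qsystem"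
    and P Q :: "('v, 'b) prog"
    and qs :: "'v list"
    and M :: "nat \<Rightarrow> 'b list oper"
  assumes "qsystem S"
    and "program S P" and "program S Q"
    and "register S qs" and "measurement S qs {0, 1} M"
  shows "prog_equiv S (Mu (Cond qs Q M (Seq P Ident))) (Plain (Seq (While qs M P) Q))"
proof -
  define I where "I = configs S"
  define F where "F = Cond qs Q M (Seq P Ident)"
  define L where "L = loop_term S qs M (psem S P)"
  have P: "qop (configs S) (psem S P)" "\<not> calls P" and Q: "qop I (psem S Q)" "\<not> calls Q"
    using assms(2,3) by (auto simp: program_def I_def intro: psem_qop)
  note loop = assms(4,5) P(1)
  have partial: "qop I (\<lambda>\<rho> x y. \<Sum>k<n. L k \<rho> x y)" for n
    unfolding I_def L_def by (rule qop_loop_partial[OF loop])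
  have While: "psem S (While qs M P) = (\<lambda>\<rho> x y. \<Sum>n. L n \<rho> x y)"
    by (simp add: L_def loop_term_def)
  have qop_While: "qop I (psem S (While qs M P))"
    unfolding While I_def L_def by (rule qop_loop[OF loop])
  have meas: "qop I (meas_op S qs (M m))" if "m \<in> {0, 1}" for m
    unfolding I_def by (rule meas_op_qop[OF assms(4,5) that])
  \<comment> \<open>The \<open>n\<close>-th approximation can test the guard \<open>n\<close> times,
    so exactly the runs that leave after \<open>k < n\<close> iterations survive; at
    \<open>n = 0\<close>, \<open>Abort\<close> meets the empty sum. Having this on the whole trace
    class also yields \<open>qop\<close> for the approximations by \<open>qop_cong\<close>.\<close>
  have approx: "psem S (approx F n) \<rho> = psem S Q (\<lambda>x y. \<Sum>k<n. L k \<rho> x y)" if "\<rho> \<in> trace_class I" for n \<rho>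
    using that
  proof (induction n arbitrary: \<rho>)
    case 0
    then show ?case using qop_zero[OF Q(1)] by (simp add: zero_op_def)
  next
    case (Suc n)
    define \<sigma> where "\<sigma> = psem S P (meas_op S qs (M 1) \<rho>)"
    have M0: "meas_op S qs (M 0) \<rho> \<in> trace_class I"
      by (rule qop_trace_class[OF meas Suc.prems]) simp
    have \<sigma>: "\<sigma> \<in> trace_class I"
      unfolding \<sigma>_def I_def
      by (rule qop_trace_class[OF P(1) qop_trace_class[OF meas Suc.prems, unfolded I_def]]) simp
    have unfold: "psem S (approx F (Suc n)) \<rho> x y =
        psem S Q (meas_op S qs (M 0) \<rho>) x y + psem S (approx F n) \<sigma> x y" for x y
      by (simp add: F_def Cond_def psem_subst P(2) Q(2) \<sigma>_def)
    \<comment> \<open>Additivity of \<open>Q\<close> merges the run that leaves at once with those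
      counted by the induction hypothesis at \<open>\<sigma>\<close>.\<close>
    have "psem S (approx F (Suc n)) \<rho> =
        psem S Q (\<lambda>x y. meas_op S qs (M 0) \<rho> x y + (\<Sum>k<n. L k \<sigma> x y))"
      by (intro ext) (simp only: unfold Suc.IH[OF \<sigma>] qop_add[OF Q(1) M0 qop_trace_class[OF partial \<sigma>]])
    then show ?case
      unfolding L_def \<sigma>_def loop_partial_Suc[OF loop] .
  qed
  have "den S (Mu F) \<rho> = psem S Q (psem S (While qs M P) \<rho>)" if \<rho>: "\<rho> \<in> partial_density I" for \<rho>
    unfolding den.simps I_def[symmetric]
  proof (rule supr_qop_order[where W = "\<lambda>\<rho>. psem S Q (psem S (While qs M P) \<rho>)", OF _ _ _ _ \<rho>])
    show "qop I (psem S (approx F n))" for n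
      by (rule qop_cong[OF qop_comp[OF partial[of n] Q(1)]]) (simp add: approx)
    show "qop I (\<lambda>\<rho>. psem S Q (psem S (While qs M P) \<rho>))"
      using qop_comp[OF qop_While Q(1)] by (simp add: o_def)
    fix \<sigma> assume "\<sigma> \<in> partial_density I"
    then have \<sigma>: "pos_trace_class I \<sigma>" "\<sigma> \<in> trace_class I"
      by (auto simp: partial_density_iff pos_trace_class_iff)
    let ?\<sigma>n = "\<lambda>n x y. \<Sum>k<n. L k \<sigma> x y" and ?\<sigma>' = "psem S (While qs M P) \<sigma>"
    have pos: "pos_trace_class I (?\<sigma>n n)" "pos_trace_class I ?\<sigma>'" for n
      by (rule qop_pos[OF partial \<sigma>(1)], rule qop_pos[OF qop_While \<sigma>(1)])
    have diff: "psd I (\<lambda>x y. ?\<sigma>' x y - ?\<sigma>n n x y)" for n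
      unfolding While I_def L_def
      by (rule loop_minus_partial_psd[OF loop]) (use \<sigma> in \<open>simp add: I_def\<close>)
    \<comment> \<open>Positivity of the tail of the series is preserved by the positive linear map
      \<open>Q\<close>.\<close>
    show "psd I (\<lambda>x y. psem S Q ?\<sigma>' x y - psem S (approx F n) \<sigma> x y)" for n
    proof -
      have "pos_trace_class I (\<lambda>x y. ?\<sigma>' x y - ?\<sigma>n n x y)"
        using diff pos by (simp add: pos_trace_class_iff trace_class_diff)
      from qop_pos[OF Q(1) this]
      have "psd I (psem S Q (\<lambda>x y. ?\<sigma>' x y - ?\<sigma>n n x y))" by (simp add: pos_trace_class_iff)
      also have "psem S Q (\<lambda>x y. ?\<sigma>' x y - ?\<sigma>n n x y) = (\<lambda>x y. psem S Q ?\<sigma>' x y - psem S Q (?\<sigma>n n) x y)"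
        by (rule qop_diff[OF Q(1)]) (use pos in \<open>auto simp: pos_trace_class_iff\<close>)
      finally show ?thesis by (simp only: approx[OF \<sigma>(2)])
    qed
    show "(\<lambda>n. psem S (approx F n) \<sigma> x y) \<longlonglongrightarrow> psem S Q ?\<sigma>' x y" for x y
      unfolding approx[OF \<sigma>(2)]
    proof (rule qop_continuous[OF Q(1) pos diff])
      show "(\<lambda>n. ?\<sigma>n n x x) \<longlonglongrightarrow> ?\<sigma>' x x" for x
        unfolding While L_def by (rule loop_partial_tendsto[OF loop]) (use \<sigma> in \<open>simp add: I_def\<close>)
    qed
  qed
  then show ?thesis
    by (simp add: prog_equiv_def F_def I_def)
qed

end
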